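(* Let $d\in\mathbb N$, $a\in\{-1,1\}$, and let $\gamma,\alpha\in\mathbb R$ satisfy $\gamma>-\min(2,d)$ and $\alpha>1+\frac{2+\gamma}{d}$. Let $l\in\mathbb R$ and $q\in[1,\infty]$ satisfy $\frac ld+\frac1q=\frac1{q_c(\gamma)}$ and $\frac{\gamma}{\alpha-1}\le l$. Let $k\in\mathbb R$, $p\in[1,\infty]$ satisfy $$\alpha<p\le\infty,\quad \frac{l+\gamma}{\alpha}\le k\le l,\quad 0\le\frac kd+\frac1p,\quad \frac{2+\gamma\alpha}{d\alpha(\alpha-1)}<\frac kd+\frac1p<\min\Big\{\frac1{q_c(\gamma)},\frac{d+\gamma}{d\alpha}\Big\}.$$ Let $\Phi(x)=\omega(x)|x|^{-\frac{2+\gamma}{\alpha-1}}$, where $\omega\in L^\infty(\mathbb R^d)$ is homogeneous of degree $0$ and $\|\omega\|_{L^\infty}$ is sufficiently small (depending only on the parameters). Then there exists a self-similar solution $u_{\mathcal S}\in\mathcal K^p_k$ of the Hardy–Hénon equation with initial data $\Phi$, and $u_{\mathcal S}(t)\to\Phi$ in $\mathcal S'(\mathbb R^d)$ as $t\to0$.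
   Context: The Hardy–Hénon equation is $\partial_tu-\Delta u=a|x|^\gamma|u|^{\alpha-1}u$ on $(0,\infty)\times\mathbb R^d$ (on $(0,\infty)\times(\mathbb R^d\setminus\{0\})$ if $\gamma<0$); a solution with initial data $\Phi$ means a solution of $u(t)=e^{t\Delta}\Phi+a\int_0^te^{(t-\tau)\Delta}\{|\cdot|^\gamma|u(\tau)|^{\alpha-1}u(\tau)\}\,d\tau$ for all $t>0$ and a.e. $x$, with $e^{t\Delta}$ the heat semigroup. A solution $u$ is self-similar if $\lambda^{\frac{2+\gamma}{\alpha-1}}u(\lambda^2t,\lambda x)=u(t,x)$ for all $\lambda>0$. $\frac1{q_c(\gamma)}=\frac{2+\gamma}{d(\alpha-1)}$. $\|f\|_{L^{p,\infty}_k}=\||\cdot|^kf\|_{L^{p,\infty}}$, where $\|g\|_{L^{p,\infty}}=\sup_{t>0}t^{1/p}g^*(t)$ with $g^*$ the decreasing rearrangement ($L^{\infty,\infty}=L^\infty$). $\|u\|_{\mathcal K^p_k}=\sup_{t>0}t^{\frac d2(\frac1{q_c(\gamma)}-\frac kd-\frac1p)}\|u(t)\|_{L^{p,\infty}_k}$; $\mathcal K^p_k$ is the set of $u\in\mathscr D'((0,\infty)\times\mathbb R^d)$ for which the corresponding supremum over $0<t<T'$ is finite for every $T'<\infty$. *)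

theory Defs
  imports "HOL-Analysis.Analysis" "HOL-Probability.Essential_Supremum"
begin

text \<open>
  The space \<open>\<real>\<^sup>d\<close> is a type \<open>'a :: euclidean_space\<close> with \<open>d = DIM('a)\<close>.  The scalar field is a type
  \<open>'b :: {real_normed_field, euclidean_space}\<close>; both \<^typ>\<open>real\<close> and \<^typ>\<open>complex\<close> are
  instances.  Functions are taken modulo Lebesgue-null sets; \<open>0 powr s = 0\<close>, so a weight
  \<open>norm x powr s\<close> has a harmless value at the origin.
\<close>

definition rearrangement :: "('a::euclidean_space \<Rightarrow> 'b::real_normed_vector) \<Rightarrow> real \<Rightarrow> ennreal" where
  "rearrangement g t =
     (INF s\<in>{s. 0 < s \<and> emeasure lebesgue {x. s < norm (g x)} \<le> ennreal t}. ennreal s)"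

text \<open>Meaningful for measurable \<open>g\<close> only; measurability is required separately.\<close>

definition weak_Lp_norm :: "ennreal \<Rightarrow> ('a::euclidean_space \<Rightarrow> 'b::real_normed_vector) \<Rightarrow> ennreal" where
  "weak_Lp_norm p g =
     (if p = \<infinity> then esssup lebesgue (\<lambda>x. ennreal (norm (g x)))
      else SUP t\<in>{0<..}. ennreal (t powr enn2real (1 / p)) * rearrangement g t)"

definition weighted_weak_Lp_norm ::
  "real \<Rightarrow> ennreal \<Rightarrow> ('a::euclidean_space \<Rightarrow> 'b::real_normed_vector) \<Rightarrow> ennreal" where
  "weighted_weak_Lp_norm k p f = weak_Lp_norm p (\<lambda>x. (norm x powr k) *\<^sub>R f x)"

definition inv_qc :: "nat \<Rightarrow> real \<Rightarrow> real \<Rightarrow> real" where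
  "inv_qc d \<gamma> \<alpha> = (2 + \<gamma>) / (real d * (\<alpha> - 1))"

text \<open>
  An element of \<open>D'((0,\<infinity>) \<times> \<real>\<^sup>d)\<close> whose norms at fixed times are finite is a function; the
  distribution it stands for is given by local integrability on \<open>(0,\<infinity>) \<times> \<real>\<^sup>d\<close>.
\<close>

definition K_space ::
  "real \<Rightarrow> real \<Rightarrow> real \<Rightarrow> ennreal \<Rightarrow> (real \<Rightarrow> 'a::euclidean_space \<Rightarrow> 'b::euclidean_space) set" where
  "K_space \<gamma> \<alpha> k p =
     {u. (\<forall>C. compact C \<and> C \<subseteq> {0<..} \<times> UNIV \<longrightarrow> (\<lambda>(t, x). u t x) absolutely_integrable_on C) \<and>
         (\<forall>t>0. u t \<in> borel_measurable lebesgue) \<and>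
         (\<forall>T. (SUP t\<in>{0<..<T}.
                 ennreal (t powr (real DIM('a) / 2 *
                   (inv_qc DIM('a) \<gamma> \<alpha> - k / real DIM('a) - enn2real (1 / p))))
                 * weighted_weak_Lp_norm k p (u t)) < \<infinity>)}"

definition heat_kernel :: "real \<Rightarrow> 'a::euclidean_space \<Rightarrow> real" where
  "heat_kernel t x = (4 * pi * t) powr (- real DIM('a) / 2) * exp (- (norm x)\<^sup>2 / (4 * t))"

text \<open>
  The Bochner integral of a non-integrable function is \<open>0\<close> by convention, hence the separate
  predicate saying that the value of the heat semigroup at a point is defined.
\<close>

definition heat_defined ::
  "real \<Rightarrow> ('a::euclidean_space \<Rightarrow> 'b::euclidean_space) \<Rightarrow> 'a \<Rightarrow> bool" where
  "heat_defined t f x \<longleftrightarrow> integrable lebesgue (\<lambda>y. heat_kernel t (x - y) *\<^sub>R f y)"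

definition heat ::
  "real \<Rightarrow> ('a::euclidean_space \<Rightarrow> 'b::euclidean_space) \<Rightarrow> 'a \<Rightarrow> 'b" where
  "heat t f x = (\<integral>y. heat_kernel t (x - y) *\<^sub>R f y \<partial>lebesgue)"

definition hh_nonlinearity ::
  "real \<Rightarrow> real \<Rightarrow> ('a::euclidean_space \<Rightarrow> 'b::euclidean_space) \<Rightarrow> 'a \<Rightarrow> 'b" where
  "hh_nonlinearity \<gamma> \<alpha> v y = (norm y powr \<gamma> * norm (v y) powr (\<alpha> - 1)) *\<^sub>R v y"

definition hardy_henon_solution ::
  "real \<Rightarrow> real \<Rightarrow> real \<Rightarrow> ('a::euclidean_space \<Rightarrow> 'b::euclidean_space) \<Rightarrow>
    (real \<Rightarrow> 'a \<Rightarrow> 'b) \<Rightarrow> bool" where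
  "hardy_henon_solution a \<gamma> \<alpha> \<Phi> u \<longleftrightarrow>
     (\<forall>t>0. AE x in lebesgue.
        heat_defined t \<Phi> x \<and>
        (AE \<tau> in lebesgue. \<tau> \<in> {0<..<t} \<longrightarrow>
           heat_defined (t - \<tau>) (hh_nonlinearity \<gamma> \<alpha> (u \<tau>)) x) \<and>
        set_integrable lebesgue {0<..<t} (\<lambda>\<tau>. heat (t - \<tau>) (hh_nonlinearity \<gamma> \<alpha> (u \<tau>)) x) \<and>
        u t x = heat t \<Phi> x +
          a *\<^sub>R (LINT \<tau>:{0<..<t}|lebesgue. heat (t - \<tau>) (hh_nonlinearity \<gamma> \<alpha> (u \<tau>)) x))"

definition self_similar ::
  "real \<Rightarrow> real \<Rightarrow> (real \<Rightarrow> 'a::euclidean_space \<Rightarrow> 'b::euclidean_space) \<Rightarrow> bool" where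
  "self_similar \<gamma> \<alpha> u \<longleftrightarrow>
     (\<forall>c>0. \<forall>t>0. \<forall>x.
        (c powr ((2 + \<gamma>) / (\<alpha> - 1))) *\<^sub>R u (c\<^sup>2 * t) (c *\<^sub>R x) = u t x)"

definition iterated_partial ::
  "'a list \<Rightarrow> ('a::euclidean_space \<Rightarrow> 'b::euclidean_space) \<Rightarrow> 'a \<Rightarrow> 'b" where
  "iterated_partial bs \<phi> = foldr (\<lambda>b f x. frechet_derivative f (at x) b) bs \<phi>"

definition schwartz_seminorm :: "nat \<Rightarrow> ('a::euclidean_space \<Rightarrow> 'b::euclidean_space) \<Rightarrow> ennreal" where
  "schwartz_seminorm N \<phi> =
     (SUP bs\<in>{bs. set bs \<subseteq> Basis \<and> length bs \<le> N}. SUP x.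
        ennreal ((1 + norm x) ^ N * norm (iterated_partial bs \<phi> x)))"

text \<open>Smoothness: all iterated partial derivatives exist and are differentiable.\<close>

definition schwartz :: "('a::euclidean_space \<Rightarrow> 'b::euclidean_space) set" where
  "schwartz =
     {\<phi>. (\<forall>bs. set bs \<subseteq> Basis \<longrightarrow> iterated_partial bs \<phi> differentiable_on UNIV) \<and>
         (\<forall>N. schwartz_seminorm N \<phi> < \<infinity>)}"

definition tempered_distribution ::
  "(('a::euclidean_space \<Rightarrow> 'b::{real_normed_field, euclidean_space}) \<Rightarrow> 'b) \<Rightarrow> bool" where
  "tempered_distribution S \<longleftrightarrow>
     (\<forall>\<phi>\<in>schwartz. \<forall>\<psi>\<in>schwartz. S (\<lambda>x. \<phi> x + \<psi> x) = S \<phi> + S \<psi>) \<and>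
     (\<forall>c. \<forall>\<phi>\<in>schwartz. S (\<lambda>x. c * \<phi> x) = c * S \<phi>) \<and>
     (\<exists>C N. \<forall>\<phi>\<in>schwartz. ennreal (norm (S \<phi>)) \<le> ennreal C * schwartz_seminorm N \<phi>)"

definition distribution_of ::
  "('a::euclidean_space \<Rightarrow> 'b::{real_normed_field, euclidean_space}) \<Rightarrow> ('a \<Rightarrow> 'b) \<Rightarrow> 'b" where
  "distribution_of f \<phi> = (\<integral>x. f x * \<phi> x \<partial>lebesgue)"

definition tempered_function ::
  "('a::euclidean_space \<Rightarrow> 'b::{real_normed_field, euclidean_space}) \<Rightarrow> bool" where
  "tempered_function f \<longleftrightarrow>
     (\<forall>\<phi>\<in>schwartz. integrable lebesgue (\<lambda>x. f x * \<phi> x)) \<and> tempered_distribution (distribution_of f)"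

text \<open>Convergence of \<open>v t\<close> to \<open>f\<close> in \<open>S'(\<real>\<^sup>d)\<close>, with its weak-* topology, as \<open>t\<close> decreases to \<open>0\<close>.\<close>

definition tends_in_tempered_at_0 ::
  "(real \<Rightarrow> 'a::euclidean_space \<Rightarrow> 'b::{real_normed_field, euclidean_space}) \<Rightarrow> ('a \<Rightarrow> 'b) \<Rightarrow> bool" where
  "tends_in_tempered_at_0 v f \<longleftrightarrow>
     (\<forall>t>0. tempered_function (v t)) \<and> tempered_function f \<and>
     (\<forall>\<phi>\<in>schwartz. ((\<lambda>t. distribution_of (v t) \<phi>) \<longlongrightarrow> distribution_of f \<phi>) (at_right 0))"

text \<open>Homogeneity of a class modulo null sets: the exceptional set may depend on \<open>c\<close>.\<close>

definition homogeneous_deg0 :: "('a::euclidean_space \<Rightarrow> 'b) \<Rightarrow> bool" where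
  "homogeneous_deg0 \<omega> \<longleftrightarrow> (\<forall>c>0. AE x in lebesgue. \<omega> (c *\<^sub>R x) = \<omega> x)"

end

theory Submission
  imports Defs "HOL-Probability.Distributions"
begin

text \<open>
  Put \<open>s = (2 + \<gamma>) / (\<alpha> - 1)\<close>, which lies in \<open>(0, d)\<close>, and \<open>m(t, x) = max (sqrt t) |x|\<close>.  The solution is
  sought among the functions with \<open>|u(t, x)| \<le> M m(t, x)\<^sup>-\<^sup>s\<close>.  The heat evolution of \<open>\<Phi>\<close> obeys such a bound.
  Since \<open>s \<alpha> = s + 2 + \<gamma>\<close>, the nonlinearity is at most a multiple of the weight
  \<open>|y| powr \<gamma> * m(\<tau>, y) powr -(s + 2 + \<gamma>)\<close>, whose Duhamel integral is again at most a multiple of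
  \<open>m(t, x)\<^sup>-\<^sup>s\<close>.  So Picard's iteration contracts pointwise for small \<open>M\<close>, without any theory of Lorentz
  spaces, and every iterate is exactly self-similar.  Membership in \<open>K\<^sup>p\<^sub>k\<close> uses only \<open>0 \<le> k + d/p \<le> s\<close>.
  As \<open>t\<close> tends to \<open>0\<close>, the heat semigroup is moved to the test function, and the Duhamel term tends to \<open>0\<close>
  pointwise away from the origin while dominated by \<open>|x|\<^sup>-\<^sup>s\<close>.
\<close>

section \<open>Powers of the norm\<close>

text \<open>The bound \<open>|u| \<le> M |x| powr (- s)\<close> alone cannot close the iteration: it
  only bounds the nonlinearity by a multiple of \<open>|x| powr (- (s + 2))\<close>, which is not
  locally integrable when \<open>s + 2 \<ge> d\<close>. Flattening the profile at height
  \<open>t powr (- s / 2)\<close> inside \<open>|x| < sqrt t\<close> cures this, because the excess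
  singularity in space can then be traded for one in time: the critical weight is at most
  \<open>\<tau> powr (- (s + 2 - B) / 2) * |y| powr (- B)\<close> for every \<open>B\<close> between
  \<open>- \<gamma>\<close> and \<open>s + 2\<close>, and the choice of \<open>B\<close> decides
  which singularity stays integrable.

  A second difficulty is null sets. The data are only Lebesgue measurable and homogeneous up to a
  null set that depends on the dilation, whereas self-similarity is asserted at every point. Bounds
  on the free evolution and on the iterates are therefore kept at every \<open>(t, x)\<close> with
  \<open>t > 0\<close>; the free evolution, being an integral, does not see null sets, and a Borel
  representative of the data makes it jointly measurable.\<close>

lemma nn_integral_lborel_affine:
  fixes f :: "'a::euclidean_space \<Rightarrow> ennreal"
  assumes [measurable]: "f \<in> borel_measurable borel" and c: "c \<noteq> 0"
  shows "(\<integral>\<^sup>+x. f x \<partial>lborel) = ennreal (\<bar>c\<bar> ^ DIM('a)) * (\<integral>\<^sup>+x. f (t + c *\<^sub>R x) \<partial>lborel)"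
proof -
  have "(\<integral>\<^sup>+x. f x \<partial>lborel) = (\<integral>\<^sup>+x. f x \<partial>density (distr lborel borel (\<lambda>x. t + c *\<^sub>R x)) (\<lambda>_. ennreal (\<bar>c\<bar> ^ DIM('a))))"
    using lborel_affine[OF c, of t] by simp
  also have "\<dots> = ennreal (\<bar>c\<bar> ^ DIM('a)) * (\<integral>\<^sup>+x. f (t + c *\<^sub>R x) \<partial>lborel)"
    by (subst nn_integral_density, measurable, subst nn_integral_distr, measurable)
       (simp add: nn_integral_cmult)
  finally show ?thesis .
qed

lemma integral_lborel_affine:
  fixes f :: "'a::euclidean_space \<Rightarrow> 'b::{banach, second_countable_topology}"
  assumes [measurable]: "f \<in> borel_measurable borel" and c: "c \<noteq> 0"
  shows "(\<integral>x. f x \<partial>lborel) = (\<bar>c\<bar> ^ DIM('a)) *\<^sub>R (\<integral>x. f (t + c *\<^sub>R x) \<partial>lborel)"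
proof -
  have "(\<integral>x. f x \<partial>lborel) = (\<integral>x. f x \<partial>density (distr lborel borel (\<lambda>x. t + c *\<^sub>R x)) (\<lambda>_. ennreal (\<bar>c\<bar> ^ DIM('a))))"
    using lborel_affine[OF c, of t] by simp
  also have "\<dots> = (\<integral>x. (\<bar>c\<bar> ^ DIM('a)) *\<^sub>R f x \<partial>distr lborel borel (\<lambda>x. t + c *\<^sub>R x))"
    by (rule integral_density) auto
  also have "\<dots> = (\<integral>x. (\<bar>c\<bar> ^ DIM('a)) *\<^sub>R f (t + c *\<^sub>R x) \<partial>lborel)"
    by (rule integral_distr) auto
  also have "\<dots> = (\<bar>c\<bar> ^ DIM('a)) *\<^sub>R (\<integral>x. f (t + c *\<^sub>R x) \<partial>lborel)"
    by simp
  finally show ?thesis .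
qed

text \<open>The initial data are only Lebesgue measurable, so dilations are needed on the completed
  measure as well as on \<open>lborel\<close>.\<close>

lemma lebesgue_scaleR:
  fixes c :: real
  assumes c: "c \<noteq> 0"
  shows measurable_lebesgue_scaleR: "(\<lambda>x::'a::euclidean_space. c *\<^sub>R x) \<in> lebesgue \<rightarrow>\<^sub>M lebesgue"
    and lebesgue_eq_density_scaleR: "(lebesgue :: 'a measure) = density (distr lebesgue lebesgue (\<lambda>x. c *\<^sub>R x)) (\<lambda>_. ennreal (\<bar>c\<bar> ^ DIM('a)))"
proof -
  have T: "(\<Sum>j\<in>Basis. (c * (x \<bullet> j)) *\<^sub>R j) = c *\<^sub>R x" for x :: 'a
    by (metis (no_types, lifting) euclidean_representation scaleR_scaleR scaleR_sum_right sum.cong)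
  show "(\<lambda>x::'a. c *\<^sub>R x) \<in> lebesgue \<rightarrow>\<^sub>M lebesgue"
    using lebesgue_affine_measurable[of "\<lambda>_. c" "0::'a"] c by (simp add: T)
  show "(lebesgue :: 'a measure) = density (distr lebesgue lebesgue (\<lambda>x. c *\<^sub>R x)) (\<lambda>_. ennreal (\<bar>c\<bar> ^ DIM('a)))"
    using lebesgue_affine_euclidean[of "\<lambda>_. c" "0::'a"] c by (simp add: T)
qed

lemma integral_lebesgue_scaleR:
  fixes f :: "'a::euclidean_space \<Rightarrow> 'b::{banach, second_countable_topology}"
  assumes [measurable]: "f \<in> borel_measurable lebesgue" and c: "c \<noteq> 0"
  shows "(\<integral>x. f x \<partial>lebesgue) = (\<bar>c\<bar> ^ DIM('a)) *\<^sub>R (\<integral>x. f (c *\<^sub>R x) \<partial>lebesgue)"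
proof -
  note [measurable] = measurable_lebesgue_scaleR[OF c] and eq = lebesgue_eq_density_scaleR[OF c, where 'a='a]
  have "(\<integral>x. f x \<partial>lebesgue) = (\<integral>x. f x \<partial>density (distr lebesgue lebesgue (\<lambda>x. c *\<^sub>R x)) (\<lambda>_. ennreal (\<bar>c\<bar> ^ DIM('a))))"
    using eq by simp
  also have "\<dots> = (\<integral>x. (\<bar>c\<bar> ^ DIM('a)) *\<^sub>R f x \<partial>distr lebesgue lebesgue (\<lambda>x. c *\<^sub>R x))"
    by (rule integral_density) auto
  also have "\<dots> = (\<integral>x. (\<bar>c\<bar> ^ DIM('a)) *\<^sub>R f (c *\<^sub>R x) \<partial>lebesgue)"
    by (rule integral_distr) auto
  also have "\<dots> = (\<bar>c\<bar> ^ DIM('a)) *\<^sub>R (\<integral>x. f (c *\<^sub>R x) \<partial>lebesgue)"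
    by simp
  finally show ?thesis .
qed

text \<open>Only the growth like \<open>r ^ DIM('a)\<close> matters, so the volume of the unit ball
  stays an abstract constant and a dilation does the rest.\<close>

lemma emeasure_lborel_ball_eq:
  assumes r: "0 < r"
  shows "emeasure lborel (ball (0::'a::euclidean_space) r) = ennreal (measure lborel (ball (0::'a) 1) * r ^ DIM('a))"
proof -
  have "emeasure lborel (ball (0::'a) r) = (\<integral>\<^sup>+x. indicator (ball (0::'a) r) x \<partial>lborel)" by simp
  also have "\<dots> = ennreal (\<bar>r\<bar> ^ DIM('a)) * (\<integral>\<^sup>+x. indicator (ball (0::'a) r) (0 + r *\<^sub>R x) \<partial>lborel)"
    using r by (intro nn_integral_lborel_affine) (auto intro!: borel_measurable_indicator)
  also have "(\<lambda>x::'a. indicator (ball (0::'a) r) (0 + r *\<^sub>R x) :: ennreal) = indicator (ball 0 1)"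
    using r by (auto simp: indicator_def fun_eq_iff)
  also have "(\<integral>\<^sup>+x. indicator (ball (0::'a) 1) x \<partial>lborel) = emeasure lborel (ball (0::'a) 1)" by simp
  also have "\<dots> = ennreal (measure lborel (ball (0::'a) 1))"
    using emeasure_lborel_ball_finite[of "0::'a" 1] by (intro emeasure_eq_ennreal_measure) auto
  finally show ?thesis using r by (simp add: ennreal_mult'' mult.commute)
qed

lemma exists_dyadic_bracket:
  fixes r :: real assumes "0 < r" "r < 1"
  shows "\<exists>n::nat. (1/2) ^ Suc n \<le> r \<and> r < (1/2) ^ n"
proof -
  define n where "n = (LEAST n. (1/2) ^ Suc n \<le> r)"
  obtain m where "(1/2::real) ^ m < r" using assms real_arch_pow_inv[of r "1/2"] by auto
  then have "(1/2::real) ^ Suc m \<le> r" using power_decreasing[of m "Suc m" "1/2::real"] by linarith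
  then have 1: "(1/2) ^ Suc n \<le> r" unfolding n_def by (rule LeastI)
  have "r < (1/2) ^ n"
  proof (cases n)
    case (Suc k)
    then have "\<not> (1/2) ^ Suc k \<le> r" using not_less_Least[of k "\<lambda>n. (1/2) ^ Suc n \<le> r"] n_def by simp
    then show ?thesis using Suc by simp
  qed (use assms in simp)
  with 1 show ?thesis by blast
qed

lemma ennreal_le_suminf: "f n \<le> (\<Sum>n. f n)" for f :: "nat \<Rightarrow> ennreal"
  using sum_le_suminf[OF summableI, of "{n}" f] by simp

lemma ball_borel_measurable [measurable]: "ball x r \<in> sets borel"
  by simp

text \<open>A dyadic decomposition replaces polar coordinates. The shell with outer radius
  \<open>(1/2) ^ n\<close> is enlarged to the full ball; it then contributes
  \<open>2 powr B * V * q ^ n\<close>, and the ratio \<open>q\<close> is below 1 exactly because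
  \<open>B < DIM('a)\<close>.\<close>

lemma nn_integral_norm_powr_unit_ball_finite:
  fixes B :: real
  assumes B: "0 \<le> B" "B < DIM('a)"
  shows "(\<integral>\<^sup>+y. ennreal (norm (y::'a::euclidean_space) powr (-B)) * indicator (ball 0 1) y \<partial>lborel) < \<infinity>"
proof -
  define V where "V = measure lborel (ball (0::'a) 1)"
  define q where "q = 2 powr (B - DIM('a))"
  have q: "0 \<le> q" "q < 1" using B by (auto simp: q_def powr_less_one)
  have "(\<integral>\<^sup>+y. ennreal (norm (y::'a) powr (-B)) * indicator (ball 0 1) y \<partial>lborel)
    \<le> (\<integral>\<^sup>+y. (\<Sum>n. ennreal (2 powr (B * (real n + 1))) * indicator (ball (0::'a) ((1/2)^n)) y) \<partial>lborel)"
  proof (intro nn_integral_mono)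
    fix y :: 'a
    show "ennreal (norm y powr (-B)) * indicator (ball 0 1) y
      \<le> (\<Sum>n. ennreal (2 powr (B * (real n + 1))) * indicator (ball (0::'a) ((1/2)^n)) y)"
    proof (cases "y \<noteq> 0 \<and> norm y < 1")
      case True
      then obtain n where n: "(1/2) ^ Suc n \<le> norm y" "norm y < (1/2) ^ n"
        using exists_dyadic_bracket[of "norm y"] by auto
      have "norm y powr (-B) \<le> ((1/2) ^ Suc n) powr (-B)"
        using n B by (intro powr_mono2') auto
      also have "((1/2::real) ^ Suc n) powr (-B) = 2 powr (B * (real n + 1))"
      proof -
        have "(1/2::real) ^ Suc n = 2 powr (- (real n + 1))"
        proof -
          have "2 powr (- (real n + 1)) = inverse (2 powr real (Suc n))"
            unfolding powr_minus[symmetric] by (simp add: add.commute)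
          also have "\<dots> = (1/2) ^ Suc n"
            by (subst powr_realpow) (simp_all add: power_one_over inverse_eq_divide)
          finally show ?thesis by simp
        qed
        then show ?thesis by (simp add: powr_powr algebra_simps del: power_Suc)
      qed
      finally have "ennreal (norm y powr (-B)) * indicator (ball 0 1) y
        \<le> ennreal (2 powr (B * (real n + 1))) * indicator (ball (0::'a) ((1/2)^n)) y"
        using n by (auto simp: indicator_def intro!: ennreal_leI)
      also have "\<dots> \<le> (\<Sum>n. ennreal (2 powr (B * (real n + 1))) * indicator (ball (0::'a) ((1/2)^n)) y)"
        by (rule ennreal_le_suminf)
      finally show ?thesis .
    qed auto
  qed
  also have "\<dots> = (\<Sum>n. \<integral>\<^sup>+y. ennreal (2 powr (B * (real n + 1))) * indicator (ball (0::'a) ((1/2)^n)) y \<partial>lborel)"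
    by (intro nn_integral_suminf) auto
  also have "\<dots> = (\<Sum>n. ennreal (2 powr B * V * q ^ n))"
  proof (intro suminf_cong)
    fix n
    have "(\<integral>\<^sup>+y. ennreal (2 powr (B * (real n + 1))) * indicator (ball (0::'a) ((1/2)^n)) y \<partial>lborel)
       = ennreal (2 powr (B * (real n + 1))) * ennreal (V * ((1/2)^n) ^ DIM('a))"
      by (simp add: nn_integral_cmult_indicator emeasure_lborel_ball_eq V_def)
    also have "\<dots> = ennreal (2 powr (B * (real n + 1)) * (V * ((1/2)^n) ^ DIM('a)))"
      by (simp add: ennreal_mult' V_def)
    also have "2 powr (B * (real n + 1)) * (V * ((1/2)^n) ^ DIM('a)) = 2 powr B * V * q ^ n"
    proof -
      have "q ^ n = 2 powr (B * n - DIM('a) * n)"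
        by (simp add: q_def powr_realpow[symmetric] powr_powr algebra_simps)
      also have "\<dots> = 2 powr (B * n) * ((1/2)^n) ^ DIM('a)"
        by (simp add: powr_diff powr_realpow[symmetric] powr_powr power_one_over mult.commute flip: power_mult of_nat_mult)
      finally show ?thesis by (simp add: powr_add algebra_simps)
    qed
    finally show "(\<integral>\<^sup>+y. ennreal (2 powr (B * (real n + 1))) * indicator (ball (0::'a) ((1/2)^n)) y \<partial>lborel) = ennreal (2 powr B * V * q ^ n)" .
  qed
  also have "\<dots> = ennreal (\<Sum>n. 2 powr B * V * q ^ n)"
    using q by (intro suminf_ennreal2) (auto simp: V_def intro!: summable_mult summable_geometric)
  also have "\<dots> < \<infinity>" by simp
  finally show ?thesis .
qed

text \<open>Dilation to the unit ball: the Jacobian and the homogeneity of the weight give the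
  exponent, and the constant is the integral over the unit ball.\<close>

lemma nn_integral_norm_powr_ball_le:
  fixes B :: real
  assumes B: "0 \<le> B" "B < DIM('a)"
  shows "\<exists>C\<ge>0. \<forall>r>0. (\<integral>\<^sup>+y. ennreal (norm (y::'a::euclidean_space) powr (-B)) * indicator (ball 0 r) y \<partial>lborel)
            = ennreal (C * r powr (DIM('a) - B))"
proof -
  define I where "I = (\<integral>\<^sup>+y. ennreal (norm (y::'a) powr (-B)) * indicator (ball 0 1) y \<partial>lborel)"
  have I: "I < \<infinity>" unfolding I_def using B by (rule nn_integral_norm_powr_unit_ball_finite)
  have "(\<integral>\<^sup>+y. ennreal (norm (y::'a) powr (-B)) * indicator (ball 0 r) y \<partial>lborel)
      = ennreal (enn2real I * r powr (DIM('a) - B))" if r: "r > 0" for r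
  proof -
    have "(\<integral>\<^sup>+y. ennreal (norm (y::'a) powr (-B)) * indicator (ball 0 r) y \<partial>lborel)
      = ennreal (\<bar>r\<bar> ^ DIM('a)) * (\<integral>\<^sup>+y. ennreal (norm (0 + r *\<^sub>R y::'a) powr (-B)) * indicator (ball 0 r) (0 + r *\<^sub>R y) \<partial>lborel)"
      using r by (intro nn_integral_lborel_affine) (auto intro!: borel_measurable_times_ennreal borel_measurable_indicator)
    also have "(\<integral>\<^sup>+y. ennreal (norm (0 + r *\<^sub>R y::'a) powr (-B)) * indicator (ball 0 r) (0 + r *\<^sub>R y) \<partial>lborel)
      = (\<integral>\<^sup>+y. ennreal (r powr (-B)) * (ennreal (norm (y::'a) powr (-B)) * indicator (ball 0 1) y) \<partial>lborel)"
      using r by (intro nn_integral_cong) (auto simp: powr_mult ennreal_mult' indicator_def)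
    also have "\<dots> = ennreal (r powr (-B)) * I"
      unfolding I_def by (rule nn_integral_cmult) auto
    also have "I = ennreal (enn2real I)" using I by simp
    also have "ennreal (\<bar>r\<bar> ^ DIM('a)) * (ennreal (r powr - B) * ennreal (enn2real I))
       = ennreal (enn2real I * r powr (DIM('a) - B))"
    proof -
      have "\<bar>r\<bar> ^ DIM('a) * (r powr - B * enn2real I) = enn2real I * r powr (DIM('a) - B)"
      proof -
        have "r powr (DIM('a) - B) = r ^ DIM('a) * r powr (- B)"
          using r by (metis add_uminus_conv_diff powr_add powr_realpow)
        then show ?thesis using r by (simp add: mult_ac)
      qed
      then show ?thesis using r by (simp flip: ennreal_mult')
    qed
    finally show ?thesis .
  qed
  then show ?thesis by (intro exI[of _ "enn2real I"]) auto
qed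

text \<open>The dyadic argument with outward shells: the ratio is
  \<open>2 powr (DIM('a) - E)\<close>, and \<open>E > DIM('a)\<close> makes the series
  converge.\<close>

lemma nn_integral_norm_powr_outside_finite:
  fixes E :: real
  assumes E: "DIM('a) < E"
  shows "(\<integral>\<^sup>+y. ennreal (norm (y::'a::euclidean_space) powr (-E)) * indicator (- ball 0 1) y \<partial>lborel) < \<infinity>"
proof -
  define V where "V = measure lborel (ball (0::'a) 1)"
  define q where "q = 2 powr (DIM('a) - E)"
  have q: "0 \<le> q" "q < 1" using E by (auto simp: q_def powr_less_one)
  have E0: "0 < E" using E by (meson le_less_trans of_nat_0_le_iff)
  have "(\<integral>\<^sup>+y. ennreal (norm (y::'a) powr (-E)) * indicator (- ball 0 1) y \<partial>lborel)
    \<le> (\<integral>\<^sup>+y. (\<Sum>n. ennreal (2 powr (- E * real n)) * indicator (ball (0::'a) (2 ^ Suc n)) y) \<partial>lborel)"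
  proof (intro nn_integral_mono)
    fix y :: 'a
    show "ennreal (norm y powr (-E)) * indicator (- ball 0 1) y
      \<le> (\<Sum>n. ennreal (2 powr (- E * real n)) * indicator (ball (0::'a) (2 ^ Suc n)) y)"
    proof (cases "norm y < 1")
      case False
      then have "\<exists>n::nat. 2 ^ n \<le> norm y \<and> norm y < 2 ^ Suc n"
      proof (cases "norm y = 1")
        case True then show ?thesis by (intro exI[of _ 0]) auto
      next
        case F: False
        then have "1 < norm y" using False by simp
        then obtain m where m: "norm y < 2 ^ m" using real_arch_pow[of 2 "norm y"] by auto
        define n where "n = (LEAST n. norm y < 2 ^ Suc n)"
        have "norm y < 2 ^ Suc m" using m power_increasing[of m "Suc m" "2::real"] by linarith
        then have 1: "norm y < 2 ^ Suc n" unfolding n_def by (rule LeastI)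
        have "2 ^ n \<le> norm y"
        proof (cases n)
          case (Suc k)
          then have "\<not> norm y < 2 ^ Suc k" using not_less_Least[of k "\<lambda>n. norm y < 2 ^ Suc n"] n_def by simp
          then show ?thesis using Suc by simp
        qed (use False in simp)
        with 1 show ?thesis by blast
      qed
      then obtain n where n: "2 ^ n \<le> norm y" "norm y < 2 ^ Suc n" by blast
      have "norm y powr (-E) \<le> (2 ^ n) powr (-E)"
        using n E0 by (intro powr_mono2') auto
      also have "(2 ^ n) powr (-E) = 2 powr (- E * real n)"
        by (simp add: powr_realpow[symmetric] powr_powr mult.commute)
      finally have "ennreal (norm y powr (-E)) * indicator (- ball 0 1) y
        \<le> ennreal (2 powr (- E * real n)) * indicator (ball (0::'a) (2 ^ Suc n)) y"
        using n by (auto simp: indicator_def intro!: ennreal_leI)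
      also have "\<dots> \<le> (\<Sum>n. ennreal (2 powr (- E * real n)) * indicator (ball (0::'a) (2 ^ Suc n)) y)"
        by (rule ennreal_le_suminf)
      finally show ?thesis .
    qed auto
  qed
  also have "\<dots> = (\<Sum>n. \<integral>\<^sup>+y. ennreal (2 powr (- E * real n)) * indicator (ball (0::'a) (2 ^ Suc n)) y \<partial>lborel)"
    by (intro nn_integral_suminf) auto
  also have "\<dots> = (\<Sum>n. ennreal (2 ^ DIM('a) * V * q ^ n))"
  proof (intro suminf_cong)
    fix n
    have "(\<integral>\<^sup>+y. ennreal (2 powr (- E * real n)) * indicator (ball (0::'a) (2 ^ Suc n)) y \<partial>lborel)
       = ennreal (2 powr (- E * real n)) * ennreal (V * (2 ^ Suc n) ^ DIM('a))"
      by (subst nn_integral_cmult_indicator) (auto simp: emeasure_lborel_ball_eq V_def simp del: power_Suc)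
    also have "\<dots> = ennreal (2 powr (- E * real n) * (V * (2 ^ Suc n) ^ DIM('a)))"
      by (simp add: ennreal_mult' V_def)
    also have "2 powr (- E * real n) * (V * (2 ^ Suc n) ^ DIM('a)) = 2 ^ DIM('a) * V * q ^ n"
    proof -
      have "q ^ n = 2 powr (DIM('a) * n + - E * n)"
        by (simp add: q_def powr_realpow[symmetric] powr_powr algebra_simps)
      also have "\<dots> = (2 ^ n) ^ DIM('a) * 2 powr (- E * n)"
        unfolding powr_add by (simp add: mult.commute powr_realpow flip: power_mult of_nat_mult)
      finally show ?thesis by (simp add: power_mult_distrib algebra_simps)
    qed
    finally show "(\<integral>\<^sup>+y. ennreal (2 powr (- E * real n)) * indicator (ball (0::'a) (2 ^ Suc n)) y \<partial>lborel) = ennreal (2 ^ DIM('a) * V * q ^ n)" .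
  qed
  also have "\<dots> = ennreal (\<Sum>n. 2 ^ DIM('a) * V * q ^ n)"
    using q by (intro suminf_ennreal2) (auto simp: V_def intro!: summable_mult summable_geometric)
  also have "\<dots> < \<infinity>" by simp
  finally show ?thesis .
qed

text \<open>This profile is the majorant in every pairing with a test function: the first power
  governs the singularity at the origin, the second the decay at infinity.\<close>

lemma integrable_min_norm_powr:
  fixes s E :: real
  assumes "0 \<le> s" "s < DIM('a)" "DIM('a) < E"
  shows "integrable lborel (\<lambda>y::'a::euclidean_space. min (norm y powr (-s)) (norm y powr (-E)))"
proof (intro integrableI_bounded)
  have "(\<integral>\<^sup>+y. ennreal (norm (min (norm (y::'a) powr (-s)) (norm y powr (-E)))) \<partial>lborel)
     \<le> (\<integral>\<^sup>+y. ennreal (norm (y::'a) powr (-s)) * indicator (ball 0 1) y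
        + ennreal (norm y powr (-E)) * indicator (- ball 0 1) y \<partial>lborel)"
    by (intro nn_integral_mono) (auto simp: indicator_def min_def intro!: ennreal_leI)
  also have "\<dots> = (\<integral>\<^sup>+y. ennreal (norm (y::'a) powr (-s)) * indicator (ball 0 1) y \<partial>lborel)
        + (\<integral>\<^sup>+y. ennreal (norm (y::'a) powr (-E)) * indicator (- ball 0 1) y \<partial>lborel)"
    by (intro nn_integral_add) auto
  also have "\<dots> < \<infinity>"
    using nn_integral_norm_powr_unit_ball_finite[OF assms(1,2)]
      nn_integral_norm_powr_outside_finite[OF assms(3)] by simp
  finally show "(\<integral>\<^sup>+y. ennreal (norm (min (norm (y::'a) powr (-s)) (norm y powr (-E)))) \<partial>lborel) < \<infinity>" .
qed auto

section \<open>The heat kernel\<close>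

lemma heat_kernel_nonneg [simp]: "0 \<le> heat_kernel t x"
  by (simp add: heat_kernel_def)

lemma heat_kernel_minus: "heat_kernel t (- x) = heat_kernel t x"
  by (simp add: heat_kernel_def)

lemma heat_kernel_commute: "heat_kernel t (x - y) = heat_kernel t (y - x)"
  by (simp add: heat_kernel_def norm_minus_commute)

lemma borel_measurable_heat_kernel [measurable (raw)]:
  assumes [measurable]: "f \<in> borel_measurable M" "g \<in> borel_measurable M"
  shows "(\<lambda>w. heat_kernel (f w) (g w)) \<in> borel_measurable M"
  unfolding heat_kernel_def by measurable

lemma heat_kernel_scaleR:
  fixes x :: "'a::euclidean_space"
  assumes "0 < c" "0 < t"
  shows "heat_kernel (c\<^sup>2 * t) (c *\<^sub>R x) = heat_kernel t x / c ^ DIM('a)"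
proof -
  have "(4 * pi * (c\<^sup>2 * t)) powr (- real DIM('a) / 2) = (4 * pi * t) powr (- real DIM('a) / 2) * (c\<^sup>2) powr (- real DIM('a) / 2)"
    using assms by (simp add: powr_mult[symmetric] mult_ac)
  also have "(c\<^sup>2) powr (- real DIM('a) / 2) = 1 / c ^ DIM('a)"
  proof -
    have "(c\<^sup>2) powr (- real DIM('a) / 2) = (c powr 2) powr (- real DIM('a) / 2)"
      using assms by simp
    also have "\<dots> = c powr (- real DIM('a))" by (simp only: powr_powr) simp
    also have "\<dots> = 1 / c ^ DIM('a)" using assms by (simp add: powr_minus powr_realpow divide_inverse)
    finally show ?thesis .
  qed
  moreover have "(norm (c *\<^sub>R x))\<^sup>2 / (4 * (c\<^sup>2 * t)) = (norm x)\<^sup>2 / (4 * t)"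
    using assms by (simp add: power_mult_distrib)
  ultimately show ?thesis
    unfolding heat_kernel_def by (simp add: field_simps)
qed

text \<open>The kernel is the density of \<open>d\<close> independent centred Gaussian variables of
  variance \<open>2 * t\<close>, so that its total mass reduces to dimension one.\<close>

lemma heat_kernel_eq_prod_normal_density:
  fixes z :: "'a::euclidean_space"
  assumes t: "0 < t"
  shows "heat_kernel t z = (\<Prod>b\<in>Basis. normal_density 0 (sqrt (2 * t)) (z \<bullet> b))"
proof -
  have "(\<Prod>b\<in>(Basis::'a set). normal_density 0 (sqrt (2 * t)) (z \<bullet> b))
     = (\<Prod>b\<in>(Basis::'a set). 1 / sqrt (4 * pi * t)) * (\<Prod>b\<in>(Basis::'a set). exp (- (z \<bullet> b)\<^sup>2 / (4 * t)))"
    unfolding prod.distrib[symmetric] using t by (simp add: normal_density_def mult_ac)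
  also have "(\<Prod>b\<in>(Basis::'a set). exp (- (z \<bullet> b)\<^sup>2 / (4 * t))) = exp (\<Sum>b\<in>(Basis::'a set). - (z \<bullet> b)\<^sup>2 / (4 * t))"
    by (simp add: exp_sum)
  also have "(\<Sum>b\<in>(Basis::'a set). - (z \<bullet> b)\<^sup>2 / (4 * t)) = - (norm z)\<^sup>2 / (4 * t)"
    unfolding power2_norm_eq_inner euclidean_inner[of z z]
    by (simp add: sum_negf sum_divide_distrib power2_eq_square)
  also have "(\<Prod>b\<in>(Basis::'a set). 1 / sqrt (4 * pi * t)) = (4 * pi * t) powr (- real DIM('a) / 2)"
  proof -
    have "(4 * pi * t) powr (- real DIM('a) / 2) = ((4 * pi * t) powr (1/2)) powr (- real DIM('a))"
      by (simp only: powr_powr) simp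
    also have "\<dots> = sqrt (4 * pi * t) powr (- real DIM('a))" using t by (simp add: powr_half_sqrt)
    also have "\<dots> = 1 / sqrt (4 * pi * t) ^ DIM('a)" using t by (subst powr_minus, subst powr_realpow) (auto simp: divide_inverse)
    finally show ?thesis by (simp add: power_one_over)
  qed
  finally show ?thesis by (simp add: heat_kernel_def)
qed

lemma nn_integral_heat_kernel:
  fixes x :: "'a::euclidean_space"
  assumes t: "0 < t"
  shows "(\<integral>\<^sup>+y. ennreal (heat_kernel t (x - y)) \<partial>lborel) = 1"
proof -
  have 1: "(\<integral>\<^sup>+z. ennreal (normal_density 0 (sqrt (2 * t)) z) \<partial>lborel) = 1"
    using t by (subst nn_integral_eq_integral) auto
  have "(\<integral>\<^sup>+z. ennreal (heat_kernel t (z::'a)) \<partial>lborel)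
     = (\<integral>\<^sup>+z. (\<Prod>b\<in>Basis. ennreal (normal_density 0 (sqrt (2 * t)) (z \<bullet> b))) \<partial>(lborel::'a measure))"
    using t by (simp add: heat_kernel_eq_prod_normal_density prod_ennreal)
  also have "\<dots> = (\<Prod>b\<in>(Basis::'a set). (\<integral>\<^sup>+z. ennreal (normal_density 0 (sqrt (2 * t)) z) \<partial>lborel))"
    by (intro nn_integral_lborel_prod) auto
  also have "\<dots> = 1" by (simp add: 1)
  finally have 2: "(\<integral>\<^sup>+z. ennreal (heat_kernel t (z::'a)) \<partial>lborel) = 1" .
  have "(\<integral>\<^sup>+z. ennreal (heat_kernel t (z::'a)) \<partial>lborel)
    = ennreal (\<bar>-1\<bar> ^ DIM('a)) * (\<integral>\<^sup>+y. ennreal (heat_kernel t (x + (-1) *\<^sub>R y)) \<partial>lborel)"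
    by (rule nn_integral_lborel_affine) auto
  then show ?thesis using 2 by simp
qed

lemma integrable_heat_kernel: "0 < t \<Longrightarrow> integrable lborel (\<lambda>y. heat_kernel t (x - y))"
  for x :: "'a::euclidean_space"
  by (intro integrableI_bounded) (auto simp: nn_integral_heat_kernel)

lemma integral_heat_kernel: "0 < t \<Longrightarrow> (\<integral>y. heat_kernel t (x - y) \<partial>lborel) = 1"
  for x :: "'a::euclidean_space"
  by (subst integral_eq_nn_integral) (auto simp: nn_integral_heat_kernel)

section \<open>Power bounds in terms of the parabolic distance to the origin\<close>

definition parabolic_norm :: "real \<Rightarrow> 'a::euclidean_space \<Rightarrow> real" where
  "parabolic_norm t x = max (sqrt t) (norm x)"

lemma borel_measurable_parabolic_norm [measurable (raw)]:
  assumes [measurable]: "f \<in> borel_measurable M" "g \<in> borel_measurable M"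
  shows "(\<lambda>w. parabolic_norm (f w) (g w)) \<in> borel_measurable M"
  unfolding parabolic_norm_def by measurable

lemma parabolic_norm_pos: "0 < t \<Longrightarrow> 0 < parabolic_norm t x"
  by (simp add: parabolic_norm_def less_max_iff_disj)

lemma parabolic_norm_powr_le_norm:
  "x \<noteq> 0 \<Longrightarrow> 0 \<le> B \<Longrightarrow> parabolic_norm t x powr (- B) \<le> norm x powr (- B)"
  by (intro powr_mono2') (auto simp: parabolic_norm_def)

lemma parabolic_norm_powr_le_sqrt:
  "0 < t \<Longrightarrow> 0 \<le> B \<Longrightarrow> parabolic_norm t x powr (- B) \<le> t powr (- B / 2)"
proof -
  assume "0 < t" "0 \<le> B"
  then have "parabolic_norm t x powr (- B) \<le> sqrt t powr (- B)"
    by (intro powr_mono2') (auto simp: parabolic_norm_def)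
  also have "\<dots> = t powr (- B / 2)"
    using \<open>0 < t\<close> by (simp add: powr_half_sqrt[symmetric] powr_powr)
  finally show ?thesis .
qed

text \<open>This is \<open>ln x \<le> x - 1\<close> at \<open>x = u / a\<close>; the factor
  \<open>exp (- a)\<close> of the sharp constant is given away.\<close>

lemma powr_exp_bound:
  fixes a u :: real
  assumes "0 < a" "0 < u"
  shows "exp (- u) \<le> a powr a * u powr (- a)"
proof -
  have "a * ln (u / a) \<le> a * (u / a - 1)"
    using assms by (intro mult_left_mono ln_le_minus_one) auto
  also have "\<dots> \<le> u" using assms by (simp add: algebra_simps)
  finally have "(u / a) powr a \<le> exp u" using assms by (simp add: powr_def)
  then have "u powr a \<le> a powr a * exp u"
    using assms by (simp add: powr_divide divide_le_eq mult.commute)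
  then have "a powr a * inverse (a powr a * exp u) \<le> a powr a * inverse (u powr a)"
    using assms by (intro mult_left_mono le_imp_inverse_le) auto
  also have "a powr a * inverse (a powr a * exp u) = inverse (exp u)" using assms by simp
  finally show ?thesis using assms by (simp only: powr_minus exp_minus)
qed

text \<open>For \<open>sqrt t < norm z\<close> the Gaussian is traded for a power by
  \<open>powr_exp_bound\<close>; the exponent \<open>d / 2\<close> is the one for which all powers
  of \<open>t\<close> cancel and a pure \<open>norm z powr (- d)\<close> remains. For smaller
  \<open>z\<close> the prefactor alone suffices.\<close>

lemma heat_kernel_le_parabolic_norm:
  "\<exists>K>0. \<forall>t>0. \<forall>z::'a::euclidean_space. heat_kernel t z \<le> K * parabolic_norm t z powr (- real DIM('a))"
proof -
  define a where "a = real DIM('a) / 2"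
  have a: "0 < a" by (simp add: a_def)
  define K where "K = max ((4 * pi) powr (- a)) (a powr a * pi powr (- a))"
  have "heat_kernel t z \<le> K * parabolic_norm t z powr (- real DIM('a))" if t: "0 < t" for t and z :: 'a
  proof (cases "norm z \<le> sqrt t")
    case True
    have "heat_kernel t z \<le> (4 * pi * t) powr (- a) * 1"
      unfolding heat_kernel_def a_def using t by (intro mult_mono) auto
    also have "\<dots> = (4 * pi) powr (- a) * (t powr (1/2)) powr (- real DIM('a))"
      using t by (simp add: powr_mult powr_powr a_def)
    also have "\<dots> \<le> K * parabolic_norm t z powr (- real DIM('a))"
      using True t by (intro mult_mono) (auto simp: K_def parabolic_norm_def max_def powr_half_sqrt)
    finally show ?thesis .
  next
    case False
    then have z: "norm z > 0" using real_sqrt_gt_zero[OF t] by linarith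
    have "heat_kernel t z = (4 * pi * t) powr (- a) * exp (- ((norm z)\<^sup>2 / (4 * t)))"
      by (simp add: heat_kernel_def a_def)
    also have "\<dots> \<le> (4 * pi * t) powr (- a) * (a powr a * ((norm z)\<^sup>2 / (4 * t)) powr (- a))"
      using t z a by (intro mult_left_mono powr_exp_bound) auto
    also have "\<dots> = a powr a * (4 * pi * t * ((norm z)\<^sup>2 / (4 * t))) powr (- a)"
      using t z by (subst powr_mult) auto
    also have "4 * pi * t * ((norm z)\<^sup>2 / (4 * t)) = pi * norm z powr 2"
    proof -
      have "norm z powr 2 = (norm z)\<^sup>2" using z by simp
      then show ?thesis using t by (simp only:) simp
    qed
    also have "(pi * norm z powr 2) powr (- a) = pi powr (- a) * norm z powr (- real DIM('a))"
    proof -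
      have "(norm z powr 2) powr (- a) = norm z powr (- real DIM('a))"
        unfolding powr_powr a_def by simp
      then show ?thesis by (simp add: powr_mult)
    qed
    also have "a powr a * (pi powr (- a) * norm z powr (- real DIM('a))) \<le> K * norm z powr (- real DIM('a))"
      unfolding mult.assoc[symmetric] by (intro mult_right_mono) (auto simp: K_def)
    finally show ?thesis using False by (simp add: parabolic_norm_def max_def)
  qed
  moreover have "0 < K" by (simp add: K_def less_max_iff_disj)
  ultimately show ?thesis by blast
qed

text \<open>The integral is split at \<open>norm y = r\<close>, half the parabolic norm. Inside, the
  kernel is at most a multiple of \<open>r powr (- d)\<close> and the ball carries a multiple of
  \<open>r powr (d - B)\<close>, which uses \<open>B < d\<close>; outside, the weight is at most
  \<open>r powr (- B)\<close> and the kernel has mass 1.\<close>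

lemma nn_integral_heat_kernel_norm_powr_le:
  fixes B :: real
  assumes B: "0 \<le> B" "B < DIM('a)"
  shows "\<exists>C>0. \<forall>t>0. \<forall>x::'a::euclidean_space.
    (\<integral>\<^sup>+y. ennreal (heat_kernel t (x - y) * norm y powr (- B)) \<partial>lborel)
      \<le> ennreal (C * parabolic_norm t x powr (- B))"
proof -
  let ?d = "real DIM('a)"
  obtain K where K: "K > 0" "\<And>t z. t > 0 \<Longrightarrow> heat_kernel t (z::'a) \<le> K * parabolic_norm t z powr (- ?d)"
    using heat_kernel_le_parabolic_norm[where 'a='a] by blast
  obtain C where C: "C \<ge> 0" "\<And>r. r > 0 \<Longrightarrow> (\<integral>\<^sup>+y. ennreal (norm (y::'a) powr (-B)) * indicator (ball 0 r) y \<partial>lborel) = ennreal (C * r powr (?d - B))"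
    using nn_integral_norm_powr_ball_le[OF B] by blast
  have "(\<integral>\<^sup>+y. ennreal (heat_kernel t (x - y) * norm y powr (- B)) \<partial>lborel)
      \<le> ennreal ((K * C + 1) * 2 powr B * parabolic_norm t x powr (- B))" if t: "0 < t" for t and x :: 'a
  proof -
    define r where "r = parabolic_norm t x / 2"
    have r: "r > 0" using parabolic_norm_pos[OF t, of x] by (simp add: r_def)
    have "(\<integral>\<^sup>+y. ennreal (heat_kernel t (x - y) * norm y powr (- B)) \<partial>lborel)
      \<le> (\<integral>\<^sup>+y. ennreal (K * r powr (- ?d)) * (ennreal (norm y powr (-B)) * indicator (ball 0 r) y)
           + ennreal (r powr (- B)) * ennreal (heat_kernel t (x - y)) \<partial>lborel)"
    proof (intro nn_integral_mono)
      fix y :: 'a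
      show "ennreal (heat_kernel t (x - y) * norm y powr (- B))
         \<le> ennreal (K * r powr (- ?d)) * (ennreal (norm y powr (-B)) * indicator (ball 0 r) y)
           + ennreal (r powr (- B)) * ennreal (heat_kernel t (x - y))"
      proof (cases "norm y < r")
        case True
        \<comment> \<open>If the maximum is attained by \<open>sqrt t\<close> this is immediate;
          otherwise \<open>norm x = 2 * r\<close>, and the triangle inequality leaves
          \<open>norm (x - y) \<ge> r\<close>.\<close>
        have "r \<le> parabolic_norm t (x - y)"
          using True norm_triangle_ineq2[of x y] norm_ge_zero[of "x - y"] real_sqrt_gt_zero[OF t]
          unfolding r_def parabolic_norm_def by linarith
        then have "parabolic_norm t (x - y) powr (- ?d) \<le> r powr (- ?d)"
          using r by (intro powr_mono2') auto
        then have "heat_kernel t (x - y) \<le> K * r powr (- ?d)"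
          using K(2)[OF t, of "x - y"] K(1) by (meson mult_left_mono less_imp_le order_trans)
        then have "ennreal (heat_kernel t (x - y) * norm y powr (- B)) \<le> ennreal (K * r powr (- ?d)) * ennreal (norm y powr (-B))"
          using K by (subst ennreal_mult[symmetric]) (auto intro!: ennreal_leI mult_right_mono)
        then show ?thesis using True by (simp add: add_increasing2)
      next
        case False
        then have "norm y powr (- B) \<le> r powr (- B)" using r B by (intro powr_mono2') auto
        then have "ennreal (heat_kernel t (x - y) * norm y powr (- B)) \<le> ennreal (r powr (- B) * heat_kernel t (x - y))"
          by (intro ennreal_leI, subst mult.commute, intro mult_right_mono) auto
        then show ?thesis by (simp add: add_increasing ennreal_mult)
      qed
    qed
    also have "\<dots> = ennreal (K * r powr (- ?d)) * (\<integral>\<^sup>+y. ennreal (norm (y::'a) powr (-B)) * indicator (ball 0 r) y \<partial>lborel)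
           + ennreal (r powr (- B)) * (\<integral>\<^sup>+y. ennreal (heat_kernel t (x - y)) \<partial>lborel)"
      by (subst nn_integral_add; (subst nn_integral_cmult)?; (subst nn_integral_cmult)?) auto
    also have "\<dots> = ennreal (K * r powr (- ?d)) * ennreal (C * r powr (?d - B)) + ennreal (r powr (- B))"
      using r t by (simp add: C(2) nn_integral_heat_kernel)
    also have "\<dots> = ennreal (K * r powr (- ?d) * (C * r powr (?d - B)) + r powr (- B))"
      using K C r by (simp add: ennreal_mult[symmetric] ennreal_plus[symmetric] del: ennreal_plus)
    also have "K * r powr (- ?d) * (C * r powr (?d - B)) + r powr (- B) = (K * C + 1) * r powr (- B)"
    proof -
      have "r powr (- ?d) * r powr (?d - B) = r powr (- B)" by (simp flip: powr_add)
      then show ?thesis by (simp add: algebra_simps)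
    qed
    also have "r powr (- B) = 2 powr B * parabolic_norm t x powr (- B)"
      using parabolic_norm_pos[OF t, of x] by (simp add: r_def powr_divide powr_minus_divide)
    finally show ?thesis by (simp add: mult.assoc)
  qed
  moreover have "0 < (K * C + 1) * 2 powr B" using K C by (simp add: add_nonneg_pos)
  ultimately show ?thesis by blast
qed

section \<open>The Duhamel integral of the critical weight\<close>

lemma nn_integral_powr_interval_le:
  fixes a t :: real
  assumes "a < 1" "0 < t"
  shows "(\<integral>\<^sup>+\<tau>. ennreal (\<tau> powr (- a)) * indicator {0<..<t} \<tau> \<partial>lborel) \<le> ennreal (t powr (1 - a) / (1 - a))"
proof -
  have "(\<integral>\<^sup>+\<tau>. ennreal (\<tau> powr (- a)) * indicator {0<..<t} \<tau> \<partial>lborel)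
     \<le> (\<integral>\<^sup>+\<tau>. ennreal (\<tau> powr (- a)) * indicator {0..t} \<tau> \<partial>lborel)"
    by (intro nn_integral_mono) (auto simp: indicator_def)
  also have "\<dots> = ennreal (t powr (- a + 1) / (- a + 1))"
    using assms by (intro nn_integral_has_integral_lebesgue' has_integral_powr_from_0) auto
  finally show ?thesis by (simp add: add.commute)
qed

lemma nn_integral_powr_interval_reflect_le:
  fixes a t :: real
  assumes "a < 1" "0 < t"
  shows "(\<integral>\<^sup>+\<tau>. ennreal ((t - \<tau>) powr (- a)) * indicator {0<..<t} \<tau> \<partial>lborel) \<le> ennreal (t powr (1 - a) / (1 - a))"
proof -
  have "(\<integral>\<^sup>+\<tau>. ennreal (\<tau> powr (- a)) * indicator {0<..<t} \<tau> \<partial>lborel)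
     = ennreal (\<bar>-1\<bar> ^ DIM(real)) * (\<integral>\<^sup>+\<tau>. ennreal ((t + (-1) *\<^sub>R \<tau>) powr (- a)) * indicator {0<..<t} (t + (-1) *\<^sub>R \<tau>) \<partial>lborel)"
    by (rule nn_integral_lborel_affine) auto
  also have "\<dots> = (\<integral>\<^sup>+\<tau>. ennreal ((t - \<tau>) powr (- a)) * indicator {0<..<t} \<tau> \<partial>lborel)"
    by (simp, intro nn_integral_cong) (auto simp: indicator_def)
  finally show ?thesis using nn_integral_powr_interval_le[OF assms] by simp
qed

text \<open>Homogeneous of degree \<open>- (s + 2)\<close> under parabolic dilations, two below the
  degree \<open>- s\<close> of the solution; the Duhamel integral gains exactly these two.\<close>

definition hardy_weight :: "real \<Rightarrow> real \<Rightarrow> real \<Rightarrow> 'a::euclidean_space \<Rightarrow> real" where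
  "hardy_weight \<gamma> s \<tau> y = norm y powr \<gamma> * parabolic_norm \<tau> y powr (- (s + 2 + \<gamma>))"

lemma hardy_weight_nonneg [simp]: "0 \<le> hardy_weight \<gamma> s \<tau> y"
  by (simp add: hardy_weight_def)

lemma borel_measurable_hardy_weight [measurable (raw)]:
  assumes [measurable]: "f \<in> borel_measurable M" "g \<in> borel_measurable M"
  shows "(\<lambda>w. hardy_weight \<gamma> s (f w) (g w)) \<in> borel_measurable M"
  unfolding hardy_weight_def by measurable

text \<open>The exponent is split as \<open>(B + \<gamma>) + (s + 2 - B)\<close>; both parts are
  nonnegative, the first power is estimated by \<open>norm y\<close>, the second by
  \<open>sqrt \<tau>\<close>. The free \<open>B\<close> decides how much of the singularity is put
  on time.\<close>

lemma hardy_weight_le: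
  assumes "0 < \<tau>" "- \<gamma> \<le> B" "B \<le> s + 2"
  shows "hardy_weight \<gamma> s \<tau> y \<le> \<tau> powr (- (s + 2 - B) / 2) * norm y powr (- B)"
proof (cases "y = 0")
  case False
  have "hardy_weight \<gamma> s \<tau> y = norm y powr \<gamma> * (parabolic_norm \<tau> y powr (- (B + \<gamma>)) * parabolic_norm \<tau> y powr (- (s + 2 - B)))"
    unfolding hardy_weight_def powr_add[symmetric] by (simp add: algebra_simps)
  also have "\<dots> \<le> norm y powr \<gamma> * (norm y powr (- (B + \<gamma>)) * \<tau> powr (- (s + 2 - B) / 2))"
    using assms False
    by (intro mult_left_mono mult_mono parabolic_norm_powr_le_norm parabolic_norm_powr_le_sqrt) auto
  also have "\<dots> = \<tau> powr (- (s + 2 - B) / 2) * (norm y powr \<gamma> * norm y powr (- (B + \<gamma>)))"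
    by (simp add: mult_ac)
  also have "norm y powr \<gamma> * norm y powr (- (B + \<gamma>)) = norm y powr (- B)"
    unfolding powr_add[symmetric] by simp
  finally show ?thesis .
\<comment> \<open>At the origin both sides are 0, since \<open>0 powr r = 0\<close>.\<close>
qed (simp add: hardy_weight_def)

lemma nn_integral_heat_kernel_hardy_weight_le:
  fixes B \<gamma> s :: real
  assumes "0 \<le> B" "B < DIM('a)" "- \<gamma> \<le> B" "B \<le> s + 2"
  shows "\<exists>C>0. \<forall>r>0. \<forall>\<tau>>0. \<forall>x::'a::euclidean_space.
    (\<integral>\<^sup>+y. ennreal (heat_kernel r (x - y) * hardy_weight \<gamma> s \<tau> y) \<partial>lborel)
      \<le> ennreal (C * (\<tau> powr (- (s + 2 - B) / 2) * parabolic_norm r x powr (- B)))"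
proof -
  obtain C where C: "C > 0" "\<And>t x. t > 0 \<Longrightarrow>
    (\<integral>\<^sup>+y. ennreal (heat_kernel t (x - y) * norm (y::'a) powr (- B)) \<partial>lborel)
      \<le> ennreal (C * parabolic_norm t x powr (- B))"
    using nn_integral_heat_kernel_norm_powr_le[OF assms(1,2)] by blast
  have "(\<integral>\<^sup>+y. ennreal (heat_kernel r (x - y) * hardy_weight \<gamma> s \<tau> y) \<partial>lborel)
      \<le> ennreal (C * (\<tau> powr (- (s + 2 - B) / 2) * parabolic_norm r x powr (- B)))"
    if r: "0 < r" and \<tau>: "0 < \<tau>" for r \<tau> and x :: 'a
  proof -
    let ?T = "\<tau> powr (- (s + 2 - B) / 2)"
    have "(\<integral>\<^sup>+y. ennreal (heat_kernel r (x - y) * hardy_weight \<gamma> s \<tau> y) \<partial>lborel)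
      \<le> (\<integral>\<^sup>+y. ennreal ?T * ennreal (heat_kernel r (x - y) * norm y powr (- B)) \<partial>lborel)"
    proof (intro nn_integral_mono)
      fix y :: 'a
      have "heat_kernel r (x - y) * hardy_weight \<gamma> s \<tau> y \<le> heat_kernel r (x - y) * (?T * norm y powr (- B))"
        using assms \<tau> by (intro mult_left_mono hardy_weight_le) auto
      then show "ennreal (heat_kernel r (x - y) * hardy_weight \<gamma> s \<tau> y)
         \<le> ennreal ?T * ennreal (heat_kernel r (x - y) * norm y powr (- B))"
        by (simp add: ennreal_mult[symmetric] ennreal_leI mult_ac)
    qed
    also have "\<dots> = ennreal ?T * (\<integral>\<^sup>+y. ennreal (heat_kernel r (x - y) * norm y powr (- B)) \<partial>lborel)"
      by (rule nn_integral_cmult) auto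
    also have "\<dots> \<le> ennreal ?T * ennreal (C * parabolic_norm r x powr (- B))"
      using C(2)[OF r] by (intro mult_left_mono) auto
    also have "\<dots> = ennreal (C * (?T * parabolic_norm r x powr (- B)))"
      using C by (simp add: ennreal_mult[symmetric] mult_ac)
    finally show ?thesis .
  qed
  with C(1) show ?thesis by blast
qed

text \<open>Both bounds have the homogeneity \<open>- s\<close> that scaling dictates. The first
  reproduces the profile of the solution; the second falls off faster at infinity and tends to 0
  with \<open>t\<close> at fixed \<open>x \<noteq> 0\<close>, as the initial condition requires.
  Room for the exponent \<open>B\<close> is left by \<open>s < d\<close>,
  \<open>- \<gamma> < d\<close> and \<open>- \<gamma> < 2\<close>.\<close>

lemma nn_integral_hardy_duhamel_le:
  fixes \<gamma> s :: real
  assumes \<gamma>: "- 2 < \<gamma>" "- real DIM('a) < \<gamma>" and s: "0 < s" "s < DIM('a)"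
  shows "\<exists>C>0. \<exists>B>s. \<forall>t>0. \<forall>x::'a::euclidean_space.
    (\<integral>\<^sup>+\<tau>. (\<integral>\<^sup>+y. ennreal (heat_kernel (t - \<tau>) (x - y) * hardy_weight \<gamma> s \<tau> y) \<partial>lborel) * indicator {0<..<t} \<tau> \<partial>lborel)
      \<le> ennreal (C * parabolic_norm t x powr (- s)) \<and>
    (x \<noteq> 0 \<longrightarrow>
      (\<integral>\<^sup>+\<tau>. (\<integral>\<^sup>+y. ennreal (heat_kernel (t - \<tau>) (x - y) * hardy_weight \<gamma> s \<tau> y) \<partial>lborel) * indicator {0<..<t} \<tau> \<partial>lborel)
      \<le> ennreal (C * (norm x powr (- B) * t powr ((B - s) / 2))))"
proof -
  let ?I = "\<lambda>t \<tau> x. \<integral>\<^sup>+y. ennreal (heat_kernel (t - \<tau>) (x - y) * hardy_weight \<gamma> s \<tau> (y::'a)) \<partial>lborel"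
  let ?D = "\<lambda>t x. \<integral>\<^sup>+\<tau>. ?I t \<tau> x * indicator {0<..<t} \<tau> \<partial>lborel"
  \<comment> \<open>With an exponent \<open>B > s\<close> the time singularity at \<open>0\<close> is integrable; with \<open>B' = max 0 (- \<gamma>) < 2\<close> the
    one at \<open>\<tau> = t\<close> is.  Near the origin the two are used on the two halves of \<open>(0, t)\<close>.\<close>
  have "max s (- \<gamma>) < min (real DIM('a)) (s + 2)" using \<gamma> s by auto
  then obtain B where "max s (- \<gamma>) < B" "B < min (real DIM('a)) (s + 2)" using dense by blast
  then have B: "s < B" "- \<gamma> < B" "B < DIM('a)" "B < s + 2" by auto
  define A where "A = (s + 2 - B) / 2"
  have A: "A < 1" using B by (simp add: A_def)
  define B' where "B' = max 0 (- \<gamma>)"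
  have B': "0 \<le> B'" "B' < DIM('a)" "- \<gamma> \<le> B'" "B' \<le> s + 2" "B' / 2 < 1" using \<gamma> s by (auto simp: B'_def)
  define A' where "A' = (s + 2 - B') / 2"
  have A': "0 \<le> A'" using B' by (simp add: A'_def)
  obtain C1 where C1: "C1 > 0" "\<And>r \<tau> x. r > 0 \<Longrightarrow> \<tau> > 0 \<Longrightarrow>
    (\<integral>\<^sup>+y. ennreal (heat_kernel r (x - y) * hardy_weight \<gamma> s \<tau> (y::'a)) \<partial>lborel)
      \<le> ennreal (C1 * (\<tau> powr (- A) * parabolic_norm r x powr (- B)))"
    using nn_integral_heat_kernel_hardy_weight_le[of B \<gamma> s, where 'a='a] B s unfolding A_def minus_divide_left by (smt (verit))
  obtain C2 where C2: "C2 > 0" "\<And>r \<tau> x. r > 0 \<Longrightarrow> \<tau> > 0 \<Longrightarrow>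
    (\<integral>\<^sup>+y. ennreal (heat_kernel r (x - y) * hardy_weight \<gamma> s \<tau> (y::'a)) \<partial>lborel)
      \<le> ennreal (C2 * (\<tau> powr (- A') * parabolic_norm r x powr (- B')))"
    using nn_integral_heat_kernel_hardy_weight_le[of B' \<gamma> s, where 'a='a] B' unfolding A'_def minus_divide_left by (smt (verit))
  define C3 where "C3 = C1 / (1 - A)"
  \<comment> \<open>The two summands belong to the halves of \<open>(0, t)\<close>; the powers of
    \<open>1/2\<close> appear when \<open>t - \<tau>\<close>, respectively \<open>\<tau>\<close>, is
    replaced by its lower bound \<open>t / 2\<close>.\<close>
  define C4 where "C4 = C1 * (1/2) powr (- B / 2) / (1 - A) + C2 * (1/2) powr (- A') / (1 - B' / 2)"
  have C3: "0 < C3" using C1 A by (simp add: C3_def)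
  have C4: "0 < C4" using C1 C2 A B' by (auto simp: C4_def intro!: add_pos_pos)
  \<comment> \<open>Replacing the parabolic norm of \<open>(t - \<tau>, x)\<close> by
    \<open>norm x\<close> decouples space from time. The integral of
    \<open>\<tau> powr (- A)\<close> remains, and it converges because
    \<open>1 - A = (B - s) / 2\<close> is positive.\<close>
  have far: "?D t x \<le> ennreal (C3 * (norm x powr (- B) * t powr ((B - s) / 2)))"
    if t: "0 < t" and x: "x \<noteq> 0" for t and x :: 'a
  proof -
    have "?D t x \<le> (\<integral>\<^sup>+\<tau>. ennreal (C1 * norm x powr (- B)) * (ennreal (\<tau> powr (- A)) * indicator {0<..<t} \<tau>) \<partial>lborel)"
    proof (intro nn_integral_mono)
      fix \<tau> :: real
      show "?I t \<tau> x * indicator {0<..<t} \<tau> \<le> ennreal (C1 * norm x powr (- B)) * (ennreal (\<tau> powr (- A)) * indicator {0<..<t} \<tau>)"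
      proof (cases "\<tau> \<in> {0<..<t}")
        case True
        then have "?I t \<tau> x \<le> ennreal (C1 * (\<tau> powr (- A) * parabolic_norm (t - \<tau>) x powr (- B)))"
          by (intro C1(2)) auto
        also have "\<dots> \<le> ennreal (C1 * (\<tau> powr (- A) * norm x powr (- B)))"
          using C1 x s B by (intro ennreal_leI mult_left_mono parabolic_norm_powr_le_norm) auto
        also have "\<dots> = ennreal (C1 * norm x powr (- B)) * ennreal (\<tau> powr (- A))"
          using C1 by (simp add: ennreal_mult[symmetric] mult_ac)
        finally show ?thesis using True by simp
      qed simp
    qed
    also have "\<dots> = ennreal (C1 * norm x powr (- B)) * (\<integral>\<^sup>+\<tau>. ennreal (\<tau> powr (- A)) * indicator {0<..<t} \<tau> \<partial>lborel)"
      by (rule nn_integral_cmult) auto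
    also have "\<dots> \<le> ennreal (C1 * norm x powr (- B)) * ennreal (t powr (1 - A) / (1 - A))"
      using A t by (intro mult_left_mono nn_integral_powr_interval_le) auto
    also have "\<dots> = ennreal (C3 * (norm x powr (- B) * t powr ((B - s) / 2)))"
    proof -
      have "1 - A = (B - s) / 2" by (simp add: A_def field_simps)
      from this[symmetric] show ?thesis using C1 A by (simp only:) (simp add: ennreal_mult[symmetric] C3_def mult_ac)
    qed
    finally show ?thesis .
  qed
  have near: "?D t x \<le> ennreal (C4 * t powr (- s / 2))" if t: "0 < t" for t and x :: 'a
  proof -
    define K1 where "K1 = C1 * (t / 2) powr (- B / 2)"
    define K2 where "K2 = C2 * (t / 2) powr (- A')"
    have K: "0 \<le> K1" "0 \<le> K2" using C1 C2 by (auto simp: K1_def K2_def)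
    \<comment> \<open>Each summand is needed on one half of the interval only; majorising by the sum
      on all of \<open>(0, t)\<close> avoids splitting the integral.\<close>
    have "?D t x \<le> (\<integral>\<^sup>+\<tau>. ennreal K1 * (ennreal (\<tau> powr (- A)) * indicator {0<..<t} \<tau>)
       + ennreal K2 * (ennreal ((t - \<tau>) powr (- (B' / 2))) * indicator {0<..<t} \<tau>) \<partial>lborel)"
    proof (intro nn_integral_mono)
      fix \<tau> :: real
      show "?I t \<tau> x * indicator {0<..<t} \<tau> \<le> ennreal K1 * (ennreal (\<tau> powr (- A)) * indicator {0<..<t} \<tau>)
       + ennreal K2 * (ennreal ((t - \<tau>) powr (- (B' / 2))) * indicator {0<..<t} \<tau>)"
      proof (cases "\<tau> \<in> {0<..<t}")
        case True
        have "?I t \<tau> x \<le> ennreal K1 * ennreal (\<tau> powr (- A)) + ennreal K2 * ennreal ((t - \<tau>) powr (- (B' / 2)))"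
        proof (cases "\<tau> \<le> t / 2")
          case half: True
          have "parabolic_norm (t - \<tau>) x powr (- B) \<le> (t - \<tau>) powr (- B / 2)"
            using True s B by (intro parabolic_norm_powr_le_sqrt) auto
          also have "\<dots> \<le> (t / 2) powr (- B / 2)"
            using True s B half by (intro powr_mono2') auto
          finally have "parabolic_norm (t - \<tau>) x powr (- B) \<le> (t / 2) powr (- B / 2)" .
          then have "C1 * (\<tau> powr (- A) * parabolic_norm (t - \<tau>) x powr (- B)) \<le> C1 * (\<tau> powr (- A) * (t / 2) powr (- B / 2))"
            using C1 by (intro mult_left_mono) auto
          then have "?I t \<tau> x \<le> ennreal (C1 * (\<tau> powr (- A) * (t / 2) powr (- B / 2)))"
            using C1(2)[of "t - \<tau>" \<tau> x] True by (meson diff_gt_0_iff_gt ennreal_leI greaterThanLessThan_iff order_trans)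
          also have "\<dots> = ennreal K1 * ennreal (\<tau> powr (- A))"
            using C1 by (simp add: K1_def ennreal_mult[symmetric] mult_ac)
          finally show ?thesis by (simp add: add_increasing2)
        next
          case half: False
          have "\<tau> powr (- A') \<le> (t / 2) powr (- A')"
            using True A' half by (intro powr_mono2') auto
          moreover have "parabolic_norm (t - \<tau>) x powr (- B') \<le> (t - \<tau>) powr (- B' / 2)"
            using True B' by (intro parabolic_norm_powr_le_sqrt) auto
          ultimately have "C2 * (\<tau> powr (- A') * parabolic_norm (t - \<tau>) x powr (- B')) \<le> C2 * ((t / 2) powr (- A') * (t - \<tau>) powr (- B' / 2))"
            using C2 by (intro mult_left_mono mult_mono) auto
          then have "?I t \<tau> x \<le> ennreal (C2 * ((t / 2) powr (- A') * (t - \<tau>) powr (- B' / 2)))"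
            using C2(2)[of "t - \<tau>" \<tau> x] True by (meson diff_gt_0_iff_gt ennreal_leI greaterThanLessThan_iff order_trans)
          also have "\<dots> = ennreal K2 * ennreal ((t - \<tau>) powr (- (B' / 2)))"
            using C2 by (simp add: K2_def ennreal_mult[symmetric] mult_ac)
          finally show ?thesis by (simp add: add_increasing)
        qed
        then show ?thesis using True by simp
      qed simp
    qed
    also have "\<dots> = ennreal K1 * (\<integral>\<^sup>+\<tau>. ennreal (\<tau> powr (- A)) * indicator {0<..<t} \<tau> \<partial>lborel)
       + ennreal K2 * (\<integral>\<^sup>+\<tau>. ennreal ((t - \<tau>) powr (- (B' / 2))) * indicator {0<..<t} \<tau> \<partial>lborel)"
      by (subst nn_integral_add; (subst nn_integral_cmult)?; (subst nn_integral_cmult)?) auto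
    also have "\<dots> \<le> ennreal K1 * ennreal (t powr (1 - A) / (1 - A)) + ennreal K2 * ennreal (t powr (1 - B' / 2) / (1 - B' / 2))"
      using A B' t
      by (intro add_mono mult_left_mono nn_integral_powr_interval_le nn_integral_powr_interval_reflect_le) auto
    also have "\<dots> = ennreal (K1 * (t powr (1 - A) / (1 - A)) + K2 * (t powr (1 - B' / 2) / (1 - B' / 2)))"
      using K A B' by (simp add: ennreal_mult[symmetric] ennreal_plus[symmetric] del: ennreal_plus)
    also have "K1 * (t powr (1 - A) / (1 - A)) + K2 * (t powr (1 - B' / 2) / (1 - B' / 2)) = C4 * t powr (- s / 2)"
    proof -
      have half: "(t / 2) powr a = (1/2) powr a * t powr a" for a
        using t powr_mult[of "1/2" t a] by simp
      have 1: "t powr (- B / 2) * t powr (1 - A) = t powr (- s / 2)"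
        unfolding powr_add[symmetric] by (simp add: A_def field_simps)
      have 2: "t powr (- A') * t powr (1 - B' / 2) = t powr (- s / 2)"
        unfolding powr_add[symmetric] by (simp add: A'_def field_simps)
      have "K1 * (t powr (1 - A) / (1 - A)) = C1 * (1/2) powr (- B / 2) / (1 - A) * (t powr (- B / 2) * t powr (1 - A))"
        by (simp add: K1_def half)
      moreover have "K2 * (t powr (1 - B' / 2) / (1 - B' / 2)) = C2 * (1/2) powr (- A') / (1 - B' / 2) * (t powr (- A') * t powr (1 - B' / 2))"
        by (simp add: K2_def half)
      ultimately show ?thesis unfolding 1 2 C4_def by (simp only: distrib_right)
    qed
    finally show ?thesis .
  qed
  define C where "C = max C3 C4"
  have C: "0 < C" "C3 \<le> C" "C4 \<le> C" using C3 by (auto simp: C_def)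
  have "?D t x \<le> ennreal (C * parabolic_norm t x powr (- s))" if t: "0 < t" for t and x :: 'a
  \<comment> \<open>For \<open>norm x < sqrt t\<close> the parabolic norm is \<open>sqrt t\<close>
    and \<open>near\<close> is the claim; otherwise it is \<open>norm x\<close>, and
    \<open>t powr ((B - s) / 2) \<le> norm x powr (B - s)\<close> turns \<open>far\<close> into the
    claim.\<close>
  proof (cases "norm x < sqrt t")
    case True
    have "?D t x \<le> ennreal (C4 * t powr (- s / 2))" using near[OF t] .
    also have "t powr (- s / 2) = sqrt t powr (- s)"
      using t by (simp add: powr_half_sqrt[symmetric] powr_powr)
    also have "\<dots> = parabolic_norm t x powr (- s)" using True by (simp add: parabolic_norm_def)
    also have "ennreal (C4 * parabolic_norm t x powr (- s)) \<le> ennreal (C * parabolic_norm t x powr (- s))"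
      using C by (intro ennreal_leI mult_right_mono) auto
    finally show ?thesis .
  next
    case False
    then have x: "x \<noteq> 0" and px: "parabolic_norm t x = norm x" using t by (auto simp: parabolic_norm_def)
    have "t powr ((B - s) / 2) = sqrt t powr (B - s)"
      using t by (simp add: powr_half_sqrt[symmetric] powr_powr)
    also have "\<dots> \<le> norm x powr (B - s)" using False B t by (intro powr_mono2) auto
    finally have "norm x powr (- B) * t powr ((B - s) / 2) \<le> norm x powr (- B) * norm x powr (B - s)"
      by (intro mult_left_mono) auto
    also have "\<dots> = norm x powr (- s)" unfolding powr_add[symmetric] by simp
    finally have "C3 * (norm x powr (- B) * t powr ((B - s) / 2)) \<le> C * norm x powr (- s)"
      using C C3 by (intro mult_mono) auto
    then show ?thesis using far[OF t x] px by (metis (no_types, lifting) ennreal_leI order_trans)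
  qed
  moreover have "?D t x \<le> ennreal (C * (norm x powr (- B) * t powr ((B - s) / 2)))" if t: "0 < t" "x \<noteq> 0" for t and x :: 'a
    using far[OF t] C by (elim order_trans) (intro ennreal_leI mult_right_mono, auto)
  ultimately show ?thesis using C(1) B(1) by blast
qed

section \<open>The Duhamel operator and the nonlinearity\<close>

text \<open>For Borel integrands the completion changes nothing, and on \<open>lborel\<close> joint
  measurability and Fubini apply.\<close>

lemma heat_eq_lborel:
  assumes [measurable]: "f \<in> borel_measurable borel"
  shows "heat t f x = (\<integral>y. heat_kernel t (x - y) *\<^sub>R f y \<partial>lborel)"
  unfolding heat_def by (rule integral_completion) measurable

lemma heat_defined_iff_lborel:
  assumes [measurable]: "f \<in> borel_measurable borel"
  shows "heat_defined t f x \<longleftrightarrow> integrable lborel (\<lambda>y. heat_kernel t (x - y) *\<^sub>R f y)"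
  unfolding heat_defined_def by (rule integrable_completion) measurable

text \<open>Time, function and base point may all depend on the parameter: in the Duhamel integral
  the source varies with the integration variable.\<close>

lemma borel_measurable_heat [measurable (raw)]:
  assumes F[measurable]: "(\<lambda>(w, y). F w y) \<in> borel_measurable (M \<Otimes>\<^sub>M borel)"
    and [measurable]: "T \<in> borel_measurable M" "X \<in> borel_measurable M"
  shows "(\<lambda>w. heat (T w) (F w) (X w)) \<in> borel_measurable M"
proof -
  have "(\<lambda>w. \<integral>y. heat_kernel (T w) (X w - y) *\<^sub>R F w y \<partial>lborel) \<in> borel_measurable M"
    by (rule lborel.borel_measurable_lebesgue_integral) measurable
  moreover have "heat (T w) (F w) (X w) = (\<integral>y. heat_kernel (T w) (X w - y) *\<^sub>R F w y \<partial>lborel)" if "w \<in> space M" for w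
    using measurable_Pair2[OF F that] by (intro heat_eq_lborel) simp
  ultimately show ?thesis by (subst measurable_cong)
qed

definition duhamel :: "real \<Rightarrow> (real \<Rightarrow> 'a::euclidean_space \<Rightarrow> 'b::euclidean_space) \<Rightarrow> 'a \<Rightarrow> 'b" where
  "duhamel t f x = (LINT \<tau>:{0<..<t}|lebesgue. heat (t - \<tau>) (f \<tau>) x)"

text \<open>Valued in \<open>ennreal\<close>, so that it can be formed before it is known to be
  finite. It contains no source term: every Duhamel estimate is a multiple of this one
  function.\<close>

definition hardy_potential :: "real \<Rightarrow> real \<Rightarrow> real \<Rightarrow> 'a::euclidean_space \<Rightarrow> ennreal" where
  "hardy_potential \<gamma> s t x =
    (\<integral>\<^sup>+\<tau>. (\<integral>\<^sup>+y. ennreal (heat_kernel (t - \<tau>) (x - y) * hardy_weight \<gamma> s \<tau> y) \<partial>lborel) * indicator {0<..<t} \<tau> \<partial>lborel)"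

text \<open>The bound is required at every point rather than almost everywhere, so that Duhamel
  terms can be compared at each single \<open>(t, x)\<close>.\<close>

definition hardy_dominated ::
  "real \<Rightarrow> real \<Rightarrow> real \<Rightarrow> (real \<Rightarrow> 'a::euclidean_space \<Rightarrow> 'b::euclidean_space) \<Rightarrow> bool" where
  "hardy_dominated \<gamma> s K f \<longleftrightarrow> 0 \<le> K \<and> (\<lambda>(\<tau>, y). f \<tau> y) \<in> borel_measurable (borel \<Otimes>\<^sub>M borel) \<and>
     (\<forall>\<tau>>0. \<forall>y. norm (f \<tau> y) \<le> K * hardy_weight \<gamma> s \<tau> y)"

lemma hardy_dominatedD:
  assumes "hardy_dominated \<gamma> s K f"
  shows "0 \<le> K" "(\<lambda>(\<tau>, y). f \<tau> y) \<in> borel_measurable (borel \<Otimes>\<^sub>M borel)"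
    "f \<tau> \<in> borel_measurable borel" "0 < \<tau> \<Longrightarrow> norm (f \<tau> y) \<le> K * hardy_weight \<gamma> s \<tau> y"
proof -
  show 1: "(\<lambda>(\<tau>, y). f \<tau> y) \<in> borel_measurable (borel \<Otimes>\<^sub>M borel)"
    using assms by (simp add: hardy_dominated_def)
  show "f \<tau> \<in> borel_measurable borel" using measurable_Pair2[OF 1, of \<tau>] by simp
qed (use assms in \<open>auto simp: hardy_dominated_def\<close>)

lemma borel_measurable_heat_slices:
  assumes [measurable]: "(\<lambda>(\<tau>, y). f \<tau> y) \<in> borel_measurable (borel \<Otimes>\<^sub>M borel)"
  shows "(\<lambda>((t, x), \<tau>). heat (t - \<tau>) (f \<tau>) x) \<in> borel_measurable ((borel \<Otimes>\<^sub>M borel) \<Otimes>\<^sub>M borel)"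
proof -
  have "(\<lambda>w. heat (fst (fst w) - snd w) (f (snd w)) (snd (fst w))) \<in> borel_measurable ((borel \<Otimes>\<^sub>M borel) \<Otimes>\<^sub>M borel)"
    by measurable
  then show ?thesis by (simp add: case_prod_unfold)
qed

lemma borel_measurable_duhamel:
  assumes [measurable]: "(\<lambda>(\<tau>, y). f \<tau> y) \<in> borel_measurable (borel \<Otimes>\<^sub>M borel)"
  shows "(\<lambda>(t, x). duhamel t f x) \<in> borel_measurable (borel \<Otimes>\<^sub>M borel)"
proof -
  note [measurable] = borel_measurable_heat_slices[OF assms]
  \<comment> \<open>The moving interval is written as a factor measurable in
    \<open>(t, x, \<tau>)\<close>, so that the parameter dependent integral runs over a fixed
    space.\<close>
  have 1: "(\<lambda>(w, \<tau>). (if 0 < \<tau> \<and> \<tau> < fst w then 1 else 0) *\<^sub>R heat (fst w - \<tau>) (f \<tau>) (snd w))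
     \<in> borel_measurable ((borel \<Otimes>\<^sub>M borel) \<Otimes>\<^sub>M lborel)"
    by measurable
  have 2: "(\<lambda>w. \<integral>\<tau>. (if 0 < \<tau> \<and> \<tau> < fst w then 1 else 0) *\<^sub>R heat (fst w - \<tau>) (f \<tau>) (snd w) \<partial>lborel)
     \<in> borel_measurable (borel \<Otimes>\<^sub>M borel)"
    by (rule lborel.borel_measurable_lebesgue_integral) (use 1 in simp)
  have "duhamel t f x = (\<integral>\<tau>. (if 0 < \<tau> \<and> \<tau> < t then 1 else 0) *\<^sub>R heat (t - \<tau>) (f \<tau>) x \<partial>lborel)" for t x
  proof -
    have "duhamel t f x = (\<integral>\<tau>. (if 0 < \<tau> \<and> \<tau> < t then 1 else 0) *\<^sub>R heat (t - \<tau>) (f \<tau>) x \<partial>lebesgue)"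
      unfolding duhamel_def set_lebesgue_integral_def by (intro Bochner_Integration.integral_cong) (auto simp: indicator_def)
    also have "\<dots> = (\<integral>\<tau>. (if 0 < \<tau> \<and> \<tau> < t then 1 else 0) *\<^sub>R heat (t - \<tau>) (f \<tau>) x \<partial>lborel)"
      by (rule integral_completion) measurable
    finally show ?thesis .
  qed
  with 2 show ?thesis by (simp add: case_prod_unfold)
qed

text \<open>For fixed \<open>\<tau>\<close> only finiteness counts, so the least admissible exponent
  \<open>max 0 (- \<gamma>)\<close> serves; it lies below \<open>d\<close>.\<close>

lemma heat_defined_hardy_dominated:
  fixes f :: "real \<Rightarrow> 'a::euclidean_space \<Rightarrow> 'b::euclidean_space"
  assumes f: "hardy_dominated \<gamma> s K f"
    and \<gamma>: "- 2 < \<gamma>" "- real DIM('a) < \<gamma>" and s: "0 < s"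
    and \<tau>: "0 < \<tau>" "\<tau> < t"
  shows "heat_defined (t - \<tau>) (f \<tau>) x"
proof -
  note [measurable] = hardy_dominatedD(3)[OF f]
  let ?B = "max 0 (- \<gamma>)"
  obtain C where C: "\<And>r \<tau> x. r > 0 \<Longrightarrow> \<tau> > 0 \<Longrightarrow>
    (\<integral>\<^sup>+y. ennreal (heat_kernel r (x - y) * hardy_weight \<gamma> s \<tau> (y::'a)) \<partial>lborel)
      \<le> ennreal (C * (\<tau> powr (- (s + 2 - ?B) / 2) * parabolic_norm r x powr (- ?B)))"
    using nn_integral_heat_kernel_hardy_weight_le[of ?B \<gamma> s, where 'a='a] \<gamma> s by fastforce
  have "(\<integral>\<^sup>+y. ennreal (norm (heat_kernel (t - \<tau>) (x - y) *\<^sub>R f \<tau> y)) \<partial>lborel)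
    \<le> (\<integral>\<^sup>+y. ennreal K * ennreal (heat_kernel (t - \<tau>) (x - y) * hardy_weight \<gamma> s \<tau> y) \<partial>lborel)"
  proof (intro nn_integral_mono)
    fix y :: 'a
    have "heat_kernel (t - \<tau>) (x - y) * norm (f \<tau> y) \<le> heat_kernel (t - \<tau>) (x - y) * (K * hardy_weight \<gamma> s \<tau> y)"
      using hardy_dominatedD(4)[OF f \<tau>(1)] by (intro mult_left_mono) auto
    then show "ennreal (norm (heat_kernel (t - \<tau>) (x - y) *\<^sub>R f \<tau> y)) \<le> ennreal K * ennreal (heat_kernel (t - \<tau>) (x - y) * hardy_weight \<gamma> s \<tau> y)"
      using hardy_dominatedD(1)[OF f] by (simp add: ennreal_mult[symmetric] ennreal_leI mult_ac)
  qed
  also have "\<dots> = ennreal K * (\<integral>\<^sup>+y. ennreal (heat_kernel (t - \<tau>) (x - y) * hardy_weight \<gamma> s \<tau> y) \<partial>lborel)"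
    by (rule nn_integral_cmult) auto
  also have "\<dots> \<le> ennreal K * ennreal (C * (\<tau> powr (- (s + 2 - ?B) / 2) * parabolic_norm (t - \<tau>) x powr (- ?B)))"
    using C[of "t - \<tau>" \<tau> x] \<tau> by (intro mult_left_mono) auto
  also have "\<dots> < \<infinity>" by (simp add: ennreal_mult_less_top)
  finally show ?thesis
    unfolding heat_defined_iff_lborel[OF hardy_dominatedD(3)[OF f]] by (intro integrableI_bounded) auto
qed

lemma ennreal_norm_integral_le:
  fixes f :: "'a \<Rightarrow> 'b::{banach, second_countable_topology}"
  shows "ennreal (norm (integral\<^sup>L M f)) \<le> (\<integral>\<^sup>+x. ennreal (norm (f x)) \<partial>M)"
  by (cases "integrable M f") (auto simp: integral_norm_bound_ennreal not_integrable_integral_eq)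

text \<open>\<open>R\<close> is left open so that the same estimate serves both bounds on the
  potential, the one by \<open>parabolic_norm t x powr (- s)\<close> and the one that vanishes with
  \<open>t\<close>.\<close>

lemma hardy_dominated_duhamel:
  fixes f :: "real \<Rightarrow> 'a::euclidean_space \<Rightarrow> 'b::euclidean_space"
  assumes f: "hardy_dominated \<gamma> s K f" and R: "hardy_potential \<gamma> s t x \<le> ennreal R" "0 \<le> R"
  shows "set_integrable lebesgue {0<..<t} (\<lambda>\<tau>. heat (t - \<tau>) (f \<tau>) x)" (is ?int)
    and "norm (duhamel t f x) \<le> K * R" (is ?le)
proof -
  note [measurable] = hardy_dominatedD(3)[OF f] borel_measurable_heat_slices[OF hardy_dominatedD(2)[OF f]]
  have K: "0 \<le> K" using f by (rule hardy_dominatedD)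
  have m[measurable]: "(\<lambda>\<tau>. heat (t - \<tau>) (f \<tau>) x) \<in> borel_measurable borel"
    by (rule borel_measurable_heat[OF hardy_dominatedD(2)[OF f]]) auto
  have "(\<integral>\<^sup>+\<tau>. ennreal (norm (indicat_real {0<..<t} \<tau> *\<^sub>R heat (t - \<tau>) (f \<tau>) x)) \<partial>lborel)
    \<le> (\<integral>\<^sup>+\<tau>. ennreal K * ((\<integral>\<^sup>+y. ennreal (heat_kernel (t - \<tau>) (x - y) * hardy_weight \<gamma> s \<tau> y) \<partial>lborel) * indicator {0<..<t} \<tau>) \<partial>lborel)"
  proof (intro nn_integral_mono)
    fix \<tau> :: real
    show "ennreal (norm (indicat_real {0<..<t} \<tau> *\<^sub>R heat (t - \<tau>) (f \<tau>) x))
      \<le> ennreal K * ((\<integral>\<^sup>+y. ennreal (heat_kernel (t - \<tau>) (x - y) * hardy_weight \<gamma> s \<tau> y) \<partial>lborel) * indicator {0<..<t} \<tau>)"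
    proof (cases "\<tau> \<in> {0<..<t}")
      case True
      have "ennreal (norm (heat (t - \<tau>) (f \<tau>) x)) \<le> (\<integral>\<^sup>+y. ennreal (norm (heat_kernel (t - \<tau>) (x - y) *\<^sub>R f \<tau> y)) \<partial>lborel)"
        by (subst heat_eq_lborel, measurable) (rule ennreal_norm_integral_le)
      also have "\<dots> \<le> (\<integral>\<^sup>+y. ennreal K * ennreal (heat_kernel (t - \<tau>) (x - y) * hardy_weight \<gamma> s \<tau> y) \<partial>lborel)"
      proof (intro nn_integral_mono)
        fix y :: 'a
        have "heat_kernel (t - \<tau>) (x - y) * norm (f \<tau> y) \<le> heat_kernel (t - \<tau>) (x - y) * (K * hardy_weight \<gamma> s \<tau> y)"
          using True hardy_dominatedD(4)[OF f] by (intro mult_left_mono) auto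
        then show "ennreal (norm (heat_kernel (t - \<tau>) (x - y) *\<^sub>R f \<tau> y)) \<le> ennreal K * ennreal (heat_kernel (t - \<tau>) (x - y) * hardy_weight \<gamma> s \<tau> y)"
          using K by (simp add: ennreal_mult[symmetric] ennreal_leI mult_ac)
      qed
      also have "\<dots> = ennreal K * (\<integral>\<^sup>+y. ennreal (heat_kernel (t - \<tau>) (x - y) * hardy_weight \<gamma> s \<tau> y) \<partial>lborel)"
        by (rule nn_integral_cmult) auto
      finally show ?thesis using True by simp
    qed simp
  qed
  also have "\<dots> = ennreal K * hardy_potential \<gamma> s t x"
    unfolding hardy_potential_def by (rule nn_integral_cmult) measurable
  also have "\<dots> \<le> ennreal K * ennreal R" using R by (intro mult_left_mono) auto
  also have "\<dots> = ennreal (K * R)" using K R by (simp add: ennreal_mult)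
  finally have le: "(\<integral>\<^sup>+\<tau>. ennreal (norm (indicat_real {0<..<t} \<tau> *\<^sub>R heat (t - \<tau>) (f \<tau>) x)) \<partial>lborel) \<le> ennreal (K * R)" .
  show ?int unfolding set_integrable_def
  proof (rule integrableI_bounded)
    show "(\<integral>\<^sup>+\<tau>. ennreal (norm (indicat_real {0<..<t} \<tau> *\<^sub>R heat (t - \<tau>) (f \<tau>) x)) \<partial>lebesgue) < \<infinity>"
      unfolding nn_integral_completion using le by (rule le_less_trans) simp
  qed (auto intro!: measurable_completion)
  have "ennreal (norm (duhamel t f x)) \<le> (\<integral>\<^sup>+\<tau>. ennreal (norm (indicat_real {0<..<t} \<tau> *\<^sub>R heat (t - \<tau>) (f \<tau>) x)) \<partial>lebesgue)"
    unfolding duhamel_def set_lebesgue_integral_def by (rule ennreal_norm_integral_le)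
  also have "\<dots> \<le> ennreal (K * R)" unfolding nn_integral_completion by (rule le)
  finally show ?le using K R by (simp add: ennreal_le_iff)
qed

text \<open>Linearity needs care because a non-integrable integrand has integral 0: the domination
  makes the inner integral over space and the outer one over time converge for both sources.\<close>

lemma duhamel_diff:
  fixes f g :: "real \<Rightarrow> 'a::euclidean_space \<Rightarrow> 'b::euclidean_space"
  assumes f: "hardy_dominated \<gamma> s K f" and g: "hardy_dominated \<gamma> s K' g"
    and \<gamma>: "- 2 < \<gamma>" "- real DIM('a) < \<gamma>" and s: "0 < s"
    and R: "hardy_potential \<gamma> s t x \<le> ennreal R" "0 \<le> R"
  shows "duhamel t (\<lambda>\<tau> y. f \<tau> y - g \<tau> y) x = duhamel t f x - duhamel t g x"
proof -
  have "duhamel t f x - duhamel t g x = (LINT \<tau>:{0<..<t}|lebesgue. heat (t - \<tau>) (f \<tau>) x - heat (t - \<tau>) (g \<tau>) x)"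
    unfolding duhamel_def
    by (rule set_integral_diff(2)[symmetric]; rule hardy_dominated_duhamel[OF _ R]; fact)
  also have "\<dots> = duhamel t (\<lambda>\<tau> y. f \<tau> y - g \<tau> y) x"
    unfolding duhamel_def set_lebesgue_integral_def
  proof (intro Bochner_Integration.integral_cong refl)
    fix \<tau> :: real
    show "indicat_real {0<..<t} \<tau> *\<^sub>R (heat (t - \<tau>) (f \<tau>) x - heat (t - \<tau>) (g \<tau>) x) =
      indicat_real {0<..<t} \<tau> *\<^sub>R heat (t - \<tau>) (\<lambda>y. f \<tau> y - g \<tau> y) x"
    proof (cases "\<tau> \<in> {0<..<t}")
      case True
      then have "heat_defined (t - \<tau>) (f \<tau>) x" "heat_defined (t - \<tau>) (g \<tau>) x"
        using heat_defined_hardy_dominated[OF f \<gamma> s] heat_defined_hardy_dominated[OF g \<gamma> s] by auto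
      then show ?thesis unfolding heat_defined_def heat_def by (simp add: scaleR_diff_right)
    qed simp
  qed
  finally show ?thesis ..
qed

text \<open>The vector valued power is compared without differentiating it, in any normed space. If
  \<open>norm w \<le> norm v\<close>, the difference is \<open>norm v powr (\<alpha> - 1)\<close>
  times \<open>v - w\<close>, plus \<open>w\<close> times a difference of scalars; the two parts
  give the 1 and the \<open>\<alpha>\<close> of the constant.\<close>

lemma norm_powr_scaleR_diff_le:
  fixes v w :: "'b::real_normed_vector"
  assumes \<alpha>: "1 \<le> \<alpha>" and R: "norm v \<le> R" "norm w \<le> R"
  shows "norm (norm v powr (\<alpha> - 1) *\<^sub>R v - norm w powr (\<alpha> - 1) *\<^sub>R w) \<le> (1 + \<alpha>) * R powr (\<alpha> - 1) * norm (v - w)"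
proof -
  have main: "norm (norm v powr (\<alpha> - 1) *\<^sub>R v - norm w powr (\<alpha> - 1) *\<^sub>R w) \<le> (1 + \<alpha>) * R powr (\<alpha> - 1) * norm (v - w)"
    if R: "norm v \<le> R" and vw: "norm w \<le> norm v" for v w :: 'b
  proof -
    let ?V = "norm v" and ?W = "norm w"
    have R1: "?V powr (\<alpha> - 1) \<le> R powr (\<alpha> - 1)" using R \<alpha> by (intro powr_mono2) auto
    \<comment> \<open>The mean value theorem is applied to \<open>z powr \<alpha>\<close>, not to
      \<open>z powr (\<alpha> - 1)\<close>, whose derivative is unbounded near 0 for
      \<open>\<alpha> < 2\<close>; the factor \<open>?W\<close> in step \<open>1\<close> makes this
      possible.\<close>
    have "?V powr \<alpha> - ?W powr \<alpha> \<le> \<alpha> * ?V powr (\<alpha> - 1) * (?V - ?W)"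
    proof (cases "?W = 0 \<or> ?V = ?W")
      case True
      moreover have "?V powr \<alpha> = ?V powr (\<alpha> - 1) * ?V" if "?V \<noteq> 0"
        using powr_add[of ?V "\<alpha> - 1" 1] that by simp
      ultimately show ?thesis using \<alpha> by (cases "?V = 0") (auto intro!: mult_right_mono)
    next
      case False
      then have pos: "0 < ?W" "?W < ?V" using vw by auto
      then obtain z where z: "z > ?W" "z < ?V" "?V powr \<alpha> - ?W powr \<alpha> = (?V - ?W) * (\<alpha> * z powr (\<alpha> - 1))"
        using MVT2[of ?W ?V "\<lambda>z. z powr \<alpha>" "\<lambda>z. \<alpha> * z powr (\<alpha> - 1)"]
        by (metis has_real_derivative_powr less_le_trans)
      have "z powr (\<alpha> - 1) \<le> ?V powr (\<alpha> - 1)" using z pos \<alpha> by (intro powr_mono2) linarith+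
      then have "(?V - ?W) * (\<alpha> * z powr (\<alpha> - 1)) \<le> (?V - ?W) * (\<alpha> * ?V powr (\<alpha> - 1))"
        using pos \<alpha> by (intro mult_left_mono) auto
      then show ?thesis using z by (simp add: mult_ac)
    qed
    moreover have "?W powr \<alpha> = ?W powr (\<alpha> - 1) * ?W"
      using powr_add[of ?W "\<alpha> - 1" 1] by (cases "w = 0") auto
    moreover have "?V powr (\<alpha> - 1) * ?W \<le> ?V powr \<alpha>"
    proof -
      have "?V powr (\<alpha> - 1) * ?W \<le> ?V powr (\<alpha> - 1) * ?V" using vw by (intro mult_left_mono) auto
      also have "\<dots> = ?V powr \<alpha>" using powr_add[of ?V "\<alpha> - 1" 1] by (cases "v = 0") auto
      finally show ?thesis .
    qed
    ultimately have 1: "(?V powr (\<alpha> - 1) - ?W powr (\<alpha> - 1)) * ?W \<le> \<alpha> * ?V powr (\<alpha> - 1) * (?V - ?W)"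
      by (simp add: left_diff_distrib)
    have W: "?W powr (\<alpha> - 1) \<le> ?V powr (\<alpha> - 1)" using vw \<alpha> by (intro powr_mono2) auto
    have "norm v powr (\<alpha> - 1) *\<^sub>R v - norm w powr (\<alpha> - 1) *\<^sub>R w
      = ?V powr (\<alpha> - 1) *\<^sub>R (v - w) + (?V powr (\<alpha> - 1) - ?W powr (\<alpha> - 1)) *\<^sub>R w"
      by (simp add: algebra_simps)
    also have "norm \<dots> \<le> ?V powr (\<alpha> - 1) * norm (v - w) + (?V powr (\<alpha> - 1) - ?W powr (\<alpha> - 1)) * ?W"
      using W by (intro order_trans[OF norm_triangle_ineq]) simp
    also have "\<dots> \<le> ?V powr (\<alpha> - 1) * norm (v - w) + \<alpha> * ?V powr (\<alpha> - 1) * norm (v - w)"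
      using 1 norm_triangle_ineq2[of v w] \<alpha>
      by (intro add_left_mono) (smt (verit) mult_left_mono mult_nonneg_nonneg powr_ge_zero)
    also have "\<dots> = (1 + \<alpha>) * norm (v - w) * ?V powr (\<alpha> - 1)" by (simp add: algebra_simps)
    also have "\<dots> \<le> (1 + \<alpha>) * norm (v - w) * R powr (\<alpha> - 1)"
      using \<alpha> R1 by (intro mult_left_mono) auto
    finally show ?thesis by (simp add: mult_ac)
  qed
  show ?thesis
  proof (cases "norm w \<le> norm v")
    case True then show ?thesis using main R by blast
  next
    case False
    then show ?thesis using main[of w v] R by (simp add: norm_minus_commute)
  qed
qed

lemma hh_nonlinearity_diff_le:
  fixes u v :: "'a::euclidean_space \<Rightarrow> 'b::euclidean_space"
  assumes \<alpha>: "1 < \<alpha>" and s: "s * (\<alpha> - 1) = 2 + \<gamma>" and \<tau>: "0 < \<tau>" and M: "0 \<le> M"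
    and u: "norm (u y) \<le> M * parabolic_norm \<tau> y powr (- s)"
    and v: "norm (v y) \<le> M * parabolic_norm \<tau> y powr (- s)"
    and uv: "norm (u y - v y) \<le> D * parabolic_norm \<tau> y powr (- s)"
  shows "norm (hh_nonlinearity \<gamma> \<alpha> u y - hh_nonlinearity \<gamma> \<alpha> v y) \<le> (1 + \<alpha>) * M powr (\<alpha> - 1) * D * hardy_weight \<gamma> s \<tau> y"
proof -
  let ?m = "parabolic_norm \<tau> y"
  have m: "0 < ?m" using \<tau> by (rule parabolic_norm_pos)
  have "hh_nonlinearity \<gamma> \<alpha> u y - hh_nonlinearity \<gamma> \<alpha> v y
    = norm y powr \<gamma> *\<^sub>R (norm (u y) powr (\<alpha> - 1) *\<^sub>R u y - norm (v y) powr (\<alpha> - 1) *\<^sub>R v y)"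
    by (simp add: hh_nonlinearity_def scaleR_diff_right)
  also have "norm \<dots> = norm y powr \<gamma> * norm (norm (u y) powr (\<alpha> - 1) *\<^sub>R u y - norm (v y) powr (\<alpha> - 1) *\<^sub>R v y)"
    by simp
  also have "\<dots> \<le> norm y powr \<gamma> * ((1 + \<alpha>) * (M * ?m powr (- s)) powr (\<alpha> - 1) * norm (u y - v y))"
    using \<alpha> u v by (intro mult_left_mono norm_powr_scaleR_diff_le) auto
  also have "\<dots> \<le> norm y powr \<gamma> * ((1 + \<alpha>) * (M * ?m powr (- s)) powr (\<alpha> - 1) * (D * ?m powr (- s)))"
    using \<alpha> uv by (intro mult_left_mono) auto
  also have "(M * ?m powr (- s)) powr (\<alpha> - 1) = M powr (\<alpha> - 1) * ?m powr (- (2 + \<gamma>))"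
  proof -
    have "- s * (\<alpha> - 1) = - (2 + \<gamma>)" using s by simp
    then show ?thesis using M by (simp add: powr_mult powr_powr)
  qed
  also have "norm y powr \<gamma> * ((1 + \<alpha>) * (M powr (\<alpha> - 1) * ?m powr (- (2 + \<gamma>))) * (D * ?m powr (- s)))
    = (1 + \<alpha>) * M powr (\<alpha> - 1) * D * (norm y powr \<gamma> * (?m powr (- (2 + \<gamma>)) * ?m powr (- s)))"
    by (simp add: mult_ac)
  also have "?m powr (- (2 + \<gamma>)) * ?m powr (- s) = ?m powr (- (s + 2 + \<gamma>))"
    unfolding powr_add[symmetric] by (simp add: algebra_simps)
  finally show ?thesis by (simp add: hardy_weight_def)
qed

section \<open>The fixed point\<close>

text \<open>Used at one point \<open>(t, x)\<close> at a time, so that no complete space of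
  functions is built. The explicit rate later passes the limit through the Duhamel integral.\<close>

lemma geometric_increments_converge:
  fixes X :: "nat \<Rightarrow> 'b::banach"
  assumes "\<And>n. norm (X (Suc n) - X n) \<le> K / 2 ^ n"
  shows "\<exists>L. X \<longlonglongrightarrow> L \<and> (\<forall>n. norm (L - X n) \<le> 2 * K / 2 ^ n)"
proof -
  have geo: "(\<lambda>i. K * (1/2) ^ n * (1/2) ^ i) sums (K * (1/2) ^ n * 2)" for n
    using geometric_sums[of "1/2::real"] by (intro sums_mult) simp
  have le: "norm (X (Suc (i + n)) - X (i + n)) \<le> K * (1/2) ^ n * (1/2) ^ i" for i n
    using assms[of "i + n"] by (simp add: power_add power_one_over field_simps)
  have "summable (\<lambda>i. X (Suc i) - X i)"
    using le[of _ 0] by (intro summable_comparison_test'[OF sums_summable[OF geo[of 0]], of 0]) simp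
  then have "convergent (\<lambda>n. \<Sum>i<n. X (Suc i) - X i)" by (simp add: summable_iff_convergent)
  then have "convergent (\<lambda>n. X n - X 0)" by (simp add: sum_lessThan_telescope)
  then obtain L0 where "(\<lambda>n. X n - X 0) \<longlonglongrightarrow> L0" by (auto simp: convergent_def)
  from tendsto_add[OF this tendsto_const[of "X 0"]] have L: "X \<longlonglongrightarrow> L0 + X 0" by simp
  have "norm (L0 + X 0 - X n) \<le> 2 * K / 2 ^ n" for n
  proof -
    have "(\<lambda>i. X (i + n) - X n) \<longlonglongrightarrow> L0 + X 0 - X n"
      by (intro tendsto_diff LIMSEQ_ignore_initial_segment[OF L] tendsto_const)
    moreover have "norm (X (i + n) - X n) \<le> 2 * K / 2 ^ n" for i
    proof -
      have "X (i + n) - X n = (\<Sum>j<i. X (Suc (j + n)) - X (j + n))"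
        using sum_lessThan_telescope[of "\<lambda>j. X (j + n)" i] by simp
      also have "norm \<dots> \<le> (\<Sum>j<i. K * (1/2) ^ n * (1/2) ^ j)"
        by (intro sum_norm_le le)
      also have "\<dots> \<le> K * (1/2) ^ n * 2"
        unfolding sums_unique[OF geo[of n]]
      proof (intro sum_le_suminf)
        fix j
        show "0 \<le> K * (1/2) ^ n * (1/2) ^ j" using le[of j n] norm_ge_zero order_trans by blast
      qed (use geo[of n] in \<open>auto intro: sums_summable\<close>)
      finally show ?thesis by (simp add: power_one_over mult.commute)
    qed
    ultimately show ?thesis using Lim_bounded[OF tendsto_norm] by blast
  qed
  with L show ?thesis by blast
qed

text \<open>Starting from 0, the first iterate is \<open>L\<close> itself for \<open>t > 0\<close>.
  The value 0 for \<open>t \<le> 0\<close> keeps every iterate jointly Borel on the whole of space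
  and time and makes the limit exist there too.\<close>

primrec picard ::
  "real \<Rightarrow> real \<Rightarrow> real \<Rightarrow> (real \<Rightarrow> 'a \<Rightarrow> 'b) \<Rightarrow> nat \<Rightarrow> real \<Rightarrow> 'a::euclidean_space \<Rightarrow> 'b::euclidean_space" where
  "picard a \<gamma> \<alpha> L 0 = (\<lambda>t x. 0)"
| "picard a \<gamma> \<alpha> L (Suc n) = (\<lambda>t x. if 0 < t then
      L t x + a *\<^sub>R duhamel t (\<lambda>\<tau>. hh_nonlinearity \<gamma> \<alpha> (picard a \<gamma> \<alpha> L n \<tau>)) x else 0)"

lemma borel_measurable_hh_nonlinearity:
  assumes [measurable]: "(\<lambda>(\<tau>, y). u \<tau> y) \<in> borel_measurable (borel \<Otimes>\<^sub>M borel)"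
  shows "(\<lambda>(\<tau>, y). hh_nonlinearity \<gamma> \<alpha> (u \<tau>) y) \<in> borel_measurable (borel \<Otimes>\<^sub>M borel)"
  unfolding hh_nonlinearity_def by measurable

lemma hh_nonlinearity_zero [simp]: "hh_nonlinearity \<gamma> \<alpha> (\<lambda>x. 0) = (\<lambda>y. 0)"
  by (simp add: hh_nonlinearity_def fun_eq_iff)

lemma duhamel_zero [simp]: "duhamel t (\<lambda>\<tau> y. 0) x = 0"
  by (simp add: duhamel_def heat_def)

lemma borel_measurable_picard:
  assumes L[measurable]: "(\<lambda>(t, x). L t x) \<in> borel_measurable (borel \<Otimes>\<^sub>M borel)"
  shows "(\<lambda>(t, x). picard a \<gamma> \<alpha> L n t x) \<in> borel_measurable (borel \<Otimes>\<^sub>M borel)"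
proof (induction n)
  case (Suc n)
  note [measurable] = borel_measurable_duhamel[OF borel_measurable_hh_nonlinearity[OF Suc]]
  show ?case unfolding picard.simps by measurable
qed simp

definition parabolic_bounded :: "real \<Rightarrow> real \<Rightarrow> (real \<Rightarrow> 'a::euclidean_space \<Rightarrow> 'b::euclidean_space) \<Rightarrow> bool" where
  "parabolic_bounded s M u \<longleftrightarrow> (\<lambda>(t, x). u t x) \<in> borel_measurable (borel \<Otimes>\<^sub>M borel) \<and>
     (\<forall>t>0. \<forall>x. norm (u t x) \<le> M * parabolic_norm t x powr (- s))"

lemma hardy_dominated_nonlinearity_diff:
  assumes \<alpha>: "1 < \<alpha>" "s * (\<alpha> - 1) = 2 + \<gamma>" and M: "0 \<le> M" "0 \<le> D"
    and u: "parabolic_bounded s M u" and v: "parabolic_bounded s M v"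
    and uv: "\<And>t x. 0 < t \<Longrightarrow> norm (u t x - v t x) \<le> D * parabolic_norm t x powr (- s)"
  shows "hardy_dominated \<gamma> s ((1 + \<alpha>) * M powr (\<alpha> - 1) * D)
    (\<lambda>\<tau> y. hh_nonlinearity \<gamma> \<alpha> (u \<tau>) y - hh_nonlinearity \<gamma> \<alpha> (v \<tau>) y)"
proof -
  have [measurable]: "(\<lambda>(\<tau>, y). hh_nonlinearity \<gamma> \<alpha> (u \<tau>) y) \<in> borel_measurable (borel \<Otimes>\<^sub>M borel)"
     "(\<lambda>(\<tau>, y). hh_nonlinearity \<gamma> \<alpha> (v \<tau>) y) \<in> borel_measurable (borel \<Otimes>\<^sub>M borel)"
    using u v by (auto simp: parabolic_bounded_def intro!: borel_measurable_hh_nonlinearity)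
  have "(\<lambda>(\<tau>, y). hh_nonlinearity \<gamma> \<alpha> (u \<tau>) y - hh_nonlinearity \<gamma> \<alpha> (v \<tau>) y) \<in> borel_measurable (borel \<Otimes>\<^sub>M borel)"
    by measurable
  moreover have "norm (hh_nonlinearity \<gamma> \<alpha> (u \<tau>) y - hh_nonlinearity \<gamma> \<alpha> (v \<tau>) y)
      \<le> (1 + \<alpha>) * M powr (\<alpha> - 1) * D * hardy_weight \<gamma> s \<tau> y" if "0 < \<tau>" for \<tau> y
    using \<alpha> M u v uv that by (intro hh_nonlinearity_diff_le) (auto simp: parabolic_bounded_def)
  ultimately show ?thesis using \<alpha> M by (simp add: hardy_dominated_def)
qed

lemma parabolic_bounded_zero: "0 \<le> M \<Longrightarrow> parabolic_bounded s M (\<lambda>t x. 0)"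
  by (simp add: parabolic_bounded_def case_prod_unfold)

text \<open>The case \<open>v = 0\<close>, \<open>D = M\<close> of the difference estimate, which
  explains the generous factor \<open>1 + \<alpha>\<close>.\<close>

lemma hardy_dominated_nonlinearity:
  assumes \<alpha>: "1 < \<alpha>" "s * (\<alpha> - 1) = 2 + \<gamma>" and M: "0 \<le> M" and u: "parabolic_bounded s M u"
  shows "hardy_dominated \<gamma> s ((1 + \<alpha>) * M powr (\<alpha> - 1) * M) (\<lambda>\<tau>. hh_nonlinearity \<gamma> \<alpha> (u \<tau>))"
  using hardy_dominated_nonlinearity_diff[OF \<alpha> M M u parabolic_bounded_zero[OF M]] u
  by (simp add: parabolic_bounded_def)

text \<open>\<open>M\<close> is split in halves: one for \<open>L\<close>, one for the Duhamel term,
  whose Lipschitz factor is 1/2 by \<open>small\<close>. The convergence of the iterates is part of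
  the conclusion because self-similarity is inherited from them.\<close>

lemma parabolic_bounded_fixed_point:
  fixes L :: "real \<Rightarrow> 'a::euclidean_space \<Rightarrow> 'b::euclidean_space"
  assumes \<gamma>: "- 2 < \<gamma>" "- real DIM('a) < \<gamma>" and s: "0 < s" and \<alpha>: "1 < \<alpha>" "s * (\<alpha> - 1) = 2 + \<gamma>"
    and a: "\<bar>a\<bar> \<le> 1" and M: "0 \<le> M" and L: "parabolic_bounded s (M / 2) L"
    and C: "0 \<le> C" "\<And>t x. 0 < t \<Longrightarrow> hardy_potential \<gamma> s t (x::'a) \<le> ennreal (C * parabolic_norm t x powr (- s))"
    and small: "(1 + \<alpha>) * M powr (\<alpha> - 1) * C \<le> 1 / 2"
  shows "\<exists>u. parabolic_bounded s M u \<and>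
    (\<forall>t>0. \<forall>x. (\<lambda>n. picard a \<gamma> \<alpha> L n t x) \<longlonglongrightarrow> u t x \<and>
       u t x = L t x + a *\<^sub>R duhamel t (\<lambda>\<tau>. hh_nonlinearity \<gamma> \<alpha> (u \<tau>)) x)"
proof -
  let ?N = "\<lambda>u \<tau>. hh_nonlinearity \<gamma> \<alpha> (u \<tau>)"
  let ?P = "picard a \<gamma> \<alpha> L"
  have R: "0 \<le> C * parabolic_norm t x powr (- s)" for t and x :: 'a using C by simp
  \<comment> \<open>Distances are measured by the constant \<open>D\<close> in front of the profile
    \<open>parabolic_norm t x powr (- s)\<close>. Domination of the difference of the nonlinearities
    and the bound on the potential multiply to the factor in \<open>small\<close>.\<close>
  have lip: "norm (duhamel t (?N u) x - duhamel t (?N v) x) \<le> D / 2 * parabolic_norm t x powr (- s)"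
    if u: "parabolic_bounded s M u" and v: "parabolic_bounded s M v" and D: "0 \<le> D"
      and uv: "\<And>t x. 0 < t \<Longrightarrow> norm (u t x - v t x) \<le> D * parabolic_norm t x powr (- s)"
      and t: "0 < t"
    for u v :: "real \<Rightarrow> 'a \<Rightarrow> 'b" and D t x
  proof -
    have "duhamel t (?N u) x - duhamel t (?N v) x = duhamel t (\<lambda>\<tau> y. ?N u \<tau> y - ?N v \<tau> y) x"
      using hardy_dominated_nonlinearity[OF \<alpha> M u] hardy_dominated_nonlinearity[OF \<alpha> M v]
      by (rule duhamel_diff[symmetric, OF _ _ \<gamma> s C(2)[OF t] R])
    also have "norm \<dots> \<le> (1 + \<alpha>) * M powr (\<alpha> - 1) * D * (C * parabolic_norm t x powr (- s))"
      using hardy_dominated_nonlinearity_diff[OF \<alpha> M D u v uv]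
      by (rule hardy_dominated_duhamel(2)[OF _ C(2)[OF t] R])
    also have "\<dots> = ((1 + \<alpha>) * M powr (\<alpha> - 1) * C) * (D * parabolic_norm t x powr (- s))" by (simp add: mult_ac)
    also have "\<dots> \<le> 1 / 2 * (D * parabolic_norm t x powr (- s))"
      using D by (intro mult_right_mono small) auto
    finally show ?thesis by simp
  qed
  have P: "parabolic_bounded s M (?P n)" for n
  proof (induction n)
    case 0
    then show ?case using parabolic_bounded_zero[OF M] by simp
  next
    case (Suc n)
    have "(\<lambda>(t, x). ?P (Suc n) t x) \<in> borel_measurable (borel \<Otimes>\<^sub>M borel)"
      using L by (intro borel_measurable_picard) (simp add: parabolic_bounded_def)
    moreover have "norm (?P (Suc n) t x) \<le> M * parabolic_norm t x powr (- s)" if t: "0 < t" for t x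
    proof -
      \<comment> \<open>Comparison with the zero function, whose Duhamel term is 0: the contraction
        estimate with \<open>D = M\<close> keeps the next iterate below \<open>M\<close>.\<close>
      have "norm (duhamel t (?N (?P n)) x) \<le> M / 2 * parabolic_norm t x powr (- s)"
        using lip[OF Suc parabolic_bounded_zero[OF M] M _ t, of x] Suc by (simp add: parabolic_bounded_def)
      moreover have "\<bar>a\<bar> * norm (duhamel t (?N (?P n)) x) \<le> 1 * norm (duhamel t (?N (?P n)) x)"
        using a by (intro mult_right_mono) auto
      moreover have "norm (L t x) \<le> M / 2 * parabolic_norm t x powr (- s)"
        using L t by (auto simp: parabolic_bounded_def)
      moreover have "norm (?P (Suc n) t x) \<le> norm (L t x) + \<bar>a\<bar> * norm (duhamel t (?N (?P n)) x)"
        using t by (simp, intro order_trans[OF norm_triangle_ineq]) simp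
      ultimately show ?thesis by (simp add: field_simps)
    qed
    ultimately show ?case by (simp add: parabolic_bounded_def)
  qed
  have step: "norm (?P (Suc n) t x - ?P n t x) \<le> M * parabolic_norm t x powr (- s) / 2 ^ n" if "0 < t" for n t x
    using that
  proof (induction n arbitrary: t x)
    case 0
    then show ?case using P[of 1] by (simp add: parabolic_bounded_def)
  next
    case (Suc n)
    have "norm (duhamel t (?N (?P (Suc n))) x - duhamel t (?N (?P n)) x) \<le> M / 2 ^ n / 2 * parabolic_norm t x powr (- s)"
      using M Suc by (intro lip P) (auto simp: divide_inverse mult_ac)
    moreover have "?P (Suc (Suc n)) t x - ?P (Suc n) t x = a *\<^sub>R (duhamel t (?N (?P (Suc n))) x - duhamel t (?N (?P n)) x)"
      using Suc(2) by (simp only: picard.simps if_True scaleR_diff_right) simp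
    moreover have "\<bar>a\<bar> * norm (duhamel t (?N (?P (Suc n))) x - duhamel t (?N (?P n)) x) \<le> 1 * norm (duhamel t (?N (?P (Suc n))) x - duhamel t (?N (?P n)) x)"
      using a by (intro mult_right_mono) auto
    ultimately show ?case by (simp only: norm_scaleR) (simp add: mult_ac)
  qed
  define u where "u t x = (if 0 < t then lim (\<lambda>n. ?P n t x) else 0)" for t x
  have u: "(\<lambda>n. ?P n t x) \<longlonglongrightarrow> u t x"
     "norm (u t x - ?P n t x) \<le> 2 * M / 2 ^ n * parabolic_norm t x powr (- s)" if t: "0 < t" for t x n
  proof -
    obtain l where l: "(\<lambda>n. ?P n t x) \<longlonglongrightarrow> l" "norm (l - ?P n t x) \<le> 2 * (M * parabolic_norm t x powr (- s)) / 2 ^ n" for n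
      using geometric_increments_converge[of "\<lambda>n. ?P n t x" "M * parabolic_norm t x powr (- s)"] step[OF t, of _ x] by blast
    moreover have "u t x = l" using l(1) t by (simp add: u_def limI)
    ultimately show "(\<lambda>n. ?P n t x) \<longlonglongrightarrow> u t x" "norm (u t x - ?P n t x) \<le> 2 * M / 2 ^ n * parabolic_norm t x powr (- s)"
      by (simp_all add: mult_ac)
  qed
  have P0: "?P n t x = 0" if "\<not> 0 < t" for n t x using that by (cases n) auto
  have ub: "parabolic_bounded s M u"
    unfolding parabolic_bounded_def
  proof (intro conjI allI impI)
    show "(\<lambda>(t, x). u t x) \<in> borel_measurable (borel \<Otimes>\<^sub>M borel)"
    proof (rule borel_measurable_LIMSEQ_metric)
      show "(\<lambda>(t, x). ?P n t x) \<in> borel_measurable (borel \<Otimes>\<^sub>M borel)" for n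
        using P[of n] by (simp add: parabolic_bounded_def)
      show "(\<lambda>n. case w of (t, x) \<Rightarrow> ?P n t x) \<longlonglongrightarrow> (case w of (t, x) \<Rightarrow> u t x)" for w
        using u(1) P0 by (cases w; cases "0 < fst w") (auto simp: u_def)
    qed
    fix t :: real and x assume t: "0 < t"
    show "norm (u t x) \<le> M * parabolic_norm t x powr (- s)"
      using P t by (intro Lim_bounded[OF tendsto_norm[OF u(1)[OF t]]]) (auto simp: parabolic_bounded_def)
  qed
  have "u t x = L t x + a *\<^sub>R duhamel t (?N u) x" if t: "0 < t" for t x
  proof -
    \<comment> \<open>Continuity of the Duhamel term along the iterates is again the contraction
      estimate, now with \<open>D = 2 * M / 2 ^ n\<close>.\<close>
    have "(\<lambda>n. duhamel t (?N (?P n)) x) \<longlonglongrightarrow> duhamel t (?N u) x"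
    proof (rule Lim_null_comparison[THEN LIM_zero_cancel])
      have le: "norm (duhamel t (?N (?P n)) x - duhamel t (?N u) x) \<le> 2 * M / 2 ^ n / 2 * parabolic_norm t x powr (- s)" for n
      proof (rule lip[OF P ub _ _ t])
        show "norm (?P n t x - u t x) \<le> 2 * M / 2 ^ n * parabolic_norm t x powr (- s)" if "0 < t" for t x
          using u(2)[OF that, of x n] by (subst norm_minus_commute)
      qed (use M in simp)
      show "\<forall>\<^sub>F n in sequentially. norm (duhamel t (?N (?P n)) x - duhamel t (?N u) x) \<le> (M * parabolic_norm t x powr (- s)) * (1/2) ^ n"
      proof (intro always_eventually allI)
        fix n
        have "2 * M / 2 ^ n / 2 * parabolic_norm t x powr (- s) = (M * parabolic_norm t x powr (- s)) * (1/2) ^ n"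
          by (simp add: power_one_over)
        then show "norm (duhamel t (?N (?P n)) x - duhamel t (?N u) x) \<le> (M * parabolic_norm t x powr (- s)) * (1/2) ^ n"
          using le[of n]
          by (simp only:)
      qed
      show "(\<lambda>n. (M * parabolic_norm t x powr (- s)) * (1/2) ^ n) \<longlonglongrightarrow> 0"
        by (intro tendsto_mult_right_zero LIMSEQ_power_zero) auto
    qed
    then have "(\<lambda>n. L t x + a *\<^sub>R duhamel t (?N (?P n)) x) \<longlonglongrightarrow> L t x + a *\<^sub>R duhamel t (?N u) x"
      by (intro tendsto_intros)
    then have "(\<lambda>n. ?P (Suc n) t x) \<longlonglongrightarrow> L t x + a *\<^sub>R duhamel t (?N u) x" using t by simp
    moreover have "(\<lambda>n. ?P (Suc n) t x) \<longlonglongrightarrow> u t x" using u(1)[OF t] by (rule LIMSEQ_Suc)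
    ultimately show ?thesis by (rule LIMSEQ_unique[rotated])
  qed
  with u(1) ub show ?thesis by blast
qed

section \<open>Scaling and weak Lebesgue norms\<close>

lemma heat_scaleR:
  fixes f :: "'a::euclidean_space \<Rightarrow> 'b::euclidean_space"
  assumes [measurable]: "f \<in> borel_measurable lebesgue" and c: "0 < c" and t: "0 < t"
  shows "heat (c\<^sup>2 * t) f (c *\<^sub>R x) = heat t (\<lambda>y. f (c *\<^sub>R y)) x"
proof -
  have [measurable]: "(\<lambda>y. heat_kernel r (z - y)) \<in> borel_measurable lebesgue" for r and z :: 'a
    by (rule measurable_completion) measurable
  have "heat (c\<^sup>2 * t) f (c *\<^sub>R x) = (\<bar>c\<bar> ^ DIM('a)) *\<^sub>R (\<integral>y. heat_kernel (c\<^sup>2 * t) (c *\<^sub>R x - c *\<^sub>R y) *\<^sub>R f (c *\<^sub>R y) \<partial>lebesgue)"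
    unfolding heat_def using c by (intro integral_lebesgue_scaleR) auto
  also have "\<dots> = (\<integral>y. heat_kernel t (x - y) *\<^sub>R f (c *\<^sub>R y) \<partial>lebesgue)"
    using c t by (simp add: heat_kernel_scaleR flip: scaleR_diff_right integral_scaleR_right)
  finally show ?thesis by (simp add: heat_def)
qed

text \<open>The heat flow commutes with parabolic dilations, and substituting
  \<open>c^2 * \<tau>\<close> for the time variable contributes \<open>c^2\<close>; this lifts the
  degree \<open>- (s + 2)\<close> of the source to \<open>- s\<close>.\<close>

lemma duhamel_scaleR:
  fixes F :: "real \<Rightarrow> 'a::euclidean_space \<Rightarrow> 'b::euclidean_space"
  assumes F[measurable]: "(\<lambda>(\<tau>, y). F \<tau> y) \<in> borel_measurable (borel \<Otimes>\<^sub>M borel)"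
    and scale: "\<And>\<tau> y. 0 < \<tau> \<Longrightarrow> F (c\<^sup>2 * \<tau>) (c *\<^sub>R y) = c powr (- (s + 2)) *\<^sub>R F \<tau> y"
    and c: "0 < c" and t: "0 < t"
  shows "duhamel (c\<^sup>2 * t) F (c *\<^sub>R x) = c powr (- s) *\<^sub>R duhamel t F x"
proof -
  have Fm: "F \<tau> \<in> borel_measurable lebesgue" for \<tau>
    using measurable_Pair2[OF F, of \<tau>] by (intro measurable_completion) simp
  let ?h = "\<lambda>\<tau>. indicat_real {0<..<c\<^sup>2 * t} \<tau> *\<^sub>R heat (c\<^sup>2 * t - \<tau>) (F \<tau>) (c *\<^sub>R x)"
  have [measurable]: "(\<lambda>\<tau>. heat (c\<^sup>2 * t - \<tau>) (F \<tau>) (c *\<^sub>R x)) \<in> borel_measurable borel"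
    by (rule borel_measurable_heat[OF F]) auto
  have "?h \<in> borel_measurable lebesgue"
    by (rule measurable_completion) measurable
  then have "duhamel (c\<^sup>2 * t) F (c *\<^sub>R x) = (\<bar>c\<^sup>2\<bar> ^ DIM(real)) *\<^sub>R (\<integral>\<tau>. ?h (c\<^sup>2 *\<^sub>R \<tau>) \<partial>lebesgue)"
    unfolding duhamel_def set_lebesgue_integral_def using c by (intro integral_lebesgue_scaleR) auto
  also have "(\<lambda>\<tau>. ?h (c\<^sup>2 *\<^sub>R \<tau>)) = (\<lambda>\<tau>. c powr (- (s + 2)) *\<^sub>R (indicat_real {0<..<t} \<tau> *\<^sub>R heat (t - \<tau>) (F \<tau>) x))"
  proof
    fix \<tau>
    show "?h (c\<^sup>2 *\<^sub>R \<tau>) = c powr (- (s + 2)) *\<^sub>R (indicat_real {0<..<t} \<tau> *\<^sub>R heat (t - \<tau>) (F \<tau>) x)"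
    proof (cases "\<tau> \<in> {0<..<t}")
      case True
      have "heat (c\<^sup>2 * t - c\<^sup>2 * \<tau>) (F (c\<^sup>2 * \<tau>)) (c *\<^sub>R x) = heat (c\<^sup>2 * (t - \<tau>)) (F (c\<^sup>2 * \<tau>)) (c *\<^sub>R x)"
        by (simp add: right_diff_distrib)
      also have "\<dots> = heat (t - \<tau>) (\<lambda>y. F (c\<^sup>2 * \<tau>) (c *\<^sub>R y)) x"
        using c True by (intro heat_scaleR Fm) auto
      also have "\<dots> = c powr (- (s + 2)) *\<^sub>R heat (t - \<tau>) (F \<tau>) x"
        unfolding heat_def using scale[of \<tau>] True by (simp add: scaleR_left_commute del: scaleR_scaleR flip: integral_scaleR_right)
      finally show ?thesis using True c by (auto simp: indicator_def)
    qed (use c in \<open>auto simp: indicator_def zero_less_mult_iff\<close>)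
  qed
  also have "(\<bar>c\<^sup>2\<bar> ^ DIM(real)) *\<^sub>R (\<integral>\<tau>. c powr (- (s + 2)) *\<^sub>R (indicat_real {0<..<t} \<tau> *\<^sub>R heat (t - \<tau>) (F \<tau>) x) \<partial>lebesgue)
    = (c\<^sup>2 * c powr (- (s + 2))) *\<^sub>R duhamel t F x"
    unfolding duhamel_def set_lebesgue_integral_def by (subst integral_scaleR_right) simp
  also have "c\<^sup>2 * c powr (- (s + 2)) = c powr (- s)"
  proof -
    have "c\<^sup>2 = c powr 2" using c by simp
    then show ?thesis by (simp only: powr_add[symmetric]) simp
  qed
  finally show ?thesis .
qed

lemma hh_nonlinearity_scaleR:
  fixes u :: "real \<Rightarrow> 'a::euclidean_space \<Rightarrow> 'b::euclidean_space"
  assumes s: "s * (\<alpha> - 1) = 2 + \<gamma>" and c: "0 < c"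
    and u: "\<And>y. u (c\<^sup>2 * \<tau>) (c *\<^sub>R y) = c powr (- s) *\<^sub>R u \<tau> y"
  shows "hh_nonlinearity \<gamma> \<alpha> (u (c\<^sup>2 * \<tau>)) (c *\<^sub>R y) = c powr (- (s + 2)) *\<^sub>R hh_nonlinearity \<gamma> \<alpha> (u \<tau>) y"
proof -
  have "- s * (\<alpha> - 1) = - (2 + \<gamma>)" using s by simp
  then have "hh_nonlinearity \<gamma> \<alpha> (u (c\<^sup>2 * \<tau>)) (c *\<^sub>R y)
    = (c powr \<gamma> * c powr (- (2 + \<gamma>)) * c powr (- s)) *\<^sub>R hh_nonlinearity \<gamma> \<alpha> (u \<tau>) y"
    unfolding hh_nonlinearity_def u using c by (simp add: powr_mult powr_powr mult_ac)
  also have "c powr \<gamma> * c powr (- (2 + \<gamma>)) * c powr (- s) = c powr (- (s + 2))"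
    unfolding powr_add[symmetric] by (simp add: algebra_simps)
  finally show ?thesis .
qed

text \<open>The nonlinearity lowers the degree \<open>- s\<close> to \<open>- (s + 2)\<close>
  because \<open>s * (\<alpha> - 1) = 2 + \<gamma>\<close>, and the Duhamel operator restores
  it.\<close>

lemma picard_scaleR:
  fixes L :: "real \<Rightarrow> 'a::euclidean_space \<Rightarrow> 'b::euclidean_space"
  assumes L: "(\<lambda>(t, x). L t x) \<in> borel_measurable (borel \<Otimes>\<^sub>M borel)"
    and scale: "\<And>t x. 0 < t \<Longrightarrow> L (c\<^sup>2 * t) (c *\<^sub>R x) = c powr (- s) *\<^sub>R L t x"
    and s: "s * (\<alpha> - 1) = 2 + \<gamma>" and c: "0 < c" and t: "0 < t"
  shows "picard a \<gamma> \<alpha> L n (c\<^sup>2 * t) (c *\<^sub>R x) = c powr (- s) *\<^sub>R picard a \<gamma> \<alpha> L n t x"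
  using t
proof (induction n arbitrary: t x)
  case (Suc n)
  have "duhamel (c\<^sup>2 * t) (\<lambda>\<tau>. hh_nonlinearity \<gamma> \<alpha> (picard a \<gamma> \<alpha> L n \<tau>)) (c *\<^sub>R x)
    = c powr (- s) *\<^sub>R duhamel t (\<lambda>\<tau>. hh_nonlinearity \<gamma> \<alpha> (picard a \<gamma> \<alpha> L n \<tau>)) x"
    using c Suc s
    by (intro duhamel_scaleR borel_measurable_hh_nonlinearity borel_measurable_picard L hh_nonlinearity_scaleR) auto
  then show ?case using Suc c scale[of t x] by (simp add: scaleR_add_right scaleR_left_commute)
qed simp

text \<open>The null set on which homogeneity fails, which may depend on \<open>c\<close>,
  disappears under the integral, so the identity holds at every \<open>x\<close>.\<close>

lemma heat_homogeneous:
  fixes \<Phi> :: "'a::euclidean_space \<Rightarrow> 'b::euclidean_space"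
  assumes \<Phi>[measurable]: "\<Phi> \<in> borel_measurable lebesgue"
    and hom: "AE y in lebesgue. \<Phi> (c *\<^sub>R y) = c powr (- s) *\<^sub>R \<Phi> y"
    and c: "0 < c" and t: "0 < t"
  shows "heat (c\<^sup>2 * t) \<Phi> (c *\<^sub>R x) = c powr (- s) *\<^sub>R heat t \<Phi> x"
proof -
  note [measurable] = measurable_lebesgue_scaleR[OF less_imp_neq[OF c, symmetric], where 'a='a]
  have [measurable]: "(\<lambda>y. heat_kernel t (x - y)) \<in> borel_measurable lebesgue"
    by (rule measurable_completion) measurable
  have "heat (c\<^sup>2 * t) \<Phi> (c *\<^sub>R x) = (\<integral>y. heat_kernel t (x - y) *\<^sub>R \<Phi> (c *\<^sub>R y) \<partial>lebesgue)"
    using heat_scaleR[OF \<Phi> c t] by (simp add: heat_def)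
  also have "\<dots> = (\<integral>y. c powr (- s) *\<^sub>R (heat_kernel t (x - y) *\<^sub>R \<Phi> y) \<partial>lebesgue)"
  proof (rule integral_cong_AE)
    show "AE y in lebesgue. heat_kernel t (x - y) *\<^sub>R \<Phi> (c *\<^sub>R y) = c powr (- s) *\<^sub>R (heat_kernel t (x - y) *\<^sub>R \<Phi> y)"
      using hom by eventually_elim (simp add: scaleR_left_commute)
  qed measurable
  also have "\<dots> = c powr (- s) *\<^sub>R heat t \<Phi> x" unfolding heat_def by (rule integral_scaleR_right)
  finally show ?thesis .
qed

section \<open>Lebesgue measurable data: Borel representatives and heat bounds\<close>

lemma completion_ex_borel_measurable_euclidean:
  fixes f :: "'a \<Rightarrow> 'b::euclidean_space"
  assumes [measurable]: "f \<in> borel_measurable (completion M)"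
  shows "\<exists>g\<in>borel_measurable M. AE x in M. f x = g x"
proof -
  \<comment> \<open>Coordinates reduce the claim to real values; only finitely many null sets are
    united.\<close>
  have "\<forall>b\<in>(Basis::'b set). \<exists>g\<in>borel_measurable M. AE x in M. f x \<bullet> b = g x"
    by (intro ballI completion_ex_borel_measurable_real) measurable
  then obtain g where g: "\<And>b. b \<in> (Basis::'b set) \<Longrightarrow> g b \<in> borel_measurable M"
      "\<And>b. b \<in> (Basis::'b set) \<Longrightarrow> AE x in M. f x \<bullet> b = g b x" by metis
  have "AE x in M. \<forall>b\<in>(Basis::'b set). f x \<bullet> b = g b x"
    using g(2) by (intro AE_finite_allI) auto
  then have "AE x in M. f x = (\<Sum>b\<in>Basis. g b x *\<^sub>R b)"
  proof eventually_elim
    case (elim x)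
    then show ?case using euclidean_representation[of "f x"] by simp
  qed
  moreover have "(\<lambda>x. \<Sum>b\<in>Basis. g b x *\<^sub>R b) \<in> borel_measurable M"
    using g(1) by measurable
  ultimately show ?thesis by (intro bexI[of _ "\<lambda>x. \<Sum>b\<in>Basis. g b x *\<^sub>R b"])
qed

lemma heat_cong_AE:
  assumes [measurable]: "f \<in> borel_measurable lebesgue" "g \<in> borel_measurable lebesgue"
    and fg: "AE y in lebesgue. f y = g y"
  shows "heat t f x = heat t g x"
proof -
  have [measurable]: "(\<lambda>y. heat_kernel t (x - y)) \<in> borel_measurable lebesgue"
    by (rule measurable_completion) measurable
  show ?thesis unfolding heat_def
  proof (rule integral_cong_AE)
    show "AE y in lebesgue. heat_kernel t (x - y) *\<^sub>R f y = heat_kernel t (x - y) *\<^sub>R g y"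
      using fg by eventually_elim simp
  qed measurable
qed

text \<open>The order of the quantifiers matters: \<open>C\<close> precedes \<open>K\<close> and
  \<open>\<Phi>\<close>, so the smallness threshold can be chosen before
  \<open>\<omega>\<close>.\<close>

lemma heat_norm_powr_bound:
  fixes B :: real
  assumes B: "0 \<le> B" "B < DIM('a)"
  shows "\<exists>C>0. \<forall>K\<ge>0. \<forall>\<Phi>::'a::euclidean_space \<Rightarrow> 'b::euclidean_space.
    \<Phi> \<in> borel_measurable lebesgue \<longrightarrow> (AE y in lebesgue. norm (\<Phi> y) \<le> K * norm y powr (- B)) \<longrightarrow>
    (\<forall>t>0. \<forall>x. heat_defined t \<Phi> x \<and> norm (heat t \<Phi> x) \<le> C * K * parabolic_norm t x powr (- B))"
proof -
  obtain C where C: "C > 0" "\<And>t x. t > 0 \<Longrightarrow>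
    (\<integral>\<^sup>+y. ennreal (heat_kernel t (x - y) * norm (y::'a) powr (- B)) \<partial>lborel)
      \<le> ennreal (C * parabolic_norm t x powr (- B))"
    using nn_integral_heat_kernel_norm_powr_le[OF B] by blast
  have "heat_defined t \<Phi> x \<and> norm (heat t \<Phi> x) \<le> C * K * parabolic_norm t x powr (- B)"
    if K: "0 \<le> K" and [measurable]: "\<Phi> \<in> borel_measurable lebesgue"
      and \<Phi>: "AE y in lebesgue. norm (\<Phi> y) \<le> K * norm y powr (- B)" and t: "0 < t"
    for K t x and \<Phi> :: "'a \<Rightarrow> 'b"
  proof -
    have [measurable]: "(\<lambda>y. heat_kernel t (x - y)) \<in> borel_measurable lebesgue"
      by (rule measurable_completion) measurable
    have "(\<integral>\<^sup>+y. ennreal (norm (heat_kernel t (x - y) *\<^sub>R \<Phi> y)) \<partial>lebesgue)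
      \<le> (\<integral>\<^sup>+y. ennreal K * ennreal (heat_kernel t (x - y) * norm y powr (- B)) \<partial>lebesgue)"
    proof (rule nn_integral_mono_AE)
      show "AE y in lebesgue. ennreal (norm (heat_kernel t (x - y) *\<^sub>R \<Phi> y)) \<le> ennreal K * ennreal (heat_kernel t (x - y) * norm y powr (- B))"
        using \<Phi>
      proof eventually_elim
        case (elim y)
        then have "heat_kernel t (x - y) * norm (\<Phi> y) \<le> heat_kernel t (x - y) * (K * norm y powr (- B))"
          by (intro mult_left_mono) auto
        then show ?case using K by (simp add: ennreal_mult[symmetric] ennreal_leI mult_ac)
      qed
    qed
    also have "\<dots> = ennreal K * (\<integral>\<^sup>+y. ennreal (heat_kernel t (x - y) * norm y powr (- B)) \<partial>lborel)"
      unfolding nn_integral_completion by (rule nn_integral_cmult) auto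
    also have "\<dots> \<le> ennreal K * ennreal (C * parabolic_norm t x powr (- B))"
      using C(2)[OF t] by (intro mult_left_mono) auto
    also have "\<dots> = ennreal (C * K * parabolic_norm t x powr (- B))"
      using K C by (simp add: ennreal_mult[symmetric] mult_ac)
    finally have le: "(\<integral>\<^sup>+y. ennreal (norm (heat_kernel t (x - y) *\<^sub>R \<Phi> y)) \<partial>lebesgue) \<le> ennreal (C * K * parabolic_norm t x powr (- B))" .
    have "heat_defined t \<Phi> x"
      unfolding heat_defined_def using le by (intro integrableI_bounded) (auto intro: le_less_trans)
    moreover have "ennreal (norm (heat t \<Phi> x)) \<le> ennreal (C * K * parabolic_norm t x powr (- B))"
      unfolding heat_def using ennreal_norm_integral_le le by (rule order_trans)
    ultimately show ?thesis using C K by (simp add: ennreal_le_iff)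
  qed
  with C(1) show ?thesis by blast
qed

section \<open>Weak Lebesgue norms and membership in \<open>K_space\<close>\<close>

lemma rearrangement_le_of_norm_powr:
  fixes g :: "'a::euclidean_space \<Rightarrow> 'b::real_normed_vector"
  assumes K: "0 < K" and P: "0 < P" and \<tau>: "0 < \<tau>"
    and g: "\<And>x. x \<noteq> 0 \<Longrightarrow> norm (g x) \<le> K * norm x powr (- real DIM('a) / P)" and g0: "g 0 = 0"
  shows "rearrangement g \<tau> \<le> ennreal (K * (measure lborel (ball (0::'a) 1) / \<tau>) powr (1 / P))"
proof -
  let ?d = "real DIM('a)"
  define V where "V = measure lborel (ball (0::'a) 1)"
  have V: "0 < V" unfolding V_def by (simp add: content_ball_pos)
  define \<sigma> where "\<sigma> = K * (V / \<tau>) powr (1 / P)"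
  have \<sigma>: "0 < \<sigma>" using K V \<tau> by (simp add: \<sigma>_def)
  \<comment> \<open>The ball of radius \<open>r\<close> has volume \<open>\<tau>\<close>, and
    \<open>\<sigma>\<close> is the value of the majorant on its boundary. The set where
    \<open>norm (g x)\<close> exceeds \<open>\<sigma>\<close> therefore lies in the ball, and
    \<open>\<sigma>\<close> competes in the infimum.\<close>
  define r where "r = (\<tau> / V) powr (1 / ?d)"
  have r: "0 < r" using V \<tau> by (simp add: r_def)
  have sub: "{x. \<sigma> < norm (g x)} \<subseteq> ball 0 r"
  proof
    fix x assume "x \<in> {x. \<sigma> < norm (g x)}"
    then have x: "\<sigma> < norm (g x)" by simp
    then have x0: "x \<noteq> 0" using g0 \<sigma> by auto
    have "K * (V / \<tau>) powr (1 / P) < K * norm x powr (- ?d / P)"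
      using x g[OF x0] by (simp add: \<sigma>_def)
    then have 1: "(V / \<tau>) powr (1 / P) < norm x powr (- ?d / P)" using K by simp
    have "norm x < r"
    proof (rule ccontr)
      assume "\<not> norm x < r"
      then have "norm x powr (- ?d / P) \<le> r powr (- ?d / P)"
        using r P by (intro powr_mono2') auto
      also have "\<dots> = (\<tau> / V) powr (- (1 / P))" by (simp add: r_def powr_powr)
      also have "\<dots> = (V / \<tau>) powr (1 / P)" using V \<tau> by (simp add: powr_minus powr_divide)
      finally show False using 1 by simp
    qed
    then show "x \<in> ball 0 r" by simp
  qed
  have "emeasure lebesgue {x. \<sigma> < norm (g x)} \<le> emeasure lebesgue (ball (0::'a) r)"
    by (intro emeasure_mono sub) auto
  also have "\<dots> = ennreal (V * r ^ DIM('a))" using r by (simp add: emeasure_lborel_ball_eq V_def)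
  also have "r ^ DIM('a) = \<tau> / V"
    using V \<tau> r by (simp add: r_def powr_realpow[symmetric] powr_powr)
  finally have "emeasure lebesgue {x. \<sigma> < norm (g x)} \<le> ennreal \<tau>" using V by simp
  then have "\<sigma> \<in> {s. 0 < s \<and> emeasure lebesgue {x. s < norm (g x)} \<le> ennreal \<tau>}" using \<sigma> by simp
  from INF_lower[OF this, of ennreal] show ?thesis
    unfolding rearrangement_def by (simp only: \<sigma>_def V_def)
qed

text \<open>Of the total power \<open>- s\<close>, the part \<open>- (s - \<kappa>)\<close> is
  charged to time and \<open>- \<kappa>\<close> to space. What is left is
  \<open>norm x powr (k - \<kappa>)\<close>, that is \<open>norm x powr (- d / p)\<close>, the
  borderline function of weak \<open>L^p\<close>. The conditions
  \<open>0 \<le> \<kappa> \<le> s\<close> say that both powers have the right sign.\<close>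

lemma weighted_weak_Lp_norm_bound:
  fixes k s :: real and p :: ennreal
  defines "\<kappa> \<equiv> k + real DIM('a) * enn2real (1 / p)"
  assumes p: "1 \<le> p" and \<kappa>: "0 \<le> \<kappa>" "\<kappa> \<le> s"
  shows "\<exists>C\<ge>0. \<forall>M>0. \<forall>t>0. \<forall>f::'a::euclidean_space \<Rightarrow> 'b::euclidean_space. f \<in> borel_measurable borel \<longrightarrow>
    (\<forall>x. norm (f x) \<le> M * parabolic_norm t x powr (- s)) \<longrightarrow>
    weighted_weak_Lp_norm k p f \<le> ennreal (C * M * t powr ((\<kappa> - s) / 2))"
proof -
  let ?d = "real DIM('a)"
  have pt: "norm (norm x powr k *\<^sub>R f x) \<le> M * t powr ((\<kappa> - s) / 2) * norm x powr (- ?d * enn2real (1 / p))"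
    if M: "0 < M" and t: "0 < t" and f: "\<And>x. norm (f x) \<le> M * parabolic_norm t x powr (- s)" and x: "x \<noteq> 0"
    for M t x and f :: "'a \<Rightarrow> 'b"
  proof -
    have "parabolic_norm t x powr (- s) = parabolic_norm t x powr (- (s - \<kappa>)) * parabolic_norm t x powr (- \<kappa>)"
      unfolding powr_add[symmetric] by simp
    also have "\<dots> \<le> t powr (- (s - \<kappa>) / 2) * norm x powr (- \<kappa>)"
      using \<kappa> t x by (intro mult_mono parabolic_norm_powr_le_norm parabolic_norm_powr_le_sqrt) auto
    finally have "norm x powr k * norm (f x) \<le> norm x powr k * (M * (t powr (- (s - \<kappa>) / 2) * norm x powr (- \<kappa>)))"
      using f[of x] M by (intro mult_left_mono order_trans[OF f[of x]]) auto
    also have "\<dots> = M * t powr (- (s - \<kappa>) / 2) * (norm x powr k * norm x powr (- \<kappa>))" by (simp add: mult_ac)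
    also have "norm x powr k * norm x powr (- \<kappa>) = norm x powr (- ?d * enn2real (1 / p))"
      unfolding powr_add[symmetric] by (simp add: \<kappa>_def)
    finally show ?thesis by simp
  qed
  show ?thesis
  proof (cases "p = \<infinity>")
    \<comment> \<open>Here \<open>enn2real (1 / p) = 0\<close>, so the spatial factor is constant
      and the essential supremum is bounded directly.\<close>
    case True
    have "weighted_weak_Lp_norm k p f \<le> ennreal (1 * M * t powr ((\<kappa> - s) / 2))"
      if M: "0 < M" "0 < t" and fm[measurable]: "f \<in> borel_measurable borel"
        and f: "\<And>x. norm (f x) \<le> M * parabolic_norm t x powr (- s)" for M t and f :: "'a \<Rightarrow> 'b"
    proof -
      have "norm (norm x powr k *\<^sub>R f x) \<le> M * t powr ((\<kappa> - s) / 2)" for x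
        using pt[OF M f, of x] True M by (cases "x = 0") auto
      then have "esssup lebesgue (\<lambda>x. ennreal (norm (norm x powr k *\<^sub>R f x))) \<le> ennreal (M * t powr ((\<kappa> - s) / 2))"
        by (intro esssup_I measurable_completion) (measurable, auto intro!: ennreal_leI)
      then show ?thesis using True by (simp add: weighted_weak_Lp_norm_def weak_Lp_norm_def)
    qed
    then show ?thesis by (intro exI[of _ 1]) auto
  next
    case False
    then obtain P where P: "p = ennreal P" "0 \<le> P" by (cases p) auto
    then have P1: "1 \<le> P" using p by simp
    have inv: "enn2real (1 / p) = 1 / P"
      using P P1 by (simp add: divide_ennreal[of 1 P, simplified])
    define V where "V = measure lborel (ball (0::'a) 1)"
    have V: "0 \<le> V" by (simp add: V_def)
    have "weighted_weak_Lp_norm k p f \<le> ennreal (V powr (1 / P) * M * t powr ((\<kappa> - s) / 2))"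
      if M: "0 < M" "0 < t" and f: "\<And>x. norm (f x) \<le> M * parabolic_norm t x powr (- s)" for M t and f :: "'a \<Rightarrow> 'b"
    proof -
      let ?g = "\<lambda>x. norm x powr k *\<^sub>R f x"
      let ?K = "M * t powr ((\<kappa> - s) / 2)"
      have "ennreal (\<tau> powr (1 / P)) * rearrangement ?g \<tau> \<le> ennreal (V powr (1 / P) * M * t powr ((\<kappa> - s) / 2))"
        if \<tau>: "0 < \<tau>" for \<tau>
      proof -
        have "rearrangement ?g \<tau> \<le> ennreal (?K * (V / \<tau>) powr (1 / P))"
          unfolding V_def using M P1 \<tau> pt[OF M f] inv by (intro rearrangement_le_of_norm_powr) auto
        then have "ennreal (\<tau> powr (1 / P)) * rearrangement ?g \<tau> \<le> ennreal (\<tau> powr (1 / P)) * ennreal (?K * (V / \<tau>) powr (1 / P))"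
          by (intro mult_left_mono) auto
        also have "\<dots> = ennreal (\<tau> powr (1 / P) * (?K * (V / \<tau>) powr (1 / P)))"
          using M by (simp add: ennreal_mult)
        also have "\<tau> powr (1 / P) * (?K * (V / \<tau>) powr (1 / P)) = V powr (1 / P) * M * t powr ((\<kappa> - s) / 2)"
          using \<tau> V by (simp add: powr_divide)
        finally show ?thesis .
      qed
      then show ?thesis
        unfolding weighted_weak_Lp_norm_def weak_Lp_norm_def using False inv by (simp add: SUP_le_iff)
    qed
    then show ?thesis by (intro exI[of _ "V powr (1 / P)"]) auto
  qed
qed

lemma parabolic_bounded_mem_K_space:
  fixes u :: "real \<Rightarrow> 'a::euclidean_space \<Rightarrow> 'b::euclidean_space"
  assumes u: "parabolic_bounded s M u" and M: "0 < M" and s: "s = (2 + \<gamma>) / (\<alpha> - 1)" "0 \<le> s"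
    and p: "1 \<le> p" and \<kappa>: "0 \<le> k + real DIM('a) * enn2real (1 / p)" "k + real DIM('a) * enn2real (1 / p) \<le> s"
  shows "u \<in> K_space \<gamma> \<alpha> k p"
proof -
  let ?d = "real DIM('a)"
  let ?\<kappa> = "k + ?d * enn2real (1 / p)"
  have um: "(\<lambda>(t, x). u t x) \<in> borel_measurable (borel \<Otimes>\<^sub>M borel)"
    and ub: "\<And>t x. 0 < t \<Longrightarrow> norm (u t x) \<le> M * parabolic_norm t x powr (- s)"
    using u by (auto simp: parabolic_bounded_def)
  have um': "u t \<in> borel_measurable borel" for t using measurable_Pair2[OF um, of t] by simp
  have "(\<lambda>(t, x). u t x) absolutely_integrable_on C" if C: "compact C" "C \<subseteq> {0<..} \<times> UNIV" for C
  proof (cases "C = {}")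
    case False
    \<comment> \<open>A nonempty compact set in open time has a smallest time \<open>t0 > 0\<close>;
      from there on \<open>u\<close> is at most \<open>M * t0 powr (- s / 2)\<close>, hence
      integrable over the set.\<close>
    have "compact (fst ` C)" using C by (intro compact_continuous_image continuous_intros)
    then obtain t0 where t0: "t0 \<in> fst ` C" "\<And>t. t \<in> fst ` C \<Longrightarrow> t0 \<le> t"
      using compact_attains_inf[of "fst ` C"] False by blast
    have t0pos: "0 < t0" using t0(1) C by auto
    have bound: "norm (u t x) \<le> M * t0 powr (- s / 2)" if "(t, x) \<in> C" for t x
    proof -
      have t: "t0 \<le> t" using t0(2) that by force
      have "parabolic_norm t x powr (- s) \<le> t powr (- s / 2)"
        using t t0pos s(2) by (intro parabolic_norm_powr_le_sqrt) auto
      also have "\<dots> \<le> t0 powr (- s / 2)" using t t0pos s(2) by (intro powr_mono2') auto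
      finally show ?thesis using ub[of t x] t t0pos M by (meson less_le_trans mult_left_mono less_imp_le order_trans)
    qed
    have Cs: "C \<in> sets borel" using C by (simp add: borel_compact)
    have "(\<lambda>(t, x). u t x) \<in> borel_measurable borel" using um by (simp add: borel_prod)
    then have m: "(\<lambda>z. indicat_real C z *\<^sub>R (case z of (t, x) \<Rightarrow> u t x)) \<in> borel_measurable lborel"
      using Cs by (intro borel_measurable_scaleR borel_measurable_indicator) auto
    have "integrable lborel (\<lambda>z. indicat_real C z *\<^sub>R (case z of (t, x) \<Rightarrow> u t x))"
    proof (rule integrableI_bounded_set[where A=C and B="M * t0 powr (- s / 2)"])
      show "emeasure lborel C < \<infinity>" using C by (intro emeasure_compact_finite)
    qed (use Cs m bound in \<open>auto simp: indicator_def\<close>)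
    then show ?thesis unfolding set_integrable_def using m by (simp add: integrable_completion)
  qed (simp add: set_integrable_def)
  moreover have "u t \<in> borel_measurable lebesgue" for t using um' by (intro measurable_completion) simp
  moreover have "(SUP t\<in>{0<..<T}. ennreal (t powr (?d / 2 * (inv_qc DIM('a) \<gamma> \<alpha> - k / ?d - enn2real (1 / p))))
      * weighted_weak_Lp_norm k p (u t)) < \<infinity>" for T
  proof -
    obtain C where C: "C \<ge> 0" "\<And>M t f. M > 0 \<Longrightarrow> t > 0 \<Longrightarrow> f \<in> borel_measurable borel \<Longrightarrow>
      (\<And>x. norm (f x) \<le> M * parabolic_norm t x powr (- s)) \<Longrightarrow>
      weighted_weak_Lp_norm k p (f :: 'a \<Rightarrow> 'b) \<le> ennreal (C * M * t powr ((?\<kappa> - s) / 2))"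
      using weighted_weak_Lp_norm_bound[where 'a='a and 'b='b, OF p \<kappa>] by blast
    have "ennreal (t powr (?d / 2 * (inv_qc DIM('a) \<gamma> \<alpha> - k / ?d - enn2real (1 / p))))
      * weighted_weak_Lp_norm k p (u t) \<le> ennreal (C * M)" if t: "0 < t" for t
    proof -
      \<comment> \<open>The time weight of \<open>K_space\<close> is the exact inverse of the time
        factor in the norm bound; the product is constant, and the supremum is bounded independently
        of \<open>T\<close>.\<close>
      have "?d / 2 * (inv_qc DIM('a) \<gamma> \<alpha> - k / ?d - enn2real (1 / p)) = (s - ?\<kappa>) / 2"
      proof -
        have "?d * inv_qc DIM('a) \<gamma> \<alpha> = s" by (simp add: inv_qc_def s)
        then show ?thesis by (simp add: field_simps)
      qed
      moreover have "weighted_weak_Lp_norm k p (u t) \<le> ennreal (C * M * t powr ((?\<kappa> - s) / 2))"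
        using M t um' ub by (intro C(2)) auto
      ultimately have "ennreal (t powr (?d / 2 * (inv_qc DIM('a) \<gamma> \<alpha> - k / ?d - enn2real (1 / p)))) * weighted_weak_Lp_norm k p (u t)
        \<le> ennreal (t powr ((s - ?\<kappa>) / 2)) * ennreal (C * M * t powr ((?\<kappa> - s) / 2))"
        by (simp only:) (intro mult_left_mono, auto)
      also have "\<dots> = ennreal (C * M * (t powr ((s - ?\<kappa>) / 2) * t powr ((?\<kappa> - s) / 2)))"
        using C M by (simp add: ennreal_mult[symmetric] mult_ac)
      also have "t powr ((s - ?\<kappa>) / 2) * t powr ((?\<kappa> - s) / 2) = 1"
        using t unfolding powr_add[symmetric] by (simp add: field_simps)
      finally show ?thesis by simp
    qed
    then have "(SUP t\<in>{0<..<T}. ennreal (t powr (?d / 2 * (inv_qc DIM('a) \<gamma> \<alpha> - k / ?d - enn2real (1 / p))))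
      * weighted_weak_Lp_norm k p (u t)) \<le> ennreal (C * M)"
      by (intro SUP_least) auto
    then show ?thesis by (rule le_less_trans) simp
  qed
  ultimately show ?thesis by (simp add: K_space_def)
qed

section \<open>Tempered distributions and the initial data\<close>

lemma schwartz_borel_measurable:
  assumes "\<phi> \<in> schwartz"
  shows "\<phi> \<in> borel_measurable borel" and "isCont \<phi> x"
proof -
  have "iterated_partial [] \<phi> differentiable_on UNIV"
    using assms unfolding schwartz_def by (force simp del: iterated_partial_def)
  then have "\<phi> differentiable_on UNIV" by (simp add: iterated_partial_def)
  then have "continuous_on UNIV \<phi>" by (rule differentiable_imp_continuous_on)
  then show "\<phi> \<in> borel_measurable borel" "isCont \<phi> x"
    by (auto intro: borel_measurable_continuous_onI simp: continuous_on_eq_continuous_at)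
qed

text \<open>Taken from the empty list of derivatives; only the size of \<open>\<phi>\<close> enters
  the pairing estimates below.\<close>

lemma schwartz_seminorm_bound:
  assumes "\<phi> \<in> schwartz"
  shows "(1 + norm x) ^ N * norm (\<phi> x) \<le> enn2real (schwartz_seminorm N \<phi>)"
proof -
  have fin: "schwartz_seminorm N \<phi> < \<infinity>" using assms by (simp add: schwartz_def)
  have "ennreal ((1 + norm x) ^ N * norm (\<phi> x)) \<le> (SUP x. ennreal ((1 + norm x) ^ N * norm (iterated_partial [] \<phi> x)))"
    by (rule SUP_upper2[of x]) (simp_all add: iterated_partial_def)
  also have "\<dots> \<le> schwartz_seminorm N \<phi>"
    unfolding schwartz_seminorm_def by (rule SUP_upper2[of "[]"]) simp_all
  finally show ?thesis
    using fin by (metis enn2real_ennreal enn2real_mono ennreal_less_zero_iff infinity_ennreal_def mult_nonneg_nonneg norm_ge_zero zero_le_power add_nonneg_nonneg zero_le_one)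
qed

lemma schwartz_decay:
  assumes \<phi>: "\<phi> \<in> schwartz" and B: "0 \<le> B" "B \<le> real N"
  shows "norm (\<phi> x) \<le> enn2real (schwartz_seminorm N \<phi>)"
    and "x \<noteq> 0 \<Longrightarrow> norm (\<phi> x) \<le> enn2real (schwartz_seminorm N \<phi>) * norm x powr (- B)"
proof -
  let ?A = "enn2real (schwartz_seminorm N \<phi>)"
  have le: "(1 + norm x) ^ N * norm (\<phi> x) \<le> ?A" using \<phi> by (rule schwartz_seminorm_bound)
  have "1 * norm (\<phi> x) \<le> (1 + norm x) ^ N * norm (\<phi> x)"
    by (intro mult_right_mono one_le_power) auto
  then show "norm (\<phi> x) \<le> ?A" using le by simp
  show "norm (\<phi> x) \<le> ?A * norm x powr (- B)" if x: "x \<noteq> 0"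
  proof -
    have "norm x powr B \<le> (1 + norm x) powr B" using B by (intro powr_mono2) auto
    also have "\<dots> \<le> (1 + norm x) powr real N" using B by (intro powr_mono) auto
    also have "\<dots> = (1 + norm x) ^ N" by (intro powr_realpow) (simp add: add_pos_nonneg)
    finally have "norm x powr B * norm (\<phi> x) \<le> ?A"
      using le by (meson mult_right_mono norm_ge_zero order_trans)
    then have "norm x powr (- B) * (norm x powr B * norm (\<phi> x)) \<le> norm x powr (- B) * ?A"
      by (intro mult_left_mono) auto
    also have "norm x powr (- B) * (norm x powr B * norm (\<phi> x)) = norm (\<phi> x)"
      using x by (simp add: mult.assoc[symmetric] powr_add[symmetric])
    finally show ?thesis by (simp add: mult.commute)
  qed
qed

text \<open>The number \<open>n\<close> stands for the size of a test function at \<open>x\<close>,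
  or of its heat evolution, so that both share one majorant. At the origin both sides are 0.\<close>

lemma norm_powr_times_le_min:
  fixes n :: real
  assumes "0 \<le> A" "n \<le> A" "x \<noteq> 0 \<Longrightarrow> n \<le> A * norm x powr (- B)"
  shows "norm x powr (- s) * n \<le> A * min (norm x powr (- s)) (norm x powr (- (s + B)))"
proof (cases "x = 0")
  case False
  have "norm x powr (- s) * n \<le> norm x powr (- s) * A" using assms by (intro mult_left_mono) auto
  moreover have "norm x powr (- s) * n \<le> norm x powr (- s) * (A * norm x powr (- B))"
    using assms False by (intro mult_left_mono) auto
  moreover have "norm x powr (- s) * norm x powr (- B) = norm x powr (- (s + B))"
    unfolding powr_add[symmetric] by simp
  ultimately show ?thesis using assms(1) by (auto simp: min_def mult_ac)
qed simp

lemma AE_lebesgue_nonzero: "AE x in lebesgue. x \<noteq> (0::'a::euclidean_space)"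
  by (rule AE_completion) (rule AE_lborel_singleton)

lemma tempered_function_norm_powr:
  fixes f :: "'a::euclidean_space \<Rightarrow> 'b::{real_normed_field, euclidean_space}" and s :: real
  assumes s: "0 \<le> s" "s < DIM('a)" and K: "0 \<le> K"
    and [measurable]: "f \<in> borel_measurable lebesgue" and f: "AE x in lebesgue. norm (f x) \<le> K * norm x powr (- s)"
  shows "tempered_function f"
proof -
  \<comment> \<open>Decay of order \<open>d + 1\<close> makes the product with
    \<open>norm x powr (- s)\<close> integrable at infinity for every
    \<open>s \<ge> 0\<close>.\<close>
  let ?N = "Suc DIM('a)"
  define W where "W = (\<lambda>x::'a. min (norm x powr (- s)) (norm x powr (- (s + real ?N))))"
  have W: "integrable lebesgue W"
    using integrable_min_norm_powr[OF s, of "s + real ?N"] s unfolding W_def by (subst integrable_completion) auto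
  have W0: "0 \<le> W x" for x by (simp add: W_def)
  define A where "A \<phi> = enn2real (schwartz_seminorm ?N \<phi>)" for \<phi> :: "'a \<Rightarrow> 'b"
  have le: "AE x in lebesgue. norm (f x * \<phi> x) \<le> K * A \<phi> * W x" if \<phi>: "\<phi> \<in> schwartz" for \<phi>
    using f
  proof eventually_elim
    case (elim x)
    have 1: "norm x powr (- s) * norm (\<phi> x) \<le> A \<phi> * W x"
      unfolding W_def A_def using schwartz_decay[OF \<phi>, of "real ?N" ?N x]
      by (intro norm_powr_times_le_min) auto
    have "norm (f x * \<phi> x) \<le> K * norm x powr (- s) * norm (\<phi> x)"
      using elim by (simp add: norm_mult mult_right_mono)
    also have "\<dots> \<le> K * (A \<phi> * W x)" unfolding mult.assoc using K 1 by (intro mult_left_mono) auto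
    finally show ?case by (simp add: mult.assoc)
  qed
  have m: "(\<lambda>x. f x * \<phi> x) \<in> borel_measurable lebesgue" if "\<phi> \<in> schwartz" for \<phi>
  proof -
    have [measurable]: "\<phi> \<in> borel_measurable lebesgue"
      using schwartz_borel_measurable(1)[OF that] by (intro measurable_completion) simp
    show ?thesis by measurable
  qed
  have int: "integrable lebesgue (\<lambda>x. f x * \<phi> x)" if \<phi>: "\<phi> \<in> schwartz" for \<phi>
  proof (rule Bochner_Integration.integrable_bound)
    show "integrable lebesgue (\<lambda>x. K * A \<phi> * W x)" using W by simp
    show "AE x in lebesgue. norm (f x * \<phi> x) \<le> norm (K * A \<phi> * W x)"
      using le[OF \<phi>] by eventually_elim simp
  qed (rule m[OF \<phi>])
  have "tempered_distribution (distribution_of f)"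
    unfolding tempered_distribution_def
  proof (intro conjI ballI allI)
    fix \<phi> \<psi> :: "'a \<Rightarrow> 'b" assume \<phi>: "\<phi> \<in> schwartz" and \<psi>: "\<psi> \<in> schwartz"
    show "distribution_of f (\<lambda>x. \<phi> x + \<psi> x) = distribution_of f \<phi> + distribution_of f \<psi>"
      unfolding distribution_of_def distrib_left using int[OF \<phi>] int[OF \<psi>] by simp
  next
    fix c and \<phi> :: "'a \<Rightarrow> 'b"
    show "distribution_of f (\<lambda>x. c * \<phi> x) = c * distribution_of f \<phi>"
      unfolding distribution_of_def by (simp add: mult.left_commute[of _ c])
  next
    have "ennreal (norm (distribution_of f \<phi>)) \<le> ennreal (K * integral\<^sup>L lebesgue W) * schwartz_seminorm ?N \<phi>"
      if \<phi>: "\<phi> \<in> schwartz" for \<phi>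
    proof -
      have "norm (distribution_of f \<phi>) \<le> (\<integral>x. norm (f x * \<phi> x) \<partial>lebesgue)"
        unfolding distribution_of_def by (rule integral_norm_bound)
      also have "\<dots> \<le> (\<integral>x. K * A \<phi> * W x \<partial>lebesgue)"
        using W le[OF \<phi>] int[OF \<phi>] by (intro integral_mono_AE) auto
      also have "\<dots> = K * integral\<^sup>L lebesgue W * A \<phi>" by simp
      finally have "ennreal (norm (distribution_of f \<phi>)) \<le> ennreal (K * integral\<^sup>L lebesgue W) * ennreal (A \<phi>)"
        using K W0 by (subst ennreal_mult[symmetric]) (auto simp: A_def intro!: ennreal_leI)
      also have "ennreal (A \<phi>) = schwartz_seminorm ?N \<phi>"
        using \<phi> unfolding A_def schwartz_def by (intro ennreal_enn2real) (auto simp: less_top)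
      finally show ?thesis .
    qed
    then show "\<exists>C N. \<forall>\<phi>\<in>schwartz. ennreal (norm (distribution_of f \<phi>)) \<le> ennreal C * schwartz_seminorm N \<phi>"
      by blast
  qed
  with int show ?thesis by (simp add: tempered_function_def)
qed

section \<open>The heat semigroup acting on test functions\<close>

lemma heat_eq_integral_dilation:
  fixes \<phi> :: "'a::euclidean_space \<Rightarrow> 'b::euclidean_space"
  assumes [measurable]: "\<phi> \<in> borel_measurable borel" and t: "0 < t"
  shows "heat t \<phi> y = (\<integral>z. heat_kernel 1 z *\<^sub>R \<phi> (y + sqrt t *\<^sub>R z) \<partial>lborel)"
proof -
  have "heat t \<phi> y = (\<integral>w. heat_kernel t (y - w) *\<^sub>R \<phi> w \<partial>lborel)" by (rule heat_eq_lborel) measurable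
  also have "\<dots> = (\<bar>sqrt t\<bar> ^ DIM('a)) *\<^sub>R (\<integral>z. heat_kernel t (y - (y + sqrt t *\<^sub>R z)) *\<^sub>R \<phi> (y + sqrt t *\<^sub>R z) \<partial>lborel)"
    using t by (intro integral_lborel_affine) auto
  also have "\<dots> = (\<integral>z. (sqrt t ^ DIM('a)) *\<^sub>R (heat_kernel t (y - (y + sqrt t *\<^sub>R z)) *\<^sub>R \<phi> (y + sqrt t *\<^sub>R z)) \<partial>lborel)"
    using t by (subst integral_scaleR_right) simp
  also have "\<dots> = (\<integral>z. heat_kernel 1 z *\<^sub>R \<phi> (y + sqrt t *\<^sub>R z) \<partial>lborel)"
  proof (intro Bochner_Integration.integral_cong refl)
    fix z :: 'a
    have "heat_kernel t (y - (y + sqrt t *\<^sub>R z)) = heat_kernel 1 z / sqrt t ^ DIM('a)"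
      using heat_kernel_scaleR[of "sqrt t" 1 z] t by (simp add: heat_kernel_minus)
    then show "(sqrt t ^ DIM('a)) *\<^sub>R (heat_kernel t (y - (y + sqrt t *\<^sub>R z)) *\<^sub>R \<phi> (y + sqrt t *\<^sub>R z))
      = heat_kernel 1 z *\<^sub>R \<phi> (y + sqrt t *\<^sub>R z)"
      using t by simp
  qed
  finally show ?thesis .
qed

lemma heat_tendsto_at_0:
  fixes \<phi> :: "'a::euclidean_space \<Rightarrow> 'b::euclidean_space"
  assumes [measurable]: "\<phi> \<in> borel_measurable borel" and cont: "isCont \<phi> y"
    and A: "\<And>x. norm (\<phi> x) \<le> A" and X: "\<And>i. 0 < X i" "X \<longlonglongrightarrow> 0"
  shows "(\<lambda>i. heat (X i) \<phi> y) \<longlonglongrightarrow> \<phi> y"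
proof -
  have hk: "integrable lborel (\<lambda>z::'a. heat_kernel 1 z)" "(\<integral>z. heat_kernel 1 (z::'a) \<partial>lborel) = 1"
    using integrable_heat_kernel[of 1 "0::'a"] integral_heat_kernel[of 1 "0::'a"] by (simp_all add: heat_kernel_minus)
  \<comment> \<open>After the dilation the Gaussian no longer depends on time, so one multiple of it
    dominates the whole sequence.\<close>
  have "(\<lambda>i. \<integral>z. heat_kernel 1 z *\<^sub>R \<phi> (y + sqrt (X i) *\<^sub>R z) \<partial>lborel) \<longlonglongrightarrow> (\<integral>z. heat_kernel 1 (z::'a) *\<^sub>R \<phi> y \<partial>lborel)"
  proof (rule integral_dominated_convergence[where w="\<lambda>z::'a. heat_kernel 1 z * A"])
    show "integrable lborel (\<lambda>z::'a. heat_kernel 1 z * A)" using hk by simp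
    show "AE z in lborel. (\<lambda>i. heat_kernel 1 z *\<^sub>R \<phi> (y + sqrt (X i) *\<^sub>R z)) \<longlonglongrightarrow> heat_kernel 1 z *\<^sub>R \<phi> y"
    proof (intro AE_I2)
      fix z :: 'a
      have "(\<lambda>i. y + sqrt (X i) *\<^sub>R z) \<longlonglongrightarrow> y + sqrt 0 *\<^sub>R z" by (intro tendsto_intros X)
      then have "(\<lambda>i. y + sqrt (X i) *\<^sub>R z) \<longlonglongrightarrow> y" by simp
      then show "(\<lambda>i. heat_kernel 1 z *\<^sub>R \<phi> (y + sqrt (X i) *\<^sub>R z)) \<longlonglongrightarrow> heat_kernel 1 z *\<^sub>R \<phi> y"
        by (intro tendsto_scaleR tendsto_const isCont_tendsto_compose[OF cont])
    qed
    show "AE z in lborel. norm (heat_kernel 1 z *\<^sub>R \<phi> (y + sqrt (X i) *\<^sub>R z)) \<le> heat_kernel 1 z * A" for i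
      using A by (intro AE_I2) (simp add: mult_left_mono)
  qed measurable
  also have "(\<integral>z. heat_kernel 1 (z::'a) *\<^sub>R \<phi> y \<partial>lborel) = \<phi> y" using hk by simp
  finally show ?thesis using X(1) by (simp add: heat_eq_integral_dilation)
qed

text \<open>Decay of order \<open>B < d\<close> survives the heat flow with a constant independent
  of \<open>t\<close>. Two heat bounds are combined: exponent \<open>B\<close> gives the decay at
  infinity, exponent 0 the boundedness near the origin.\<close>

lemma norm_powr_heat_bound:
  fixes s B :: real
  assumes B: "0 \<le> B" "B < DIM('a)"
  shows "\<exists>C\<ge>0. \<forall>A\<ge>0. \<forall>\<phi>::'a::euclidean_space \<Rightarrow> 'b::euclidean_space. \<phi> \<in> borel_measurable borel \<longrightarrow>
    (\<forall>x. norm (\<phi> x) \<le> A) \<longrightarrow> (\<forall>x. x \<noteq> 0 \<longrightarrow> norm (\<phi> x) \<le> A * norm x powr (- B)) \<longrightarrow>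
    (\<forall>t>0. \<forall>y. heat_defined t \<phi> y \<and>
       norm y powr (- s) * norm (heat t \<phi> y) \<le> C * A * min (norm y powr (- s)) (norm y powr (- (s + B))))"
proof -
  obtain C1 where C1: "C1 > 0" "\<And>K \<Phi> t x. K \<ge> 0 \<Longrightarrow> \<Phi> \<in> borel_measurable lebesgue \<Longrightarrow>
     (AE y in lebesgue. norm (\<Phi> y) \<le> K * norm y powr (- B)) \<Longrightarrow> t > 0 \<Longrightarrow>
     heat_defined t (\<Phi> :: 'a \<Rightarrow> 'b) x \<and> norm (heat t \<Phi> x) \<le> C1 * K * parabolic_norm t x powr (- B)"
    using heat_norm_powr_bound[OF B, where 'b='b] by blast
  obtain C2 where C2: "C2 > 0" "\<And>K \<Phi> t x. K \<ge> 0 \<Longrightarrow> \<Phi> \<in> borel_measurable lebesgue \<Longrightarrow>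
     (AE y in lebesgue. norm (\<Phi> y) \<le> K * norm y powr (- 0)) \<Longrightarrow> t > 0 \<Longrightarrow>
     heat_defined t (\<Phi> :: 'a \<Rightarrow> 'b) x \<and> norm (heat t \<Phi> x) \<le> C2 * K * parabolic_norm t x powr (- 0)"
    using heat_norm_powr_bound[of 0, where 'a='a and 'b='b] by auto
  define C where "C = max C1 C2"
  have "heat_defined t \<phi> y \<and> norm y powr (- s) * norm (heat t \<phi> y) \<le> C * A * min (norm y powr (- s)) (norm y powr (- (s + B)))"
    if A: "0 \<le> A" and \<phi>: "\<phi> \<in> borel_measurable borel" "\<And>x. norm (\<phi> x) \<le> A"
      "\<And>x. x \<noteq> 0 \<Longrightarrow> norm (\<phi> x) \<le> A * norm x powr (- B)" and t: "0 < t" for A t y and \<phi> :: "'a \<Rightarrow> 'b"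
  proof -
    have m: "\<phi> \<in> borel_measurable lebesgue" using \<phi>(1) by (intro measurable_completion) simp
    have "AE x in lebesgue. norm (\<phi> x) \<le> A * norm x powr (- B)"
      using AE_lebesgue_nonzero[where 'a='a] by eventually_elim (rule \<phi>(3))
    from C1(2)[OF A m this t, of y]
    have 1: "heat_defined t \<phi> y" "norm (heat t \<phi> y) \<le> C1 * A * parabolic_norm t y powr (- B)" by auto
    have "AE x in lebesgue. norm (\<phi> x) \<le> A * norm x powr (- 0)"
      using AE_lebesgue_nonzero[where 'a='a] by eventually_elim (simp add: \<phi>(2))
    from C2(2)[OF A m this t, of y] have 2: "norm (heat t \<phi> y) \<le> C2 * A"
      using parabolic_norm_pos[OF t, of y] by simp
    have "norm y powr (- s) * norm (heat t \<phi> y) \<le> (C * A) * min (norm y powr (- s)) (norm y powr (- (s + B)))"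
    proof (rule norm_powr_times_le_min)
      show "0 \<le> C * A" using C1(1) A by (simp add: C_def)
      have "C2 * A \<le> C * A" using A by (intro mult_right_mono) (auto simp: C_def)
      then show "norm (heat t \<phi> y) \<le> C * A" using 2 by linarith
      assume y: "y \<noteq> 0"
      have "C1 * A * parabolic_norm t y powr (- B) \<le> C * A * norm y powr (- B)"
        using C1(1) A B y by (intro mult_mono parabolic_norm_powr_le_norm) (auto simp: C_def)
      then show "norm (heat t \<phi> y) \<le> C * A * norm y powr (- B)" using 1(2) by linarith
    qed
    with 1(1) show ?thesis by simp
  qed
  moreover have "0 \<le> C" using C1(1) by (simp add: C_def)
  ultimately show ?thesis by blast
qed

text \<open>Fubini and the symmetry of the kernel leave the rough factor fixed in time. The majorant
  \<open>w\<close> is chosen before \<open>t\<close>, ready for dominated convergence.\<close>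

lemma schwartz_heat_pairing:
  fixes \<Phi> \<phi> :: "'a::euclidean_space \<Rightarrow> 'b::{real_normed_field, euclidean_space}" and s :: real
  assumes s: "0 < s" "s < DIM('a)" and K: "0 \<le> K" and \<Phi>m[measurable]: "\<Phi> \<in> borel_measurable borel"
    and \<Phi>: "AE x in lborel. norm (\<Phi> x) \<le> K * norm x powr (- s)" and \<phi>: "\<phi> \<in> schwartz"
  shows "\<exists>w. integrable lborel w \<and> (\<forall>t>0. (AE y in lborel. norm (\<Phi> y * heat t \<phi> y) \<le> w y) \<and>
     distribution_of (heat t \<Phi>) \<phi> = (\<integral>y. \<Phi> y * heat t \<phi> y \<partial>lborel))"
proof -
  have \<phi>m[measurable]: "\<phi> \<in> borel_measurable borel" using schwartz_borel_measurable(1)[OF \<phi>] .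
  let ?A = "enn2real (schwartz_seminorm DIM('a) \<phi>)"
  \<comment> \<open>Any \<open>B\<close> in \<open>(d - s, d)\<close>: above \<open>d - s\<close>
    the product with \<open>norm y powr (- s)\<close> is integrable at infinity, below
    \<open>d\<close> the heat flow preserves the decay.\<close>
  have "max 0 (real DIM('a) - s) < real DIM('a)" using s by simp
  then obtain B where "max 0 (real DIM('a) - s) < B" "B < real DIM('a)" using dense by blast
  then have B: "0 \<le> B" "B < DIM('a)" "DIM('a) < s + B" by auto
  have \<phi>b: "norm (\<phi> x) \<le> ?A" "x \<noteq> 0 \<Longrightarrow> norm (\<phi> x) \<le> ?A * norm x powr (- B)" for x
    using schwartz_decay[OF \<phi>, of B "DIM('a)" x] B by auto
  obtain C where C: "C \<ge> 0" "\<And>t y. t > 0 \<Longrightarrow> heat_defined t \<phi> y \<and>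
       norm y powr (- s) * norm (heat t \<phi> y) \<le> C * ?A * min (norm y powr (- s)) (norm y powr (- (s + B)))"
    using norm_powr_heat_bound[OF B(1,2), where 'b='b and s=s] \<phi>b \<phi>m by (metis enn2real_nonneg)
  \<comment> \<open>Fubini needs the absolute integral, hence the heat evolution of
    \<open>norm (\<phi> x)\<close>, which a bound on \<open>heat t \<phi>\<close> does not control;
    the estimate is used a second time, for a real valued function.\<close>
  have nm: "(\<lambda>x. norm (\<phi> x)) \<in> borel_measurable borel" by measurable
  obtain C' where C'_all: "\<And>A \<psi> t y. A \<ge> 0 \<Longrightarrow> \<psi> \<in> borel_measurable borel \<Longrightarrow> (\<forall>x. norm (\<psi> x) \<le> A) \<Longrightarrow>
      (\<forall>x. x \<noteq> 0 \<longrightarrow> norm (\<psi> x) \<le> A * norm x powr (- B)) \<Longrightarrow> t > 0 \<Longrightarrow> heat_defined t (\<psi> :: 'a \<Rightarrow> real) y \<and>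
       norm y powr (- s) * norm (heat t \<psi> y) \<le> C' * A * min (norm y powr (- s)) (norm y powr (- (s + B)))"
    using norm_powr_heat_bound[OF B(1,2), where 'b=real and s=s] by blast
  have C': "norm y powr (- s) * norm (heat t (\<lambda>x. norm (\<phi> x)) y) \<le> C' * ?A * min (norm y powr (- s)) (norm y powr (- (s + B)))"
    if "t > 0" for t y
    using C'_all[OF enn2real_nonneg nm _ _ that, of "schwartz_seminorm DIM('a) \<phi>" y] \<phi>b by simp
  define W where "W = (\<lambda>y::'a. min (norm y powr (- s)) (norm y powr (- (s + B))))"
  have W: "integrable lborel W" unfolding W_def using s B by (intro integrable_min_norm_powr) auto
  have bound: "norm (\<Phi> y) * h \<le> K * (c * ?A) * W y"
    if "norm (\<Phi> y) \<le> K * norm y powr (- s)" "0 \<le> h" "norm y powr (- s) * h \<le> c * ?A * W y" for y h c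
  proof -
    have "norm (\<Phi> y) * h \<le> K * (norm y powr (- s) * h)"
      using that(1,2) by (simp add: mult.assoc[symmetric] mult_right_mono)
    also have "\<dots> \<le> K * (c * ?A * W y)" using that(3) K by (intro mult_left_mono)
    finally show ?thesis by (simp add: mult.assoc)
  qed
  have "(AE y in lborel. norm (\<Phi> y * heat t \<phi> y) \<le> K * (C * ?A) * W y) \<and>
     distribution_of (heat t \<Phi>) \<phi> = (\<integral>y. \<Phi> y * heat t \<phi> y \<partial>lborel)" if t: "0 < t" for t
  proof
    show "AE y in lborel. norm (\<Phi> y * heat t \<phi> y) \<le> K * (C * ?A) * W y"
      using \<Phi>
    proof eventually_elim
      case (elim y)
      show ?case unfolding norm_mult using elim C(2)[OF t, of y] by (intro bound) (auto simp: W_def)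
    qed
    have [measurable]: "(\<lambda>x. heat t \<Phi> x) \<in> borel_measurable borel"
      by (rule borel_measurable_heat) measurable
    let ?f = "\<lambda>(y, x). heat_kernel t (x - y) *\<^sub>R (\<Phi> y * \<phi> x)"
    have int: "integrable (lborel \<Otimes>\<^sub>M lborel) ?f"
    proof (rule lborel_pair.Fubini_integrable)
      show "?f \<in> borel_measurable (lborel \<Otimes>\<^sub>M lborel)" by measurable
      have inner: "(\<integral>x. norm (?f (y, x)) \<partial>lborel) = norm (\<Phi> y) * heat t (\<lambda>x. norm (\<phi> x)) y" for y
        by (simp add: heat_eq_lborel[OF nm] norm_mult heat_kernel_commute[of t y] mult.left_commute)
      show "integrable lborel (\<lambda>y. \<integral>x. norm (?f (y, x)) \<partial>lborel)"
        unfolding inner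
      proof (rule Bochner_Integration.integrable_bound)
        show "integrable lborel (\<lambda>y. K * (C' * ?A) * W y)" using W by simp
        show "(\<lambda>y. norm (\<Phi> y) * heat t (\<lambda>x. norm (\<phi> x)) y) \<in> borel_measurable lborel"
          by measurable
        show "AE y in lborel. norm (norm (\<Phi> y) * heat t (\<lambda>x. norm (\<phi> x)) y) \<le> norm (K * (C' * ?A) * W y)"
          using \<Phi>
        proof eventually_elim
          case (elim y)
          have "norm (\<Phi> y) * norm (heat t (\<lambda>x. norm (\<phi> x)) y) \<le> K * (C' * ?A) * W y"
            using elim C'[OF t, of y] by (intro bound) (auto simp: W_def)
          then have "norm (norm (\<Phi> y) * heat t (\<lambda>x. norm (\<phi> x)) y) \<le> K * (C' * ?A) * W y"
            by (simp add: abs_mult)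
          then show ?case unfolding real_norm_def by (rule order_trans[OF _ abs_ge_self])
        qed
      qed
      show "AE y in lborel. integrable lborel (\<lambda>x. ?f (y, x))"
      proof (intro AE_I2)
        fix y :: 'a
        have "integrable lborel (\<lambda>x. heat_kernel t (y - x) *\<^sub>R \<phi> x)"
          using C(2)[OF t, of y] heat_defined_iff_lborel[OF \<phi>m] by blast
        then have "integrable lborel (\<lambda>x. \<Phi> y * (heat_kernel t (y - x) *\<^sub>R \<phi> x))" by (rule integrable_mult_right)
        then show "integrable lborel (\<lambda>x. ?f (y, x))" by (simp add: heat_kernel_commute[of t y])
      qed
    qed
    have "distribution_of (heat t \<Phi>) \<phi> = (\<integral>x. heat t \<Phi> x * \<phi> x \<partial>lborel)"
      unfolding distribution_of_def by (rule integral_completion) measurable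
    also have "\<dots> = (\<integral>x. (\<integral>y. ?f (y, x) \<partial>lborel) \<partial>lborel)"
    proof (intro Bochner_Integration.integral_cong refl)
      fix x :: 'a
      have "heat t \<Phi> x * \<phi> x = (\<integral>y. (heat_kernel t (x - y) *\<^sub>R \<Phi> y) * \<phi> x \<partial>lborel)"
        by (subst integral_mult_left_zero) (simp add: heat_eq_lborel)
      then show "heat t \<Phi> x * \<phi> x = (\<integral>y. ?f (y, x) \<partial>lborel)" by simp
    qed
    also have "\<dots> = (\<integral>y. (\<integral>x. ?f (y, x) \<partial>lborel) \<partial>lborel)"
      using lborel_pair.Fubini_integral[OF int] by simp
    also have "\<dots> = (\<integral>y. \<Phi> y * heat t \<phi> y \<partial>lborel)"
    proof (intro Bochner_Integration.integral_cong refl)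
      fix y :: 'a
      have "\<Phi> y * heat t \<phi> y = (\<integral>x. \<Phi> y * (heat_kernel t (y - x) *\<^sub>R \<phi> x) \<partial>lborel)"
        by (subst integral_mult_right_zero) (simp add: heat_eq_lborel)
      then show "(\<integral>x. ?f (y, x) \<partial>lborel) = \<Phi> y * heat t \<phi> y" by (simp add: heat_kernel_commute[of t y])
    qed
    finally show "distribution_of (heat t \<Phi>) \<phi> = (\<integral>y. \<Phi> y * heat t \<phi> y \<partial>lborel)" .
  qed
  then show ?thesis using W by (intro exI[of _ "\<lambda>y. K * (C * ?A) * W y"]) auto
qed

lemma distribution_of_heat_tendsto:
  fixes \<Phi> \<phi> :: "'a::euclidean_space \<Rightarrow> 'b::{real_normed_field, euclidean_space}" and s :: real
  assumes s: "0 < s" "s < DIM('a)" and K: "0 \<le> K" and \<Phi>m[measurable]: "\<Phi> \<in> borel_measurable borel"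
    and \<Phi>: "AE x in lborel. norm (\<Phi> x) \<le> K * norm x powr (- s)" and \<phi>: "\<phi> \<in> schwartz"
    and X: "\<And>i. 0 < X i" "X \<longlonglongrightarrow> 0"
  shows "(\<lambda>i. distribution_of (heat (X i) \<Phi>) \<phi>) \<longlonglongrightarrow> distribution_of \<Phi> \<phi>"
proof -
  have \<phi>m[measurable]: "\<phi> \<in> borel_measurable borel" using schwartz_borel_measurable(1)[OF \<phi>] .
  obtain w where w: "integrable lborel w" "\<And>t. 0 < t \<Longrightarrow> AE y in lborel. norm (\<Phi> y * heat t \<phi> y) \<le> w y"
     "\<And>t. 0 < t \<Longrightarrow> distribution_of (heat t \<Phi>) \<phi> = (\<integral>y. \<Phi> y * heat t \<phi> y \<partial>lborel)"
    using schwartz_heat_pairing[OF s K \<Phi>m \<Phi> \<phi>] by blast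
  have "(\<lambda>i. \<integral>y. \<Phi> y * heat (X i) \<phi> y \<partial>lborel) \<longlonglongrightarrow> (\<integral>y. \<Phi> y * \<phi> y \<partial>lborel)"
  proof (rule integral_dominated_convergence[where w=w])
    show "AE y in lborel. (\<lambda>i. \<Phi> y * heat (X i) \<phi> y) \<longlonglongrightarrow> \<Phi> y * \<phi> y"
      using schwartz_borel_measurable(2)[OF \<phi>] schwartz_decay(1)[OF \<phi>, of 0 0] X
      by (intro AE_I2 tendsto_mult tendsto_const heat_tendsto_at_0[where A="enn2real (schwartz_seminorm 0 \<phi>)"] \<phi>m) auto
  qed (use w X in measurable)
  moreover have "distribution_of \<Phi> \<phi> = (\<integral>y. \<Phi> y * \<phi> y \<partial>lborel)"
    unfolding distribution_of_def by (rule integral_completion) measurable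
  ultimately show ?thesis using w(3) X(1) by simp
qed

text \<open>Dominated convergence is applied along sequences of times.\<close>

lemma tendsto_at_right_0_sequentially:
  fixes f :: "real \<Rightarrow> 'b::first_countable_topology"
  assumes "\<And>X. (\<And>i::nat. 0 < X i) \<Longrightarrow> X \<longlonglongrightarrow> 0 \<Longrightarrow> (\<lambda>i. f (X i)) \<longlonglongrightarrow> l"
  shows "(f \<longlongrightarrow> l) (at_right 0)"
  unfolding tendsto_at_iff_sequentially comp_def using assms by auto

lemma distribution_of_duhamel_tendsto:
  fixes F :: "real \<Rightarrow> 'a::euclidean_space \<Rightarrow> 'b::{real_normed_field, euclidean_space}"
  assumes F: "hardy_dominated \<gamma> s K F" and s: "0 < s" "s < DIM('a)" and C: "0 \<le> C" and B: "s < B"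
    and near: "\<And>t x. 0 < t \<Longrightarrow> hardy_potential \<gamma> s t (x::'a) \<le> ennreal (C * parabolic_norm t x powr (- s))"
    and far: "\<And>t x. 0 < t \<Longrightarrow> x \<noteq> 0 \<Longrightarrow> hardy_potential \<gamma> s t (x::'a) \<le> ennreal (C * (norm x powr (- B) * t powr ((B - s) / 2)))"
    and \<phi>: "\<phi> \<in> schwartz" and X: "\<And>i. 0 < X i" "X \<longlonglongrightarrow> 0"
  shows "(\<lambda>i. distribution_of (duhamel (X i) F) \<phi>) \<longlonglongrightarrow> 0"
proof -
  let ?N = "Suc DIM('a)"
  let ?A = "enn2real (schwartz_seminorm ?N \<phi>)"
  define W where "W = (\<lambda>x::'a. min (norm x powr (- s)) (norm x powr (- (s + real ?N))))"
  have W: "integrable lebesgue W"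
    using integrable_min_norm_powr[of s, where 'a='a and E="s + real ?N"] s unfolding W_def by (subst integrable_completion) auto
  have K: "0 \<le> K" using F by (rule hardy_dominatedD)
  have [measurable]: "\<phi> \<in> borel_measurable lebesgue"
    using schwartz_borel_measurable(1)[OF \<phi>] by (intro measurable_completion) simp
  have [measurable]: "duhamel t F \<in> borel_measurable lebesgue" for t
    using measurable_Pair2[OF borel_measurable_duhamel[OF hardy_dominatedD(2)[OF F]], of t]
    by (intro measurable_completion) simp
  have "(\<lambda>i. \<integral>x. duhamel (X i) F x * \<phi> x \<partial>lebesgue) \<longlonglongrightarrow> (\<integral>x. 0 \<partial>(lebesgue :: 'a measure))"
  proof (rule integral_dominated_convergence[where w="\<lambda>x. K * C * ?A * W x"])
    show "integrable lebesgue (\<lambda>x. K * C * ?A * W x)" using W by simp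
    show "AE x in lebesgue. norm (duhamel (X i) F x * \<phi> x) \<le> K * C * ?A * W x" for i
      using AE_lebesgue_nonzero[where 'a='a]
    proof eventually_elim
      case (elim x)
      have "norm (duhamel (X i) F x) \<le> K * (C * parabolic_norm (X i) x powr (- s))"
        using C by (intro hardy_dominated_duhamel(2)[OF F near[OF X(1)]]) simp
      also have "\<dots> \<le> K * (C * norm x powr (- s))"
        using K C elim s by (intro mult_left_mono parabolic_norm_powr_le_norm) auto
      finally have "norm (duhamel (X i) F x * \<phi> x) \<le> K * (C * norm x powr (- s)) * norm (\<phi> x)"
        unfolding norm_mult by (intro mult_right_mono) auto
      also have "\<dots> = K * C * (norm x powr (- s) * norm (\<phi> x))" by simp
      also have "\<dots> \<le> K * C * (?A * W x)"
        using K C schwartz_decay[OF \<phi>, of "real ?N" ?N x] unfolding W_def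
        by (intro mult_left_mono norm_powr_times_le_min) auto
      finally show ?case by simp
    qed
    show "AE x in lebesgue. (\<lambda>i. duhamel (X i) F x * \<phi> x) \<longlonglongrightarrow> 0"
      using AE_lebesgue_nonzero[where 'a='a]
    proof eventually_elim
      case (elim x)
      have "(\<lambda>i. duhamel (X i) F x) \<longlonglongrightarrow> 0"
      proof (rule Lim_null_comparison)
        show "\<forall>\<^sub>F i in sequentially. norm (duhamel (X i) F x) \<le> K * (C * (norm x powr (- B) * X i powr ((B - s) / 2)))"
          using C by (intro always_eventually allI hardy_dominated_duhamel(2)[OF F far[OF X(1) elim]]) simp
        \<comment> \<open>Here \<open>s < B\<close> enters: the exponent is positive.\<close>
        have "(\<lambda>i. X i powr ((B - s) / 2)) \<longlonglongrightarrow> 0 powr ((B - s) / 2)"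
          using X B by (intro tendsto_powr2 tendsto_const X) (auto simp: less_imp_le)
        then have "(\<lambda>i. X i powr ((B - s) / 2)) \<longlonglongrightarrow> 0" by simp
        then show "(\<lambda>i. K * (C * (norm x powr (- B) * X i powr ((B - s) / 2)))) \<longlonglongrightarrow> 0"
          by (intro tendsto_mult_right_zero)
      qed
      then show ?case by (rule tendsto_mult_left_zero)
    qed
  qed measurable
  then show ?thesis by (simp add: distribution_of_def)
qed

section \<open>Choice of the constants, construction and verification\<close>

theorem theorem1p7:
  fixes a \<gamma> \<alpha> l k :: real and q p :: ennreal
  defines "d \<equiv> real DIM('a::euclidean_space)"
  assumes "a \<in> {-1, 1}"
    and "\<gamma> > - min 2 d"
    and "\<alpha> > 1 + (2 + \<gamma>) / d"
    and "1 \<le> q"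
    and "l / d + enn2real (1 / q) = inv_qc DIM('a) \<gamma> \<alpha>"
    and "\<gamma> / (\<alpha> - 1) \<le> l"
    and "1 \<le> p"
    and "ennreal \<alpha> < p"
    and "(l + \<gamma>) / \<alpha> \<le> k" and "k \<le> l"
    and "0 \<le> k / d + enn2real (1 / p)"
    and "(2 + \<gamma> * \<alpha>) / (d * \<alpha> * (\<alpha> - 1)) < k / d + enn2real (1 / p)"
    and "k / d + enn2real (1 / p) < min (inv_qc DIM('a) \<gamma> \<alpha>) ((d + \<gamma>) / (d * \<alpha>))"
  shows "\<exists>\<delta>>0. \<forall>\<omega> :: 'a \<Rightarrow> 'b::{real_normed_field, euclidean_space}.
           \<omega> \<in> borel_measurable lebesgue \<longrightarrow> homogeneous_deg0 \<omega> \<longrightarrow>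
           esssup lebesgue (\<lambda>x. ennreal (norm (\<omega> x))) \<le> ennreal \<delta> \<longrightarrow>
           (let \<Phi> = (\<lambda>x. (norm x powr (- (2 + \<gamma>) / (\<alpha> - 1))) *\<^sub>R \<omega> x) in
            \<exists>u. u \<in> K_space \<gamma> \<alpha> k p \<and>
                hardy_henon_solution a \<gamma> \<alpha> \<Phi> u \<and>
                self_similar \<gamma> \<alpha> u \<and>
                tends_in_tempered_at_0 u \<Phi>)"
proof -
  have d: "0 < d" by (simp add: d_def)
  have \<gamma>: "- 2 < \<gamma>" "- real DIM('a) < \<gamma>" using assms(3) by (auto simp: d_def)
  have "0 < (2 + \<gamma>) / d" using \<gamma> d by simp
  then have \<alpha>: "1 < \<alpha>" using assms(4) by linarith
  define s where "s = (2 + \<gamma>) / (\<alpha> - 1)"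
  have s\<alpha>: "s * (\<alpha> - 1) = 2 + \<gamma>" using \<alpha> by (simp add: s_def)
  have "2 + \<gamma> < (\<alpha> - 1) * d" using assms(4) d by (simp add: field_simps)
  then have s: "0 < s" "s < DIM('a)" using \<alpha> \<gamma> by (auto simp: s_def d_def divide_less_eq mult.commute)
  \<comment> \<open>Multiplication by \<open>d\<close> turns the bounds on
    \<open>k / d + 1 / p\<close> into bounds on the exponent of the weak norm estimate, since
    \<open>d * inv_qc DIM('a) \<gamma> \<alpha> = s\<close>.\<close>
  have \<kappa>: "0 \<le> k + real DIM('a) * enn2real (1 / p)" "k + real DIM('a) * enn2real (1 / p) \<le> s"
  proof -
    have e: "d * (k / d + enn2real (1 / p)) = k + real DIM('a) * enn2real (1 / p)"
      using d by (simp add: distrib_left d_def)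
    have "0 \<le> d * (k / d + enn2real (1 / p))" using d assms(12) by simp
    then show "0 \<le> k + real DIM('a) * enn2real (1 / p)" unfolding e .
    have "d * (k / d + enn2real (1 / p)) \<le> d * inv_qc DIM('a) \<gamma> \<alpha>"
      using d assms(14) by (intro mult_left_mono) auto
    also have "\<dots> = s" using d by (simp add: inv_qc_def s_def d_def)
    finally show "k + real DIM('a) * enn2real (1 / p) \<le> s" unfolding e .
  qed
  have a: "\<bar>a\<bar> \<le> 1" using assms(2) by auto
  obtain C0 where C0: "C0 > 0" "\<And>K \<Phi> t x. K \<ge> 0 \<Longrightarrow> \<Phi> \<in> borel_measurable lebesgue \<Longrightarrow>
     (AE y in lebesgue. norm (\<Phi> y) \<le> K * norm y powr (- s)) \<Longrightarrow> t > 0 \<Longrightarrow>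
     heat_defined t (\<Phi> :: 'a \<Rightarrow> 'b) x \<and> norm (heat t \<Phi> x) \<le> C0 * K * parabolic_norm t x powr (- s)"
    using heat_norm_powr_bound[of s, where 'a='a and 'b='b] s by auto
  obtain C1 B where C1: "C1 > 0" and B: "B > s"
    and near: "\<And>t x. 0 < t \<Longrightarrow> hardy_potential \<gamma> s t (x::'a) \<le> ennreal (C1 * parabolic_norm t x powr (- s))"
    and far: "\<And>t x. 0 < t \<Longrightarrow> x \<noteq> 0 \<Longrightarrow> hardy_potential \<gamma> s t (x::'a) \<le> ennreal (C1 * (norm x powr (- B) * t powr ((B - s) / 2)))"
    using nn_integral_hardy_duhamel_le[OF \<gamma> s] unfolding hardy_potential_def[symmetric] by blast
  \<comment> \<open>\<open>M\<close> solves
    \<open>(1 + \<alpha>) * M powr (\<alpha> - 1) * C1 = 1 / 2\<close>.\<close>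
  define M where "M = (1 / (2 * (1 + \<alpha>) * C1)) powr (1 / (\<alpha> - 1))"
  have M: "0 < M" using C1 \<alpha> by (simp add: M_def)
  have "M powr (\<alpha> - 1) = 1 / (2 * (1 + \<alpha>) * C1)" using C1 \<alpha> by (simp add: M_def powr_powr)
  then have small: "(1 + \<alpha>) * M powr (\<alpha> - 1) * C1 \<le> 1 / 2" using C1 \<alpha> by (simp add: field_simps)
  \<comment> \<open>Then \<open>C0 * \<delta> = M / 2\<close>, the share of the free
    evolution.\<close>
  define \<delta> where "\<delta> = M / (2 * C0)"
  have \<delta>: "0 < \<delta>" using M C0(1) by (simp add: \<delta>_def)
  show ?thesis
  proof (intro exI[of _ \<delta>] conjI \<delta> allI impI)
    fix \<omega> :: "'a \<Rightarrow> 'b"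
    assume \<omega>[measurable]: "\<omega> \<in> borel_measurable lebesgue" and hom: "homogeneous_deg0 \<omega>"
      and ess: "esssup lebesgue (\<lambda>x. ennreal (norm (\<omega> x))) \<le> ennreal \<delta>"
    define \<Phi> where "\<Phi> = (\<lambda>x. (norm x powr (- (2 + \<gamma>) / (\<alpha> - 1))) *\<^sub>R \<omega> x)"
    have \<Phi>_eq: "\<Phi> = (\<lambda>x. (norm x powr (- s)) *\<^sub>R \<omega> x)" by (simp only: \<Phi>_def s_def minus_divide_left)
    have [measurable]: "(\<lambda>x::'a. norm x powr (- s)) \<in> borel_measurable lebesgue"
      by (rule measurable_completion) measurable
    have \<Phi>m[measurable]: "\<Phi> \<in> borel_measurable lebesgue" unfolding \<Phi>_eq by measurable
    have \<Phi>_le: "AE x in lebesgue. norm (\<Phi> x) \<le> \<delta> * norm x powr (- s)"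
      using esssup_AE[of "\<lambda>x. ennreal (norm (\<omega> x))" lebesgue]
    proof eventually_elim
      case (elim x)
      then have "ennreal (norm (\<omega> x)) \<le> ennreal \<delta>" using ess by (rule order_trans)
      then have "norm (\<omega> x) \<le> \<delta>" using \<delta> by (simp add: ennreal_le_iff)
      then show ?case by (simp add: \<Phi>_eq mult.commute mult_right_mono)
    qed
    \<comment> \<open>The free evolution is the same for \<open>\<Psi>\<close>, which makes it
      jointly Borel, while the homogeneity is read off from \<open>\<Phi>\<close>.\<close>
    obtain \<Psi> where \<Psi>[measurable]: "\<Psi> \<in> borel_measurable borel" and "AE x in lborel. \<Phi> x = \<Psi> x"
      using completion_ex_borel_measurable_euclidean[OF \<Phi>m] by auto
    then have \<Phi>\<Psi>: "AE x in lebesgue. \<Phi> x = \<Psi> x" by (intro AE_completion)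
    have \<Psi>m: "\<Psi> \<in> borel_measurable lebesgue" using \<Psi> by (intro measurable_completion) simp
    have "AE x in lebesgue. norm (\<Psi> x) \<le> \<delta> * norm x powr (- s)" using \<Phi>_le \<Phi>\<Psi> by eventually_elim simp
    then have \<Psi>_le: "AE x in lborel. norm (\<Psi> x) \<le> \<delta> * norm x powr (- s)"
      by (subst (asm) AE_completion_iff) auto
    have heat_eq: "heat t \<Phi> = heat t \<Psi>" for t
      by (intro ext heat_cong_AE \<Phi>m \<Psi>m \<Phi>\<Psi>)
    define L where "L t = heat t \<Phi>" for t
    have Lm: "(\<lambda>(t, x). L t x) \<in> borel_measurable (borel \<Otimes>\<^sub>M borel)"
    proof -
      have "(\<lambda>w. heat (fst w) \<Psi> (snd w)) \<in> borel_measurable (borel \<Otimes>\<^sub>M borel)"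
        by (rule borel_measurable_heat) measurable
      then show ?thesis by (simp add: L_def heat_eq case_prod_unfold)
    qed
    have L: "parabolic_bounded s (M / 2) L"
      unfolding parabolic_bounded_def
    proof (intro conjI Lm allI impI)
      fix t x assume t: "0 < (t::real)"
      have "M / 2 = C0 * \<delta>" using C0(1) by (simp add: \<delta>_def)
      then show "norm (L t x) \<le> M / 2 * parabolic_norm t x powr (- s)"
        using C0(2)[OF less_imp_le[OF \<delta>] \<Phi>m \<Phi>_le t, of x] by (simp only: L_def)
    qed
    have L_scale: "L (c\<^sup>2 * t) (c *\<^sub>R x) = c powr (- s) *\<^sub>R L t x" if c: "0 < c" and t: "0 < t" for c t x
      unfolding L_def
    proof (rule heat_homogeneous[OF \<Phi>m _ c t])
      have "AE y in lebesgue. \<omega> (c *\<^sub>R y) = \<omega> y" using hom c by (simp add: homogeneous_deg0_def)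
      then show "AE y in lebesgue. \<Phi> (c *\<^sub>R y) = c powr (- s) *\<^sub>R \<Phi> y"
        by eventually_elim (use c in \<open>simp add: \<Phi>_eq powr_mult\<close>)
    qed
    obtain u where u: "parabolic_bounded s M u"
      and lim: "\<And>t x. 0 < t \<Longrightarrow> (\<lambda>n. picard a \<gamma> \<alpha> L n t x) \<longlonglongrightarrow> u t x"
      and eq: "\<And>t x. 0 < t \<Longrightarrow> u t x = L t x + a *\<^sub>R duhamel t (\<lambda>\<tau>. hh_nonlinearity \<gamma> \<alpha> (u \<tau>)) x"
      using parabolic_bounded_fixed_point[OF \<gamma> s(1) \<alpha> s\<alpha> a less_imp_le[OF M] L less_imp_le[OF C1] near small] by blast
    let ?F = "\<lambda>\<tau>. hh_nonlinearity \<gamma> \<alpha> (u \<tau>)"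
    have F: "hardy_dominated \<gamma> s ((1 + \<alpha>) * M powr (\<alpha> - 1) * M) ?F"
      using M by (intro hardy_dominated_nonlinearity \<alpha> s\<alpha> u) simp
    have R: "0 \<le> C1 * parabolic_norm t x powr (- s)" for t and x :: 'a using C1 by simp
    have K: "u \<in> K_space \<gamma> \<alpha> k p"
      using s by (intro parabolic_bounded_mem_K_space[OF u M s_def _ assms(8) \<kappa>]) simp
    have sol: "hardy_henon_solution a \<gamma> \<alpha> \<Phi> u"
      unfolding hardy_henon_solution_def
    \<comment> \<open>The almost everywhere quantifiers in space and in time are discharged at every
      point, since all bounds hold there.\<close>
    proof (intro allI impI AE_I2 conjI)
      fix t x assume t: "0 < (t::real)"
      show "heat_defined t \<Phi> x" using C0(2)[OF less_imp_le[OF \<delta>] \<Phi>m \<Phi>_le t, of x] by simp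
      show "heat_defined (t - \<tau>) (?F \<tau>) x" if "\<tau> \<in> {0<..<t}" for \<tau>
        using that by (intro heat_defined_hardy_dominated[OF F \<gamma> s(1)]) auto
      show "set_integrable lebesgue {0<..<t} (\<lambda>\<tau>. heat (t - \<tau>) (?F \<tau>) x)"
        by (rule hardy_dominated_duhamel(1)[OF F near[OF t] R])
      show "u t x = heat t \<Phi> x + a *\<^sub>R (LINT \<tau>:{0<..<t}|lebesgue. heat (t - \<tau>) (?F \<tau>) x)"
        using eq[OF t, of x] by (simp add: L_def duhamel_def)
    qed
    have sim: "self_similar \<gamma> \<alpha> u"
      unfolding self_similar_def
    proof (intro allI impI)
      fix c t x assume c: "0 < (c::real)" and t: "0 < (t::real)"
      have "(\<lambda>n. picard a \<gamma> \<alpha> L n (c\<^sup>2 * t) (c *\<^sub>R x)) \<longlonglongrightarrow> u (c\<^sup>2 * t) (c *\<^sub>R x)"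
        using c t by (intro lim) simp
      moreover have "(\<lambda>n. picard a \<gamma> \<alpha> L n (c\<^sup>2 * t) (c *\<^sub>R x)) \<longlonglongrightarrow> c powr (- s) *\<^sub>R u t x"
      proof -
        have "picard a \<gamma> \<alpha> L n (c\<^sup>2 * t) (c *\<^sub>R x) = c powr (- s) *\<^sub>R picard a \<gamma> \<alpha> L n t x" for n
          by (rule picard_scaleR[OF Lm L_scale[OF c] s\<alpha> c t])
        then show ?thesis using tendsto_scaleR[OF tendsto_const lim[OF t]] by simp
      qed
      ultimately have "u (c\<^sup>2 * t) (c *\<^sub>R x) = c powr (- s) *\<^sub>R u t x" by (rule LIMSEQ_unique)
      then show "(c powr ((2 + \<gamma>) / (\<alpha> - 1))) *\<^sub>R u (c\<^sup>2 * t) (c *\<^sub>R x) = u t x"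
        using c by (simp add: s_def[symmetric] powr_add[symmetric])
    qed
    have um: "u t \<in> borel_measurable lebesgue" for t
      using u measurable_Pair2[of "\<lambda>(t, x). u t x" borel borel borel t]
      by (intro measurable_completion) (simp add: parabolic_bounded_def)
    have par_le: "AE x in lebesgue. norm (f x) \<le> N * norm x powr (- s)"
      if f: "\<And>x. norm (f x) \<le> N * parabolic_norm t x powr (- s)" and N: "0 \<le> N" for f :: "'a \<Rightarrow> 'b" and N t
      using AE_lebesgue_nonzero[where 'a='a]
    proof eventually_elim
      case (elim x)
      then show ?case
        using N s by (intro order_trans[OF f] mult_left_mono parabolic_norm_powr_le_norm) auto
    qed
    have tmp_u: "tempered_function (u t)" if t: "0 < t" for t
      using u t M s by (intro tempered_function_norm_powr[of s M] um par_le[of _ M t]) (auto simp: parabolic_bounded_def)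
    have tmp_L: "tempered_function (L t)" if t: "0 < t" for t
    proof (rule tempered_function_norm_powr[of s "M / 2"])
      show "L t \<in> borel_measurable lebesgue"
        using measurable_Pair2[OF Lm, of t] by (intro measurable_completion) simp
      show "AE x in lebesgue. norm (L t x) \<le> M / 2 * norm x powr (- s)"
        using L t M by (intro par_le[of _ "M / 2" t]) (auto simp: parabolic_bounded_def)
    qed (use s M in auto)
    have tmp_D: "tempered_function (duhamel t ?F)" if t: "0 < t" for t
    proof (rule tempered_function_norm_powr[of s "(1 + \<alpha>) * M powr (\<alpha> - 1) * M * C1"])
      show "duhamel t ?F \<in> borel_measurable lebesgue"
        using measurable_Pair2[OF borel_measurable_duhamel[OF hardy_dominatedD(2)[OF F]], of t]
        by (intro measurable_completion) simp
      show "AE x in lebesgue. norm (duhamel t ?F x) \<le> (1 + \<alpha>) * M powr (\<alpha> - 1) * M * C1 * norm x powr (- s)"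
        using hardy_dominated_duhamel(2)[OF F near[OF t] R] \<alpha> M C1
        by (intro par_le[of _ "(1 + \<alpha>) * M powr (\<alpha> - 1) * M * C1" t]) (auto simp: mult.assoc)
    qed (use s M \<alpha> C1 in auto)
    have tmp_\<Phi>: "tempered_function \<Phi>"
      using s \<delta> by (intro tempered_function_norm_powr[OF _ _ _ \<Phi>m \<Phi>_le]) auto
    have "((\<lambda>t. distribution_of (u t) \<phi>) \<longlongrightarrow> distribution_of \<Phi> \<phi>) (at_right 0)" if \<phi>: "\<phi> \<in> schwartz" for \<phi>
    proof (rule tendsto_at_right_0_sequentially)
      fix X :: "nat \<Rightarrow> real" assume X: "\<And>i. 0 < X i" "X \<longlonglongrightarrow> 0"
      \<comment> \<open>\<open>\<Psi>\<close> replaces \<open>\<Phi>\<close> because the limit of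
        the free evolution is proved for Borel data; the integral may be split as both terms are
        tempered functions.\<close>
      have split: "distribution_of (u t) \<phi> = distribution_of (heat t \<Psi>) \<phi> + a *\<^sub>R distribution_of (duhamel t ?F) \<phi>"
        if t: "0 < t" for t
      proof -
        have "integrable lebesgue (\<lambda>x. L t x * \<phi> x)" "integrable lebesgue (\<lambda>x. duhamel t ?F x * \<phi> x)"
          using tmp_L[OF t] tmp_D[OF t] \<phi> by (auto simp: tempered_function_def)
        then show ?thesis
          unfolding distribution_of_def eq[OF t] distrib_right by (simp add: L_def heat_eq)
      qed
      have "(\<lambda>i. distribution_of (heat (X i) \<Psi>) \<phi> + a *\<^sub>R distribution_of (duhamel (X i) ?F) \<phi>)
        \<longlonglongrightarrow> distribution_of \<Psi> \<phi> + a *\<^sub>R 0"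
        using C1 \<delta>
        by (intro tendsto_add tendsto_scaleR tendsto_const distribution_of_heat_tendsto[OF s _ \<Psi> \<Psi>_le \<phi> X]
            distribution_of_duhamel_tendsto[OF F s _ B near far \<phi> X]) auto
      moreover have "distribution_of \<Psi> \<phi> = distribution_of \<Phi> \<phi>"
      proof -
        have [measurable]: "\<phi> \<in> borel_measurable lebesgue"
          using schwartz_borel_measurable(1)[OF \<phi>] by (intro measurable_completion) simp
        note [measurable] = \<Psi>m
        show ?thesis unfolding distribution_of_def
        proof (rule integral_cong_AE)
          show "AE x in lebesgue. \<Psi> x * \<phi> x = \<Phi> x * \<phi> x" using \<Phi>\<Psi> by eventually_elim simp
        qed measurable
      qed
      ultimately show "(\<lambda>i. distribution_of (u (X i)) \<phi>) \<longlonglongrightarrow> distribution_of \<Phi> \<phi>"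
        using X(1) by (simp add: split)
    qed
    then have "tends_in_tempered_at_0 u \<Phi>"
      using tmp_u tmp_\<Phi> by (simp add: tends_in_tempered_at_0_def)
    with K sol sim show "let \<Phi> = (\<lambda>x. (norm x powr (- (2 + \<gamma>) / (\<alpha> - 1))) *\<^sub>R \<omega> x) in
            \<exists>u. u \<in> K_space \<gamma> \<alpha> k p \<and> hardy_henon_solution a \<gamma> \<alpha> \<Phi> u \<and>
                self_similar \<gamma> \<alpha> u \<and> tends_in_tempered_at_0 u \<Phi>"
      unfolding Let_def \<Phi>_def[symmetric] by blast
  qed
qed

end
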